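(* Let $\Omega=\{z\in\mathbb{C}:|z|<1\}$ and $\Omega_h=\{z\in\Omega:\operatorname{Im}z>0\}$ (identifying $\mathbb{R}^2$ with $\mathbb{C}$). Let $0<\alpha<\frac{\pi}{2}$ and let $I$ be the arc of the unit circle of points with polar angle in $[\frac{\pi}{2}-\alpha,\frac{\pi}{2}+\alpha]$. Let $\gamma\in L^2(\Omega)$ be real-valued and vanish in a neighborhood of the endpoints of $I$. Let $\psi:\Omega_h\to\Omega$ be the conformal map given in the context, and for $n\ge1$ let $f_n=g_n$ be the function on $I$ given by $f_n=\sin(n\,\cdot)\circ\psi^{-1}$, i.e. $f_n(\psi(e^{i\phi}))=\sin(n\phi)$ for $\phi\in[0,\pi]$. Then $\gamma$ is recovered from the linearized incomplete Dirichlet-to-Neumann operator ${\Lambda^{inc}_{1,\gamma}}'$ with data on $I$ (see context) by $$\gamma=\Big[\frac12\sum_{n=0}^\infty L_n^0(r)\,p_{n,0}+\sum_{k=1}^\infty\sum_{n=0}^\infty L_n^k(r)\cos(k\phi)\,p_{n,k}\Big]\circ\psi^{-1},$$ where the bracket is a series in polar coordinates $(r,\phi)$ on $\Omega_h$ converging in $L^2(\Omega_h)$, and $$p_{n,k}=\sum_{l=0}^n 2(-1)^{n-l}(2n+k+1)\frac{\prod_{j=0}^{n-1}(1+k+l+j)}{l!\,(n-l)!}\cdot\frac{2\langle{\Lambda^{inc}_{1,\gamma}}'f_{l+1},g_{l+k+1}\rangle}{(l+1)(l+1+k)\pi}.$$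
   Context: For a function $f$ on $I$ whose extension by zero $f^e$ to $\partial\Omega$ is in $H^{1/2}(\partial\Omega)$, $u_{f,1}\in H^1(\Omega)$ is the harmonic function in $\Omega$ with boundary values $f^e$, and $\langle{\Lambda^{inc}_{1,\gamma}}'f,g\rangle:=\int_\Omega\gamma\,\nabla u_{f,1}\cdot\nabla u_{g,1}\,dx$ (whenever the integral converges absolutely). The map $\psi=\sigma\circ\theta$, where $$\theta(z)=\frac{(1+z)^2-i(1-z)^2}{(1+z)^2+i(1-z)^2},\qquad \sigma(z)=e^{i\mu}\frac{z-w}{\overline{w}z-1},\quad \mu=\pi,\quad w=-i\frac{\cos\alpha}{1+\sin\alpha}.$$ It maps $\Omega_h$ conformally onto $\Omega$, extends to a homeomorphism $\overline{\Omega_h}\to\overline{\Omega}$, satisfies $\psi(1)=e^{i(\pi/2-\alpha)}$, $\psi(-1)=e^{i(\pi/2+\alpha)}$, and maps the upper half circle onto $I$. For integers $k\ge0$, $n\ge0$: $L_n^k(x):=\sum_{l=0}^n c^k_{l,n}x^{2l+k}$ with $c^k_{l,n}:=\dfrac{\prod_{j=0}^{n-1}(l+j+k+1)}{\prod_{j=0,\,j\ne l}^{n}(l-j)}$. Empty products equal $1$. *)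

theory Defs
  imports "HOL-Analysis.Analysis"
begin

definition L2_fun :: "'a measure \<Rightarrow> ('a \<Rightarrow> 'b::real_normed_vector) \<Rightarrow> bool" where
  "L2_fun M f \<longleftrightarrow> f \<in> borel_measurable M \<and> integrable M (\<lambda>x. (norm (f x))\<^sup>2)"

text \<open>Membership is part of the definition, since the Bochner integral of a
  non-integrable function is \<open>0\<close>.\<close>

definition L2_tendsto ::
    "'a measure \<Rightarrow> (nat \<Rightarrow> 'a \<Rightarrow> 'b::real_normed_vector) \<Rightarrow> ('a \<Rightarrow> 'b) \<Rightarrow> bool" where
  "L2_tendsto M s f \<longleftrightarrow>
     (\<forall>j. L2_fun M (s j)) \<and> L2_fun M f \<and>
     (\<lambda>j. LINT x|M. (norm (s j x - f x))\<^sup>2) \<longlonglongrightarrow> 0"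

definition L2_sums ::
    "'a measure \<Rightarrow> (nat \<Rightarrow> 'a \<Rightarrow> 'b::real_normed_vector) \<Rightarrow> ('a \<Rightarrow> 'b) \<Rightarrow> bool" where
  "L2_sums M f F \<longleftrightarrow> L2_tendsto M (\<lambda>N x. \<Sum>n<N. f n x) F"

text \<open>The plane is the type of complex numbers, with directions \<open>1\<close> and \<open>\<i>\<close> for the
  two coordinates and with its real inner product \<open>z \<bullet> w\<close>.\<close>

definition pdiff :: "complex \<Rightarrow> (complex \<Rightarrow> real) \<Rightarrow> complex \<Rightarrow> real" where
  "pdiff v u z = frechet_derivative u (at z) v"

definition grad :: "(complex \<Rightarrow> real) \<Rightarrow> complex \<Rightarrow> complex" where
  "grad u z = Complex (pdiff 1 u z) (pdiff \<i> u z)"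

text \<open>Intended for open \<open>S\<close>.\<close>

fun Ck_on :: "nat \<Rightarrow> complex set \<Rightarrow> (complex \<Rightarrow> real) \<Rightarrow> bool" where
  "Ck_on 0 S u \<longleftrightarrow> continuous_on S u"
| "Ck_on (Suc k) S u \<longleftrightarrow>
     (\<forall>z\<in>S. u differentiable (at z)) \<and> Ck_on k S (pdiff 1 u) \<and> Ck_on k S (pdiff \<i> u)"

definition smooth_on :: "complex set \<Rightarrow> (complex \<Rightarrow> real) \<Rightarrow> bool" where
  "smooth_on S u \<longleftrightarrow> (\<forall>k. Ck_on k S u)"

definition harmonic_on :: "complex set \<Rightarrow> (complex \<Rightarrow> real) \<Rightarrow> bool" where
  "harmonic_on S u \<longleftrightarrow>
     Ck_on 2 S u \<and> (\<forall>z\<in>S. pdiff 1 (pdiff 1 u) z + pdiff \<i> (pdiff \<i> u) z = 0)"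

abbreviation disc :: "complex set" where
  "disc \<equiv> ball 0 1"

definition test_function :: "complex set \<Rightarrow> (complex \<Rightarrow> real) \<Rightarrow> bool" where
  "test_function S \<phi> \<longleftrightarrow>
     smooth_on UNIV \<phi> \<and> compact (closure {z. \<phi> z \<noteq> 0}) \<and> closure {z. \<phi> z \<noteq> 0} \<subseteq> S"

definition weak_gradient ::
    "complex set \<Rightarrow> (complex \<Rightarrow> real) \<Rightarrow> (complex \<Rightarrow> complex) \<Rightarrow> bool" where
  "weak_gradient S u G \<longleftrightarrow>
     (\<forall>\<phi>. test_function S \<phi> \<longrightarrow> (\<forall>v\<in>{1, \<i>}.
        (LINT z|lebesgue_on S. u z * pdiff v \<phi> z) =
        - (LINT z|lebesgue_on S. (G z \<bullet> v) * \<phi> z)))"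

definition H1_with_gradient ::
    "complex set \<Rightarrow> (complex \<Rightarrow> real) \<Rightarrow> (complex \<Rightarrow> complex) \<Rightarrow> bool" where
  "H1_with_gradient S u G \<longleftrightarrow>
     L2_fun (lebesgue_on S) u \<and> L2_fun (lebesgue_on S) G \<and> weak_gradient S u G"

definition H1 :: "complex set \<Rightarrow> (complex \<Rightarrow> real) \<Rightarrow> bool" where
  "H1 S u \<longleftrightarrow> (\<exists>G. H1_with_gradient S u G)"

text \<open>The trace operator is the continuous extension, from \<open>H\<^sup>1\<close> of the disc to \<open>L\<^sup>2\<close> of the
  circle, of the restriction map on functions that are smooth up to the boundary.\<close>

definition has_trace :: "(complex \<Rightarrow> real) \<Rightarrow> (complex \<Rightarrow> real) \<Rightarrow> bool" where
  "has_trace u h \<longleftrightarrow>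
     (\<exists>G v. H1_with_gradient disc u G \<and>
        (\<forall>j. \<exists>U. open U \<and> closure disc \<subseteq> U \<and> smooth_on U (v j)) \<and>
        L2_tendsto (lebesgue_on disc) v u \<and>
        L2_tendsto (lebesgue_on disc) (\<lambda>j. grad (v j)) G \<and>
        L2_tendsto (lebesgue_on {0..2 * pi}) (\<lambda>j t. v j (cis t)) (\<lambda>t. h (cis t)))"

text \<open>The space \<open>H\<^sup>1\<^sup>/\<^sup>2\<close> of the unit circle is the trace space of \<open>H\<^sup>1\<close> of the disc.\<close>

definition H_half :: "(complex \<Rightarrow> real) \<Rightarrow> bool" where
  "H_half h \<longleftrightarrow> (\<exists>u. H1 disc u \<and> has_trace u h)"

definition ext0 :: "complex set \<Rightarrow> (complex \<Rightarrow> real) \<Rightarrow> complex \<Rightarrow> real" where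
  "ext0 I f z = (if z \<in> I then f z else 0)"

text \<open>The conditions determine the function on the disc only, which is where it is used.\<close>

definition harmonic_ext :: "complex set \<Rightarrow> (complex \<Rightarrow> real) \<Rightarrow> complex \<Rightarrow> real" where
  "harmonic_ext I f = (SOME u. harmonic_on disc u \<and> H1 disc u \<and> has_trace u (ext0 I f))"

definition dtn_lin ::
    "complex set \<Rightarrow> (complex \<Rightarrow> real) \<Rightarrow> (complex \<Rightarrow> real) \<Rightarrow> (complex \<Rightarrow> real) \<Rightarrow> real" where
  "dtn_lin I \<gamma> f g =
     (LINT z|lebesgue_on disc. \<gamma> z * (grad (harmonic_ext I f) z \<bullet> grad (harmonic_ext I g) z))"

text \<open>The pairing is defined only where the integral converges absolutely.\<close>

definition dtn_lin_defined ::
    "complex set \<Rightarrow> (complex \<Rightarrow> real) \<Rightarrow> (complex \<Rightarrow> real) \<Rightarrow> (complex \<Rightarrow> real) \<Rightarrow> bool" where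
  "dtn_lin_defined I \<gamma> f g \<longleftrightarrow>
     H_half (ext0 I f) \<and> H_half (ext0 I g) \<and>
     integrable (lebesgue_on disc)
       (\<lambda>z. \<gamma> z * (grad (harmonic_ext I f) z \<bullet> grad (harmonic_ext I g) z))"

definition half_disc :: "complex set" where
  "half_disc = {z \<in> disc. Im z > 0}"

definition circ_arc :: "real \<Rightarrow> complex set" where
  "circ_arc \<alpha> = cis ` {pi / 2 - \<alpha> .. pi / 2 + \<alpha>}"

definition theta_map :: "complex \<Rightarrow> complex" where
  "theta_map z = ((1 + z)\<^sup>2 - \<i> * (1 - z)\<^sup>2) / ((1 + z)\<^sup>2 + \<i> * (1 - z)\<^sup>2)"

definition sigma_map :: "real \<Rightarrow> complex \<Rightarrow> complex" where
  "sigma_map \<alpha> z =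
     (let w = - \<i> * of_real (cos \<alpha> / (1 + sin \<alpha>)) in cis pi * ((z - w) / (cnj w * z - 1)))"

definition psi :: "real \<Rightarrow> complex \<Rightarrow> complex" where
  "psi \<alpha> = sigma_map \<alpha> \<circ> theta_map"

definition psi_inv :: "real \<Rightarrow> complex \<Rightarrow> complex" where
  "psi_inv \<alpha> = inv_into (closure half_disc) (psi \<alpha>)"

definition sine_data :: "real \<Rightarrow> nat \<Rightarrow> complex \<Rightarrow> real" where
  "sine_data \<alpha> n \<zeta> = sin (real n * Arg (psi_inv \<alpha> \<zeta>))"

definition c_coeff :: "nat \<Rightarrow> nat \<Rightarrow> nat \<Rightarrow> real" where
  "c_coeff k l n =
     (\<Prod>j<n. real (l + j + k + 1)) / (\<Prod>j\<in>{0..n} - {l}. real l - real j)"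

definition L_poly :: "nat \<Rightarrow> nat \<Rightarrow> real \<Rightarrow> real" where
  "L_poly n k x = (\<Sum>l=0..n. c_coeff k l n * x ^ (2 * l + k))"

definition p_coeff :: "real \<Rightarrow> (complex \<Rightarrow> real) \<Rightarrow> nat \<Rightarrow> nat \<Rightarrow> real" where
  "p_coeff \<alpha> \<gamma> n k =
     (\<Sum>l=0..n. 2 * (-1) ^ (n - l) * real (2 * n + k + 1) *
        ((\<Prod>j<n. real (1 + k + l + j)) / (fact l * fact (n - l))) *
        (2 * dtn_lin (circ_arc \<alpha>) \<gamma> (sine_data \<alpha> (l + 1)) (sine_data \<alpha> (l + k + 1)) /
           (real (l + 1) * real (l + 1 + k) * pi)))"

end

theory Submission
  imports Defs "HOL-Complex_Analysis.Complex_Analysis"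
begin

text \<open>The function \<open>Im ((\<psi>\<^sup>-\<^sup>1)\<^sup>n)\<close> is the harmonic extension of the \<open>n\<close>-th datum. The bilinear form is
  conformally invariant, so with \<open>m = l + 1\<close> and \<open>n = l + k + 1\<close> it becomes \<open>m n\<close> times the moment
  of \<open>\<gamma> \<circ> \<psi>\<close> against \<open>r\<^sup>2\<^sup>l\<^sup>+\<^sup>k cos (k \<phi>)\<close> over the half disc. Orthogonalising these moment
  functions for each \<open>k\<close> gives \<open>L\<^sub>n\<^sup>k(r) cos (k \<phi>)\<close>, so that the asserted series is the orthogonal
  expansion of \<open>\<gamma> \<circ> \<psi>\<close>. The system is complete by Stone--Weierstrass, because the functions
  \<open>|z|\<^sup>2\<^sup>l Re (z\<^sup>k)\<close> span an algebra that separates the points of the closed half disc.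
  That \<open>\<gamma> \<circ> \<psi>\<close> is square integrable uses that \<open>\<psi>'\<close> vanishes only at \<open>\<plusminus>1\<close>, which \<open>\<psi>\<close> maps to
  the endpoints of the arc.\<close>

section \<open>Change of variables in the plane\<close>

text \<open>The pairing is defined through \<open>harmonic_ext\<close>, a \<open>SOME\<close>
  choice, so exhibiting one harmonic function with the right trace does not evaluate it: a harmonic
  function must be determined by its trace. This is the main obstacle, since a trace is only an L2
  limit of boundary values of approximants that need not be harmonic. It is met with Fourier
  coefficients: those of a harmonic function on the circle of radius \<open>r\<close> are
  \<open>r ^ k\<close> times a constant, and averaging over thin annuli identifies the constant with
  the coefficient of the trace. The sine data fit because the complement of the arc corresponds to
  the real diameter, where \<open>Im (z ^ n)\<close> vanishes, so the extension by zero comes for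
  free. The coefficients of \<open>L_poly\<close> are Lagrange weights: integrating
  \<open>L_poly n k\<close> against \<open>r ^ (2 * i + k)\<close> with weight \<open>r\<close>
  evaluates an interpolated polynomial at one of its roots if \<open>i < n\<close>. The factor
  \<open>1 / 2\<close> in front of \<open>k = 0\<close> appears because the constant function has
  squared norm \<open>pi\<close> over the angle and the other cosines have
  \<open>pi / 2\<close>.\<close>

definition vec2_complex :: "real^2 \<Rightarrow> complex" where
  "vec2_complex v = Complex (v $ 1) (v $ 2)"

definition complex_vec2 :: "complex \<Rightarrow> real^2" where
  "complex_vec2 z = vector [Re z, Im z]"

lemma vec2_complex_inverse [simp]:
  "complex_vec2 (vec2_complex v) = v" "vec2_complex (complex_vec2 z) = z"
  by (auto simp: vec2_complex_def complex_vec2_def vec_eq_iff forall_2)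

lemma linear_vec2_complex: "linear vec2_complex" and linear_complex_vec2: "linear complex_vec2"
  by (auto intro!: linearI simp: vec2_complex_def complex_vec2_def vec_eq_iff forall_2 complex_eq_iff)

lemma measurable_vec2_complex [measurable]: "vec2_complex \<in> borel_measurable borel"
  and measurable_complex_vec2 [measurable]: "complex_vec2 \<in> borel_measurable borel"
  using linear_vec2_complex linear_complex_vec2
  by (auto intro!: borel_measurable_continuous_onI linear_continuous_on simp: linear_conv_bounded_linear)

text \<open>Lebesgue measure is determined by its values on boxes, and the coordinate map pulls a
  box back to a box with the same side lengths.\<close>

lemma distr_vec2_complex: "distr lborel lborel vec2_complex = lborel"
proof (rule sym, rule lborel_eqI)
  fix l u :: complex
  assume lu: "\<And>b. b \<in> Basis \<Longrightarrow> l \<bullet> b \<le> u \<bullet> b"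
  have "Re l \<le> Re u" "Im l \<le> Im u"
    using lu[of 1] lu[of \<i>] by (auto simp: Basis_complex_def)
  moreover have "vec2_complex -` box l u = box (complex_vec2 l) (complex_vec2 u)"
    by (auto simp: vec2_complex_def complex_vec2_def mem_box_cart forall_2 mem_box Basis_complex_def)
  ultimately show "emeasure (distr lborel lborel vec2_complex) (box l u) = (\<Prod>b\<in>Basis. (u - l) \<bullet> b)"
    apply (subst emeasure_distr)
      apply (simp_all add: emeasure_lborel_box_eq)
    apply (auto simp: Basis_complex_def Basis_vec_def UNIV_2 axis_eq_axis inner_axis complex_vec2_def)
    done
qed auto

lemma distr_complex_vec2: "distr lborel lborel complex_vec2 = lborel"
proof -
  have "distr lborel lborel complex_vec2 = distr (distr lborel lborel vec2_complex) lborel complex_vec2"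
    by (simp add: distr_vec2_complex)
  also have "\<dots> = distr lborel lborel (\<lambda>x. x)"
    by (subst distr_distr) (auto simp: o_def)
  finally show ?thesis by (simp add: distr_id2)
qed

text \<open>Borel measurability alone does not give measurability for the completed sigma-algebras.
  It holds here because the image measure is Lebesgue measure, so that preimages of null sets are
  null.\<close>

lemma distr_lebesgue_of_distr_lborel:
  fixes T :: "'a::euclidean_space \<Rightarrow> 'b::euclidean_space"
  assumes [measurable]: "T \<in> borel_measurable borel" and T: "distr lborel lborel T = lborel"
  shows "distr lebesgue lebesgue T = lebesgue" "T \<in> lebesgue \<rightarrow>\<^sub>M lebesgue"
proof -
  have TM: "T \<in> lebesgue \<rightarrow>\<^sub>M lborel"
    by (rule measurable_completion) simp
  have D: "distr lebesgue lborel T = lborel"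
    using distr_completion[of T lborel lborel] T by simp
  then show "distr lebesgue lebesgue T = lebesgue"
    using completion.completion_distr_eq[OF TM] by simp
  show "T \<in> lebesgue \<rightarrow>\<^sub>M lebesgue"
    by (rule completion.measurable_completion2[OF TM]) (simp add: D)
qed

text \<open>\<open>F\<close> may fail to be measurable. As the inverse map preserves Lebesgue
  measure too, \<open>F\<close> and its pullback are measurable together, and otherwise both
  integrals have the default value \<open>0\<close>.\<close>

lemma integrable_vec2_complex:
  fixes F :: "complex \<Rightarrow> real"
  shows "integrable lebesgue (\<lambda>v. F (vec2_complex v)) \<longleftrightarrow> integrable lebesgue F"
    and "integral\<^sup>L lebesgue (\<lambda>v. F (vec2_complex v)) = integral\<^sup>L lebesgue F"
proof -
  note V = distr_lebesgue_of_distr_lborel[OF measurable_vec2_complex distr_vec2_complex]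
  note C = distr_lebesgue_of_distr_lborel[OF measurable_complex_vec2 distr_complex_vec2]
  have meas: "F \<in> borel_measurable lebesgue" if "(\<lambda>v. F (vec2_complex v)) \<in> borel_measurable lebesgue"
    using measurable_compose[OF C(2) that] by simp
  show eq: "integrable lebesgue (\<lambda>v. F (vec2_complex v)) \<longleftrightarrow> integrable lebesgue F"
  proof (cases "F \<in> borel_measurable lebesgue")
    case True
    then show ?thesis using integrable_distr_eq[OF V(2) True] by (simp add: V(1))
  next
    case False then show ?thesis using meas by (blast dest: borel_measurable_integrable)
  qed
  show "integral\<^sup>L lebesgue (\<lambda>v. F (vec2_complex v)) = integral\<^sup>L lebesgue F"
  proof (cases "F \<in> borel_measurable lebesgue")
    case True
    then show ?thesis using integral_distr[OF V(2) True] by (simp add: V(1))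
  next
    case False
    then show ?thesis using eq by (metis borel_measurable_integrable not_integrable_integral_eq)
  qed
qed

lemma absolutely_integrable_vec2_complex:
  fixes f :: "complex \<Rightarrow> real"
  shows "(\<lambda>v. f (vec2_complex v)) absolutely_integrable_on (vec2_complex -` S) \<and>
           integral (vec2_complex -` S) (\<lambda>v. f (vec2_complex v)) = b \<longleftrightarrow>
         f absolutely_integrable_on S \<and> integral S f = b" (is "?L1 \<and> ?L2 \<longleftrightarrow> ?R1 \<and> ?R2")
proof -
  have ind: "indicator (vec2_complex -` S) v = indicator S (vec2_complex v)" for v
    by (auto simp: indicator_def)
  have 1: "?L1 \<longleftrightarrow> ?R1"
    unfolding set_integrable_def ind
    using integrable_vec2_complex(1)[of "\<lambda>z. indicator S z *\<^sub>R f z"] by simp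
  have "integral (vec2_complex -` S) (\<lambda>v. f (vec2_complex v)) = integral S f" if ?L1 ?R1
    using set_lebesgue_integral_eq_integral(2)[OF that(1)] set_lebesgue_integral_eq_integral(2)[OF that(2)]
      integrable_vec2_complex(2)[of "\<lambda>z. indicator S z *\<^sub>R f z"]
    by (simp add: set_lebesgue_integral_def ind)
  with 1 show ?thesis by auto
qed

definition real_det :: "(complex \<Rightarrow> complex) \<Rightarrow> real" where
  "real_det L = Re (L 1) * Im (L \<i>) - Re (L \<i>) * Im (L 1)"

text \<open>Conjugating \<open>g\<close> with the coordinate isometry carries the transformation
  formula for \<open>real^n\<close> over to the complex plane; \<open>real_det\<close> is the
  determinant in the basis \<open>1\<close>, \<open>\<i>\<close>.\<close>

theorem has_absolute_integral_change_of_variables_complex: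
  fixes f :: "complex \<Rightarrow> real" and g :: "complex \<Rightarrow> complex"
  assumes S: "S \<in> sets lebesgue"
    and der: "\<And>z. z \<in> S \<Longrightarrow> (g has_derivative g' z) (at z within S)"
    and inj: "inj_on g S"
  shows "(\<lambda>z. \<bar>real_det (g' z)\<bar> * f (g z)) absolutely_integrable_on S \<and>
           integral S (\<lambda>z. \<bar>real_det (g' z)\<bar> * f (g z)) = b \<longleftrightarrow>
         f absolutely_integrable_on (g ` S) \<and> integral (g ` S) f = b"
proof -
  define G where "G = complex_vec2 \<circ> g \<circ> vec2_complex"
  define G' where "G' v = complex_vec2 \<circ> g' (vec2_complex v) \<circ> vec2_complex" for v
  let ?S = "vec2_complex -` S"
  have im: "?S = complex_vec2 ` S"
    by (auto simp: image_iff) (metis vec2_complex_inverse(1))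
  have gim: "vec2_complex -` (g ` S) = G ` ?S"
  proof safe
    fix x z assume "vec2_complex x = g z" "z \<in> S"
    then have "x = G (complex_vec2 z)" "complex_vec2 z \<in> ?S"
      unfolding G_def by (simp_all add: o_def) (metis vec2_complex_inverse(1))
    then show "x \<in> G ` ?S" by blast
  qed (auto simp: G_def)
  have S': "?S \<in> sets lebesgue"
    using measurable_sets[OF distr_lebesgue_of_distr_lborel(2)[OF measurable_vec2_complex distr_vec2_complex] S] by simp
  have der': "(G has_derivative G' v) (at v within ?S)" if "v \<in> ?S" for v
  proof -
    have "(vec2_complex has_derivative vec2_complex) (at v within ?S)"
      using linear_vec2_complex by (simp add: bounded_linear_imp_has_derivative linear_conv_bounded_linear)
    moreover have "(g has_derivative g' (vec2_complex v)) (at (vec2_complex v) within vec2_complex ` ?S)"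
      by (rule has_derivative_subset[OF der]) (use that in auto)
    moreover have "(complex_vec2 has_derivative complex_vec2) (at w within X)" for w X
      using linear_complex_vec2 by (simp add: bounded_linear_imp_has_derivative linear_conv_bounded_linear)
    ultimately show ?thesis
      unfolding G_def G'_def
      by (intro diff_chain_within) (auto simp: image_comp)
  qed
  have inj': "inj_on G ?S"
  proof (rule inj_onI)
    fix v w assume "v \<in> ?S" "w \<in> ?S" "G v = G w"
    then have "g (vec2_complex v) = g (vec2_complex w)"
      unfolding G_def o_def by (metis vec2_complex_inverse(2))
    then have "vec2_complex v = vec2_complex w"
      using inj \<open>v \<in> ?S\<close> \<open>w \<in> ?S\<close> by (simp add: inj_on_def)
    then show "v = w" by (metis vec2_complex_inverse(1))
  qed
  have [simp]: "vec2_complex (axis 1 1) = 1" "vec2_complex (axis 2 1) = \<i>"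
    by (auto simp: vec2_complex_def complex_eq_iff axis_def)
  have det: "det (matrix (G' v)) = real_det (g' (vec2_complex v))" for v
    by (simp add: det_2 matrix_def G'_def real_det_def complex_vec2_def)
  \<comment> \<open>The formula in coordinates concerns vector-valued integrands, so the real one
    passes through it as a vector of length one.\<close>
  let ?f = "\<lambda>x. vec (f (vec2_complex x)) :: real^1"
  have "(\<lambda>x. \<bar>det (matrix (G' x))\<bar> *\<^sub>R ?f (G x)) absolutely_integrable_on ?S \<and>
           integral ?S (\<lambda>x. \<bar>det (matrix (G' x))\<bar> *\<^sub>R ?f (G x)) = vec b
     \<longleftrightarrow> ?f absolutely_integrable_on (G ` ?S) \<and> integral (G ` ?S) ?f = vec b"
    by (rule has_absolute_integral_change_of_variables[OF S' der' inj'])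
  then have "(\<lambda>x. \<bar>det (matrix (G' x))\<bar> * f (vec2_complex (G x))) absolutely_integrable_on ?S \<and>
           integral ?S (\<lambda>x. \<bar>det (matrix (G' x))\<bar> * f (vec2_complex (G x))) = b
     \<longleftrightarrow> (\<lambda>x. f (vec2_complex x)) absolutely_integrable_on (G ` ?S) \<and> integral (G ` ?S) (\<lambda>x. f (vec2_complex x)) = b"
    unfolding absolutely_integrable_on_1_iff integral_on_1_eq
    by (auto simp: vec_eq_iff)
  then have "(\<lambda>x. \<bar>real_det (g' (vec2_complex x))\<bar> * f (g (vec2_complex x))) absolutely_integrable_on ?S \<and>
           integral ?S (\<lambda>x. \<bar>real_det (g' (vec2_complex x))\<bar> * f (g (vec2_complex x))) = b
     \<longleftrightarrow> (\<lambda>x. f (vec2_complex x)) absolutely_integrable_on (vec2_complex -` (g ` S)) \<and> 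
       integral (vec2_complex -` (g ` S)) (\<lambda>x. f (vec2_complex x)) = b"
    unfolding det gim by (simp add: G_def)
  then show ?thesis
    using absolutely_integrable_vec2_complex[where f = f and S = "g ` S" and b = b]
      absolutely_integrable_vec2_complex[where f = "\<lambda>z. \<bar>real_det (g' z)\<bar> * f (g z)" and S = S and b = b]
    by simp
qed

section \<open>The space of square integrable functions\<close>

lemma L2_fun_measurable: "L2_fun M f \<Longrightarrow> f \<in> borel_measurable M"
  by (simp add: L2_fun_def)

lemma L2_fun_real: "L2_fun M (f :: _ \<Rightarrow> real) \<longleftrightarrow> f \<in> borel_measurable M \<and> integrable M (\<lambda>x. (f x)\<^sup>2)"
  by (simp add: L2_fun_def)

text \<open>Stands in for Minkowski's inequality, since only squares of L2 norms are used.\<close>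

lemma norm_diff_square_le: "(norm (a - b :: 'b::real_normed_vector))\<^sup>2 \<le> 2 * (norm a)\<^sup>2 + 2 * (norm b)\<^sup>2"
proof -
  have "(norm (a - b))\<^sup>2 \<le> (norm a + norm b)\<^sup>2"
    by (intro power_mono norm_triangle_ineq4) auto
  also have "\<dots> \<le> 2 * (norm a)\<^sup>2 + 2 * (norm b)\<^sup>2"
    using zero_le_power2[of "norm a - norm b"] by (simp add: power2_eq_square algebra_simps)
  finally show ?thesis .
qed

lemma norm_add_square_le: "(norm (a + b :: 'b::real_normed_vector))\<^sup>2 \<le> 2 * (norm a)\<^sup>2 + 2 * (norm b)\<^sup>2"
  using norm_diff_square_le[of a "- b"] by simp

lemma add_square_le: "(a + b :: real)\<^sup>2 \<le> 2 * a\<^sup>2 + 2 * b\<^sup>2"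
  using norm_add_square_le[of a b] by simp

lemma L2_fun_diff:
  fixes f g :: "'a \<Rightarrow> 'b::{second_countable_topology, real_normed_vector}"
  assumes "L2_fun M f" "L2_fun M g"
  shows "L2_fun M (\<lambda>x. f x - g x)"
proof -
  have [measurable]: "f \<in> borel_measurable M" "g \<in> borel_measurable M"
    using assms by (auto simp: L2_fun_def)
  have "integrable M (\<lambda>x. 2 * (norm (f x))\<^sup>2 + 2 * (norm (g x))\<^sup>2)"
    using assms by (auto simp: L2_fun_def)
  then have "integrable M (\<lambda>x. (norm (f x - g x))\<^sup>2)"
    by (rule Bochner_Integration.integrable_bound) (use norm_diff_square_le in \<open>auto intro!: AE_I2\<close>)
  then show ?thesis by (auto simp: L2_fun_def)
qed

lemma L2_fun_zero [simp]: "L2_fun M (\<lambda>x. 0)"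
  by (simp add: L2_fun_def)

lemma L2_fun_add:
  fixes f g :: "'a \<Rightarrow> 'b::{second_countable_topology, real_normed_vector}"
  assumes "L2_fun M f" "L2_fun M g"
  shows "L2_fun M (\<lambda>x. f x + g x)"
  using L2_fun_diff[OF assms(1) L2_fun_diff[OF L2_fun_zero assms(2)]] by simp

lemma L2_fun_cmult: "L2_fun M f \<Longrightarrow> L2_fun M (\<lambda>x. (c::real) * f x)"
  by (auto simp: L2_fun_def power_mult_distrib)

lemma L2_fun_sum:
  fixes f :: "'i \<Rightarrow> 'a \<Rightarrow> real"
  shows "(\<And>i. i \<in> I \<Longrightarrow> L2_fun M (f i)) \<Longrightarrow> L2_fun M (\<lambda>x. \<Sum>i\<in>I. f i x)"
  by (induction I rule: infinite_finite_induct) (auto intro!: L2_fun_add)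

lemma L2_fun_mult_integrable:
  fixes f g :: "'a \<Rightarrow> real"
  assumes "L2_fun M f" "L2_fun M g"
  shows "integrable M (\<lambda>x. f x * g x)"
proof -
  have [measurable]: "f \<in> borel_measurable M" "g \<in> borel_measurable M"
    using assms by (auto simp: L2_fun_def)
  have "integrable M (\<lambda>x. (f x)\<^sup>2 + (g x)\<^sup>2)"
    using assms by (auto simp: L2_fun_def)
  then show ?thesis
  proof (rule Bochner_Integration.integrable_bound)
    have "\<bar>a * b\<bar> \<le> a\<^sup>2 + b\<^sup>2" for a b :: real
    proof -
      have "2 * \<bar>a * b\<bar> \<le> a\<^sup>2 + b\<^sup>2"
        using zero_le_power2[of "\<bar>a\<bar> - \<bar>b\<bar>"] by (simp add: power2_diff abs_mult)
      then show ?thesis by linarith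
    qed
    then show "AE x in M. norm (f x * g x) \<le> norm ((f x)\<^sup>2 + (g x)\<^sup>2)"
      by (auto intro!: AE_I2)
  qed auto
qed

lemma L2_fun_bounded:
  fixes f :: "'a \<Rightarrow> 'b::{second_countable_topology, real_normed_vector}"
  assumes "finite_measure M" "f \<in> borel_measurable M" "\<And>x. x \<in> space M \<Longrightarrow> norm (f x) \<le> B"
  shows "L2_fun M f"
proof -
  interpret finite_measure M by fact
  have "integrable M (\<lambda>x. (norm (f x))\<^sup>2)"
    by (rule integrable_const_bound[where B = "B\<^sup>2"])
      (use assms in \<open>auto intro!: AE_I2 power_mono\<close>)
  then show ?thesis using assms by (auto simp: L2_fun_def)
qed

lemma L2_fun_integrable:
  fixes f :: "'a \<Rightarrow> real"
  assumes "finite_measure M" "L2_fun M f"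
  shows "integrable M f"
proof -
  have "L2_fun M (\<lambda>x. 1::real)" by (rule L2_fun_bounded[OF assms(1), where B = 1]) auto
  from L2_fun_mult_integrable[OF assms(2) this] show ?thesis by simp
qed

lemma L2_tendsto_bounded_convergence:
  fixes f :: "'a \<Rightarrow> real"
  assumes "finite_measure M" and meas: "\<And>j. s j \<in> borel_measurable M" "f \<in> borel_measurable M"
    and bd: "\<And>j x. x \<in> space M \<Longrightarrow> \<bar>s j x\<bar> \<le> B" "\<And>x. x \<in> space M \<Longrightarrow> \<bar>f x\<bar> \<le> B"
    and lim: "AE x in M. (\<lambda>j. s j x) \<longlonglongrightarrow> f x"
  shows "L2_tendsto M s f"
proof -
  interpret finite_measure M by fact
  note [measurable] = meas
  have "(\<lambda>j. LINT x|M. (norm (s j x - f x))\<^sup>2) \<longlonglongrightarrow> (LINT x|M. 0)"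
  proof (rule integral_dominated_convergence[where w = "\<lambda>x. (2 * B)\<^sup>2"])
    show "AE x in M. (\<lambda>j. (norm (s j x - f x))\<^sup>2) \<longlonglongrightarrow> 0"
      using lim
    proof eventually_elim
      case (elim x)
      then have "(\<lambda>j. s j x - f x) \<longlonglongrightarrow> 0" by (simp add: LIM_zero)
      then have "(\<lambda>j. (norm (s j x - f x))\<^sup>2) \<longlonglongrightarrow> (norm (0::real))\<^sup>2" by (intro tendsto_intros)
      then show ?case by simp
    qed
    show "AE x in M. norm ((norm (s j x - f x))\<^sup>2) \<le> (2 * B)\<^sup>2" for j
    proof (rule AE_I2)
      fix x assume "x \<in> space M"
      then have "\<bar>s j x - f x\<bar> \<le> 2 * B" using bd[of x] by (smt (verit, ccfv_SIG))
      then show "norm ((norm (s j x - f x))\<^sup>2) \<le> (2 * B)\<^sup>2"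
        using power_mono[of "\<bar>s j x - f x\<bar>" "2 * B" 2] by simp
    qed
  qed auto
  moreover have "L2_fun M (s j)" for j by (rule L2_fun_bounded[OF assms(1), where B = B]) (use bd in auto)
  moreover have "L2_fun M f" by (rule L2_fun_bounded[OF assms(1), where B = B]) (use bd in auto)
  ultimately show ?thesis by (simp add: L2_tendsto_def)
qed

text \<open>Fatou's lemma applied to \<open>2 |s\<^sub>j|\<^sup>2 + 2 |f|\<^sup>2 - |s\<^sub>j - f|\<^sup>2\<close>.\<close>

lemma L2_tendsto_of_norm_le:
  fixes f :: "'a \<Rightarrow> 'b::{second_countable_topology, real_normed_vector}"
  assumes L2: "\<And>j. L2_fun M (s j)" "L2_fun M f"
    and le: "\<And>j. (LINT x|M. (norm (s j x))\<^sup>2) \<le> (LINT x|M. (norm (f x))\<^sup>2)"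
    and lim: "AE x in M. (\<lambda>j. s j x) \<longlonglongrightarrow> f x"
  shows "L2_tendsto M s f"
proof -
  note [measurable] = L2_fun_measurable[OF L2(1)] L2_fun_measurable[OF L2(2)]
  define g where "g j x = 2 * (norm (s j x))\<^sup>2 + 2 * (norm (f x))\<^sup>2 - (norm (s j x - f x))\<^sup>2" for j x
  have g0: "0 \<le> g j x" for j x using norm_diff_square_le[of "s j x" "f x"] by (simp add: g_def)
  have ints: "integrable M (\<lambda>x. (norm (s j x))\<^sup>2)" "integrable M (\<lambda>x. (norm (f x))\<^sup>2)"
      "integrable M (\<lambda>x. (norm (s j x - f x))\<^sup>2)" for j
    using L2 L2_fun_diff[OF L2(1) L2(2)] by (auto simp: L2_fun_def)
  then have ig: "integrable M (g j)" for j unfolding g_def by auto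
  define A where "A = (LINT x|M. (norm (f x))\<^sup>2)"
  have gi: "integral\<^sup>L M (g j) \<le> 4 * A - (LINT x|M. (norm (s j x - f x))\<^sup>2)" for j
    unfolding g_def using ints le[of j] by (simp add: A_def)
  have "ennreal (4 * A) = (\<integral>\<^sup>+x. ennreal (4 * (norm (f x))\<^sup>2) \<partial>M)"
    unfolding A_def using ints by (subst nn_integral_eq_integral) auto
  also have "\<dots> = (\<integral>\<^sup>+x. liminf (\<lambda>j. ennreal (g j x)) \<partial>M)"
  proof (rule nn_integral_cong_AE, use lim in eventually_elim)
    case (elim x)
    then have "(\<lambda>j. g j x) \<longlonglongrightarrow> 2 * (norm (f x))\<^sup>2 + 2 * (norm (f x))\<^sup>2 - (norm (f x - f x))\<^sup>2"
      unfolding g_def by (intro tendsto_intros)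
    then have "(\<lambda>j. ennreal (g j x)) \<longlonglongrightarrow> ennreal (4 * (norm (f x))\<^sup>2)"
      by (intro tendsto_ennrealI) simp
    then show ?case by (simp add: lim_imp_Liminf)
  qed
  also have "\<dots> \<le> liminf (\<lambda>j. \<integral>\<^sup>+x. ennreal (g j x) \<partial>M)"
    by (rule nn_integral_liminf) (simp add: g_def)
  also have "\<dots> = liminf (\<lambda>j. ennreal (integral\<^sup>L M (g j)))"
    using ig g0 by (subst nn_integral_eq_integral) auto
  finally have li: "ennreal (4 * A) \<le> liminf (\<lambda>j. ennreal (integral\<^sup>L M (g j)))" .
  have A0: "0 \<le> A" unfolding A_def by (intro integral_nonneg_AE) auto
  have "(\<lambda>j. LINT x|M. (norm (s j x - f x))\<^sup>2) \<longlonglongrightarrow> 0"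
  proof (rule order_tendstoI)
    fix e :: real assume "0 < e"
    have "eventually (\<lambda>j. ennreal (4 * A - e) < ennreal (integral\<^sup>L M (g j)) \<or> 4 * A < e) sequentially"
    proof (cases "4 * A < e")
      case False
      then have "ennreal (4 * A - e) < ennreal (4 * A)"
        using \<open>0 < e\<close> by (intro ennreal_lessI) auto
      then have "eventually (\<lambda>j. ennreal (4 * A - e) < ennreal (integral\<^sup>L M (g j))) sequentially"
        using li unfolding le_Liminf_iff by auto
      then show ?thesis by eventually_elim auto
    qed simp
    then show "eventually (\<lambda>j. (LINT x|M. (norm (s j x - f x))\<^sup>2) < e) sequentially"
    proof eventually_elim
      case (elim j)
      have "0 \<le> integral\<^sup>L M (g j)" by (intro integral_nonneg_AE) (use g0 in auto)
      with elim have "4 * A - e < integral\<^sup>L M (g j)"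
        by (smt (verit) ennreal_less_iff)
      then show ?case using gi[of j] by simp
    qed
  next
    fix e :: real assume "e < 0"
    then show "eventually (\<lambda>j. e < (LINT x|M. (norm (s j x - f x))\<^sup>2)) sequentially"
      by (intro always_eventually allI) (auto intro: less_le_trans[OF _ integral_nonneg_AE])
  qed
  then show ?thesis using L2 by (simp add: L2_tendsto_def)
qed

text \<open>Riesz-Fischer: a rapidly Cauchy subsequence converges almost everywhere, and by Fatou's
  lemma its pointwise limit is the L2 limit of the whole sequence. Completeness supplies the inner
  sums of the expansion.\<close>

theorem L2_complete:
  fixes s :: "nat \<Rightarrow> 'a \<Rightarrow> real"
  assumes L2: "\<And>j. L2_fun M (s j)"
    and Cauchy: "\<And>e. 0 < e \<Longrightarrow> \<exists>N. \<forall>m\<ge>N. \<forall>n\<ge>N. (LINT x|M. (s m x - s n x)\<^sup>2) < e"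
  obtains f where "L2_tendsto M s f"
proof -
  note [measurable] = L2_fun_measurable[OF L2]
  have id: "integrable M (\<lambda>x. (s m x - s n x)\<^sup>2)" for m n
    using L2_fun_diff[OF L2 L2, of m n] by (simp add: L2_fun_real)
  have "\<exists>N. \<forall>k. \<forall>m\<ge>N k. \<forall>n\<ge>N k. (LINT x|M. (s m x - s n x)\<^sup>2) < (1/4)^k"
    using Cauchy by (intro choice) auto
  then obtain N where N: "\<And>k m n. N k \<le> m \<Longrightarrow> N k \<le> n \<Longrightarrow> (LINT x|M. (s m x - s n x)\<^sup>2) < (1/4)^k"
    by blast
  \<comment> \<open>\<open>N\<close> need not be monotone. The sum makes \<open>\<phi> k\<close>
    dominate every \<open>N j\<close> with \<open>j \<le> k\<close>, and the summand
    \<open>k\<close> makes it tend to infinity.\<close>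
  define \<phi> where "\<phi> k = k + (\<Sum>i\<le>k. N i)" for k
  have \<phi>N: "N j \<le> \<phi> k" if "j \<le> k" for j k
    unfolding \<phi>_def using that member_le_sum[of j "{..k}" N] by (simp add: trans_le_add2)
  define d where "d k x = s (\<phi> (Suc k)) x - s (\<phi> k) x" for k x
  have [measurable]: "d k \<in> borel_measurable M" for k unfolding d_def by measurable
  have dint: "(LINT x|M. (d k x)\<^sup>2) < (1/4)^k" for k
    unfolding d_def by (intro N \<phi>N) auto
  have "(\<integral>\<^sup>+x. (\<Sum>k. ennreal ((3/2)^k * (d k x)\<^sup>2)) \<partial>M) = (\<Sum>k. \<integral>\<^sup>+x. ennreal ((3/2)^k * (d k x)\<^sup>2) \<partial>M)"
    by (rule nn_integral_suminf) auto
  also have "\<dots> \<le> (\<Sum>k. ennreal ((3/8)^k))"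
  proof (intro suminf_le allI)
    fix k
    have "(\<integral>\<^sup>+x. ennreal ((3/2)^k * (d k x)\<^sup>2) \<partial>M) = ennreal ((3/2)^k * (LINT x|M. (d k x)\<^sup>2))"
      using id[of "\<phi> (Suc k)" "\<phi> k"] by (subst nn_integral_eq_integral) (auto simp: d_def)
    also have "\<dots> \<le> ennreal ((3/2)^k * (1/4)^k)"
      using dint[of k] by (intro ennreal_leI mult_left_mono) auto
    finally show "(\<integral>\<^sup>+x. ennreal ((3/2)^k * (d k x)\<^sup>2) \<partial>M) \<le> ennreal ((3/8)^k)"
      by (simp add: power_mult_distrib[symmetric])
  qed auto
  also have "\<dots> = ennreal (\<Sum>k. (3/8)^k)"
    by (rule suminf_ennreal2) (auto intro!: summable_geometric)
  finally have "(\<integral>\<^sup>+x. (\<Sum>k. ennreal ((3/2)^k * (d k x)\<^sup>2)) \<partial>M) \<noteq> \<infinity>"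
    by (auto simp: top_unique)
  then have "AE x in M. (\<Sum>k. ennreal ((3/2)^k * (d k x)\<^sup>2)) \<noteq> \<infinity>"
    by (intro nn_integral_PInf_AE) auto
  then have conv: "AE x in M. convergent (\<lambda>k. s (\<phi> k) x)"
  proof eventually_elim
    case (elim x)
    then have "summable (\<lambda>k. (3/2)^k * (d k x)\<^sup>2)"
      by (intro summable_suminf_not_top) auto
    then have "summable (\<lambda>k. (2/3)^k + (3/2)^k * (d k x)\<^sup>2)"
      by (intro summable_add summable_geometric) auto
    then have "summable (\<lambda>k. d k x)"
    proof (rule summable_comparison_test'[where N = 0])
      fix k
      \<comment> \<open>This explains the weights \<open>(3/2)^k\<close>: their reciprocals are
        summable, and so are their products with the bounds \<open>(1/4)^k\<close> for the
        integrals, while one of the two summands always dominates \<open>d k x\<close>.\<close>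
      have "\<bar>d k x\<bar> \<le> (2/3)^k + (3/2)^k * (d k x)\<^sup>2"
      proof (cases "\<bar>d k x\<bar> \<le> (2/3)^k")
        case False
        then have "1 \<le> (3/2)^k * \<bar>d k x\<bar>"
          by (simp add: power_divide field_simps)
        then have "\<bar>d k x\<bar> * 1 \<le> \<bar>d k x\<bar> * ((3/2)^k * \<bar>d k x\<bar>)"
          by (rule mult_left_mono) auto
        also have "\<dots> = (3/2)^k * (d k x)\<^sup>2" by (simp add: power2_eq_square)
        finally have "\<bar>d k x\<bar> \<le> (3/2)^k * (d k x)\<^sup>2" by simp
        moreover have "(0::real) \<le> (2/3)^k" by simp
        ultimately show ?thesis by linarith
      qed (auto intro: add_increasing2)
      then show "norm (d k x) \<le> (2/3)^k + (3/2)^k * (d k x)\<^sup>2" by simp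
    qed
    then have "convergent (\<lambda>n. \<Sum>k<n. d k x)" by (simp add: summable_iff_convergent)
    then have "convergent (\<lambda>n. s (\<phi> n) x - s (\<phi> 0) x)"
      by (simp add: d_def sum_lessThan_telescope[of "\<lambda>n. s (\<phi> n) x"])
    then have "convergent (\<lambda>n. (s (\<phi> n) x - s (\<phi> 0) x) + s (\<phi> 0) x)"
      by (intro convergent_add convergent_const)
    then show ?case by simp
  qed
  define f where "f x = lim (\<lambda>k. s (\<phi> k) x)" for x
  have [measurable]: "f \<in> borel_measurable M" unfolding f_def by measurable
  have \<phi>_top: "\<phi> k \<ge> k" for k by (simp add: \<phi>_def)
  \<comment> \<open>Fatou's lemma along the subsequence turns the Cauchy bound into a bound for the
    distance to the limit.\<close>
  have fatou: "(\<integral>\<^sup>+x. ennreal ((s n x - f x)\<^sup>2) \<partial>M) \<le> ennreal e"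
    if "0 < e" and Ne: "\<forall>m\<ge>N'. \<forall>n\<ge>N'. (LINT x|M. (s m x - s n x)\<^sup>2) < e" and "n \<ge> N'" for e N' n
  proof -
    have "(\<integral>\<^sup>+x. ennreal ((s n x - f x)\<^sup>2) \<partial>M) = (\<integral>\<^sup>+x. liminf (\<lambda>k. ennreal ((s n x - s (\<phi> k) x)\<^sup>2)) \<partial>M)"
    proof (rule nn_integral_cong_AE, use conv in eventually_elim)
      case (elim x)
      then have "(\<lambda>k. s (\<phi> k) x) \<longlonglongrightarrow> f x" unfolding f_def by (simp add: convergent_LIMSEQ_iff)
      then have "(\<lambda>k. ennreal ((s n x - s (\<phi> k) x)\<^sup>2)) \<longlonglongrightarrow> ennreal ((s n x - f x)\<^sup>2)"
        by (intro tendsto_ennrealI tendsto_intros)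
      then show ?case by (metis lim_imp_Liminf trivial_limit_sequentially)
    qed
    also have "\<dots> \<le> liminf (\<lambda>k. \<integral>\<^sup>+x. ennreal ((s n x - s (\<phi> k) x)\<^sup>2) \<partial>M)"
      by (rule nn_integral_liminf) auto
    also have "\<dots> = liminf (\<lambda>k. ennreal (LINT x|M. (s n x - s (\<phi> k) x)\<^sup>2))"
      using id by (subst nn_integral_eq_integral) auto
    also have "\<dots> \<le> limsup (\<lambda>k. ennreal (LINT x|M. (s n x - s (\<phi> k) x)\<^sup>2))"
      by (rule Liminf_le_Limsup) simp
    also have "\<dots> \<le> ennreal e"
    proof (rule Limsup_bounded)
      show "\<forall>\<^sub>F k in sequentially. ennreal (LINT x|M. (s n x - s (\<phi> k) x)\<^sup>2) \<le> ennreal e"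
        using eventually_ge_at_top[of N']
      proof eventually_elim
        case (elim k)
        then have "\<phi> k \<ge> N'" using \<phi>_top[of k] by simp
        then show ?case using Ne \<open>n \<ge> N'\<close> by (intro ennreal_leI) (auto intro: less_imp_le)
      qed
    qed
    finally show ?thesis .
  qed
  obtain N1 where N1: "\<forall>m\<ge>N1. \<forall>n\<ge>N1. (LINT x|M. (s m x - s n x)\<^sup>2) < 1"
    using Cauchy[of 1] by auto
  have "integrable M (\<lambda>x. (s N1 x - f x)\<^sup>2)"
  proof (rule integrableI_bounded)
    show "(\<integral>\<^sup>+x. ennreal (norm ((s N1 x - f x)\<^sup>2)) \<partial>M) < \<infinity>"
      using fatou[OF _ N1, of N1] by (simp add: le_less_trans)
  qed auto
  then have "L2_fun M (\<lambda>x. s N1 x - f x)" by (simp add: L2_fun_real)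
  from L2_fun_diff[OF L2[of N1] this] have f2: "L2_fun M f" by simp
  have if': "integrable M (\<lambda>x. (s n x - f x)\<^sup>2)" for n
    using L2_fun_diff[OF L2[of n] f2] by (simp add: L2_fun_real)
  have "(\<lambda>j. LINT x|M. (norm (s j x - f x))\<^sup>2) \<longlonglongrightarrow> 0"
  proof (rule LIMSEQ_I)
    fix e :: real assume "0 < e"
    then obtain N' where N': "\<forall>m\<ge>N'. \<forall>n\<ge>N'. (LINT x|M. (s m x - s n x)\<^sup>2) < e/2"
      using Cauchy[of "e/2"] by auto
    have "norm ((LINT x|M. (norm (s n x - f x))\<^sup>2) - 0) < e" if "n \<ge> N'" for n
    proof -
      have "ennreal (LINT x|M. (s n x - f x)\<^sup>2) \<le> ennreal (e/2)"
        using fatou[OF _ N' that] \<open>0 < e\<close> if' by (subst nn_integral_eq_integral[symmetric]) auto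
      then have "(LINT x|M. (s n x - f x)\<^sup>2) \<le> e/2" using \<open>0 < e\<close> by (simp add: ennreal_le_iff)
      moreover have "0 \<le> (LINT x|M. (s n x - f x)\<^sup>2)" by (intro integral_nonneg_AE) auto
      ultimately show ?thesis using \<open>0 < e\<close> by simp
    qed
    then show "\<exists>N. \<forall>n\<ge>N. norm ((LINT x|M. (norm (s n x - f x))\<^sup>2) - 0) < e" by blast
  qed
  then have "L2_tendsto M s f" using L2 f2 by (simp add: L2_tendsto_def)
  then show ?thesis by (rule that)
qed


text \<open>The orthogonal functions are not normalised and \<open>h\<close> is arbitrary, so the
  formula serves twice: to compare the errors of approximations of \<open>h\<close>, and, with
  \<open>h = 0\<close>, to compute the norm of a block of the series.\<close>

lemma integral_square_diff_orthogonal_sum: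
  fixes E :: "'i \<Rightarrow> 'a \<Rightarrow> real"
  assumes E: "\<And>i. i \<in> I \<Longrightarrow> L2_fun M (E i)" and h: "L2_fun M h" and "finite I"
    and orth: "\<And>i j. i \<in> I \<Longrightarrow> j \<in> I \<Longrightarrow> i \<noteq> j \<Longrightarrow> (LINT x|M. E i x * E j x) = 0"
  shows "(LINT x|M. (h x - (\<Sum>i\<in>I. b i * E i x))\<^sup>2) =
    (LINT x|M. (h x)\<^sup>2) - 2 * (\<Sum>i\<in>I. b i * (LINT x|M. h x * E i x)) + (\<Sum>i\<in>I. (b i)\<^sup>2 * (LINT x|M. (E i x)\<^sup>2))"
proof -
  have i1: "integrable M (\<lambda>x. h x * E i x)" if "i \<in> I" for i
    by (rule L2_fun_mult_integrable[OF h E[OF that]])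
  have i2: "integrable M (\<lambda>x. E i x * E j x)" if "i \<in> I" "j \<in> I" for i j
    by (rule L2_fun_mult_integrable[OF E[OF that(1)] E[OF that(2)]])
  have i3: "integrable M (\<lambda>x. (h x)\<^sup>2)" using h by (simp add: L2_fun_real)
  have eq: "(h x - (\<Sum>i\<in>I. b i * E i x))\<^sup>2 =
      (h x)\<^sup>2 - 2 * (\<Sum>i\<in>I. b i * (h x * E i x)) + (\<Sum>i\<in>I. \<Sum>j\<in>I. b i * b j * (E i x * E j x))" for x
    by (simp add: power2_diff power2_eq_square sum_product sum_distrib_left sum_distrib_right algebra_simps)
  have "(LINT x|M. (h x - (\<Sum>i\<in>I. b i * E i x))\<^sup>2) =
      (LINT x|M. (h x)\<^sup>2) - 2 * (\<Sum>i\<in>I. b i * (LINT x|M. h x * E i x)) +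
      (\<Sum>i\<in>I. \<Sum>j\<in>I. b i * b j * (LINT x|M. E i x * E j x))"
    unfolding eq using i1 i2 i3 by simp
  also have "(\<Sum>i\<in>I. \<Sum>j\<in>I. b i * b j * (LINT x|M. E i x * E j x)) = (\<Sum>i\<in>I. (b i)\<^sup>2 * (LINT x|M. (E i x)\<^sup>2))"
  proof (rule sum.cong[OF refl])
    fix i assume "i \<in> I"
    have "(\<Sum>j\<in>I. b i * b j * (LINT x|M. E i x * E j x)) =
        (\<Sum>j\<in>I. if j = i then (b i)\<^sup>2 * (LINT x|M. (E i x)\<^sup>2) else 0)"
      using orth \<open>i \<in> I\<close> by (intro sum.cong) (auto simp: power2_eq_square)
    then show "(\<Sum>j\<in>I. b i * b j * (LINT x|M. E i x * E j x)) = (b i)\<^sup>2 * (LINT x|M. (E i x)\<^sup>2)"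
      using \<open>finite I\<close> \<open>i \<in> I\<close> by simp
  qed
  finally show ?thesis .
qed

lemma L2_tendsto_sum:
  fixes s :: "'i \<Rightarrow> nat \<Rightarrow> 'a \<Rightarrow> real"
  assumes "\<And>i. i \<in> I \<Longrightarrow> L2_tendsto M (s i) (f i)"
  shows "L2_tendsto M (\<lambda>j x. \<Sum>i\<in>I. s i j x) (\<lambda>x. \<Sum>i\<in>I. f i x)"
  using assms
proof (induction I rule: infinite_finite_induct)
  case (insert i I)
  have T: "L2_tendsto M (s i) (f i)" "L2_tendsto M (\<lambda>j x. \<Sum>i\<in>I. s i j x) (\<lambda>x. \<Sum>i\<in>I. f i x)"
    using insert by auto
  have L2: "L2_fun M (s i j)" "L2_fun M (f i)" "L2_fun M (\<lambda>x. \<Sum>i\<in>I. s i j x)" "L2_fun M (\<lambda>x. \<Sum>i\<in>I. f i x)" for j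
    using T by (auto simp: L2_tendsto_def)
  have L2d: "L2_fun M (\<lambda>x. s i j x - f i x)" "L2_fun M (\<lambda>x. (\<Sum>i\<in>I. s i j x) - (\<Sum>i\<in>I. f i x))" for j
    by (intro L2_fun_diff L2)+
  have L2s: "L2_fun M (\<lambda>x. (s i j x - f i x) + ((\<Sum>i\<in>I. s i j x) - (\<Sum>i\<in>I. f i x)))" for j
    by (intro L2_fun_add L2d)
  let ?D = "\<lambda>j. LINT x|M. (norm ((s i j x + (\<Sum>i\<in>I. s i j x)) - (f i x + (\<Sum>i\<in>I. f i x))))\<^sup>2"
  have "?D \<longlonglongrightarrow> 0"
  proof (rule tendsto_sandwich[where f = "\<lambda>_. 0"])
    show "\<forall>\<^sub>F j in sequentially. ?D j \<le> 2 * (LINT x|M. (norm (s i j x - f i x))\<^sup>2) +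
        2 * (LINT x|M. (norm ((\<Sum>i\<in>I. s i j x) - (\<Sum>i\<in>I. f i x)))\<^sup>2)"
    proof (intro always_eventually allI)
      fix j
      have "?D j = (LINT x|M. (norm ((s i j x - f i x) + ((\<Sum>i\<in>I. s i j x) - (\<Sum>i\<in>I. f i x))))\<^sup>2)"
        by (simp add: algebra_simps)
      also have "\<dots> \<le> (LINT x|M. 2 * (norm (s i j x - f i x))\<^sup>2 + 2 * (norm ((\<Sum>i\<in>I. s i j x) - (\<Sum>i\<in>I. f i x)))\<^sup>2)"
        using L2d[of j] L2s[of j] add_square_le
        by (intro integral_mono) (auto simp: L2_fun_def)
      finally show "?D j \<le> 2 * (LINT x|M. (norm (s i j x - f i x))\<^sup>2) +
        2 * (LINT x|M. (norm ((\<Sum>i\<in>I. s i j x) - (\<Sum>i\<in>I. f i x)))\<^sup>2)"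
        using L2d[of j] by (simp add: L2_fun_def)
    qed
    show "(\<lambda>j. 2 * (LINT x|M. (norm (s i j x - f i x))\<^sup>2) +
        2 * (LINT x|M. (norm ((\<Sum>i\<in>I. s i j x) - (\<Sum>i\<in>I. f i x)))\<^sup>2)) \<longlonglongrightarrow> 0"
      using T unfolding L2_tendsto_def by (auto intro!: tendsto_eq_intros)
    show "\<forall>\<^sub>F j in sequentially. 0 \<le> ?D j"
      by (intro always_eventually allI integral_nonneg_AE) auto
  qed simp
  then show ?case
    using insert L2 by (auto simp: L2_tendsto_def intro!: L2_fun_add)
qed (auto simp: L2_tendsto_def)

text \<open>The sum over \<open>n\<close> is taken for each \<open>k\<close> before the sum over
  \<open>k\<close>, so every inner limit has to exist by itself; Bessel's inequality makes it
  Cauchy. For the outer sum, a rectangle of Fourier coefficients approximates \<open>h\<close> at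
  least as well as any combination supported in a smaller rectangle, and density makes the latter
  error small.\<close>

theorem L2_iterated_orthogonal_expansion:
  fixes e :: "nat \<Rightarrow> nat \<Rightarrow> 'a \<Rightarrow> real"
  assumes e: "\<And>k n. L2_fun M (e k n)" and h: "L2_fun M h"
    and orth: "\<And>k n j m. (k, n) \<noteq> (j, m) \<Longrightarrow> (LINT x|M. e k n x * e j m x) = 0"
    and pos: "\<And>k n. (LINT x|M. (e k n x)\<^sup>2) > 0"
    and a: "\<And>k n. a k n = (LINT x|M. h x * e k n x) / (LINT x|M. (e k n x)\<^sup>2)"
    and dense: "\<And>\<epsilon>. 0 < \<epsilon> \<Longrightarrow> \<exists>b L. (LINT x|M. (h x - (\<Sum>k<L. \<Sum>n<L. b k n * e k n x))\<^sup>2) < \<epsilon>"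
  shows "\<exists>S. (\<forall>k. L2_sums M (\<lambda>n x. a k n * e k n x) (S k)) \<and> L2_tendsto M (\<lambda>K x. \<Sum>k\<le>K. S k x) h"
proof -
  define E where "E i = e (fst i) (snd i)" for i
  define A where "A i = a (fst i) (snd i)" for i
  define N where "N i = (LINT x|M. (E i x)\<^sup>2)" for i
  define D where "D b I = (LINT x|M. (h x - (\<Sum>i\<in>I. b i * E i x))\<^sup>2)" for b I
  have LE: "L2_fun M (E i)" for i using e by (simp add: E_def)
  have N0: "N i > 0" for i using pos by (simp add: N_def E_def)
  have orthE: "(LINT x|M. E i x * E j x) = 0" if "i \<noteq> j" for i j
    using orth[of "fst i" "snd i" "fst j" "snd j"] that by (auto simp: E_def prod_eq_iff)
  have cA: "(LINT x|M. h x * E i x) = A i * N i" for i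
    using pos[of "fst i" "snd i"] by (simp add: A_def N_def a E_def)
  \<comment> \<open>Completing the square: the error depends on \<open>b\<close> only through the
    squares of \<open>b i - A i\<close>, so Fourier coefficients are optimal and further indices can
    only lower the error.\<close>
  have Dexp: "D b I = (LINT x|M. (h x)\<^sup>2) + (\<Sum>i\<in>I. N i * ((b i - A i)\<^sup>2 - (A i)\<^sup>2))" if "finite I" for b I
  proof -
    have "D b I = (LINT x|M. (h x)\<^sup>2) - 2 * (\<Sum>i\<in>I. b i * (A i * N i)) + (\<Sum>i\<in>I. (b i)\<^sup>2 * N i)"
      unfolding D_def N_def cA[unfolded N_def, symmetric]
      by (rule integral_square_diff_orthogonal_sum) (use LE h that orthE in auto)
    also have "\<dots> = (LINT x|M. (h x)\<^sup>2) + (\<Sum>i\<in>I. (b i)\<^sup>2 * N i - 2 * (b i * (A i * N i)))"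
      by (simp add: sum_subtractf sum_distrib_left)
    finally show ?thesis by (simp add: power2_eq_square algebra_simps)
  qed
  have D0: "0 \<le> D b I" for b I unfolding D_def by (intro integral_nonneg_AE) auto
  have best: "D A I \<le> D b J" if "finite I" "J \<subseteq> I" for I J b
  proof -
    have "finite J" using that finite_subset by blast
    have "(\<Sum>i\<in>I. N i * (A i)\<^sup>2) \<ge> (\<Sum>i\<in>J. N i * (A i)\<^sup>2)"
      using that by (intro sum_mono2 mult_nonneg_nonneg less_imp_le[OF N0]) auto
    also have "(\<Sum>i\<in>J. N i * (A i)\<^sup>2) \<ge> (\<Sum>i\<in>J. N i * ((A i)\<^sup>2 - (b i - A i)\<^sup>2))"
      using N0 by (intro sum_mono mult_left_mono) (auto intro: less_imp_le)
    finally have "(\<Sum>i\<in>I. N i * (0 - (A i)\<^sup>2)) \<le> (\<Sum>i\<in>J. N i * ((b i - A i)\<^sup>2 - (A i)\<^sup>2))"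
      by (simp add: sum_negf algebra_simps sum_subtractf sum_distrib_left)
    then show ?thesis using that \<open>finite J\<close> by (simp add: Dexp)
  qed
  have "\<exists>f. L2_sums M (\<lambda>n x. a k n * e k n x) f" for k
  proof -
    let ?s = "\<lambda>m x. \<Sum>n<m. a k n * e k n x"
    have "summable (\<lambda>n. N (k, n) * (a k n)\<^sup>2)"
    proof (rule bounded_imp_summable)
      fix m
      have "0 \<le> D A ((\<lambda>n. (k, n)) ` {..m})" by (rule D0)
      also have "\<dots> = (LINT x|M. (h x)\<^sup>2) - (\<Sum>n\<le>m. N (k, n) * (a k n)\<^sup>2)"
        by (subst Dexp) (auto simp: sum.reindex inj_on_def A_def sum_negf)
      finally show "(\<Sum>n\<le>m. N (k, n) * (a k n)\<^sup>2) \<le> (LINT x|M. (h x)\<^sup>2)" by simp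
    qed (intro mult_nonneg_nonneg less_imp_le[OF N0] zero_le_power2)
    then have C: "\<exists>N'. \<forall>m\<ge>N'. \<forall>p. norm (\<Sum>n=m..<p. N (k, n) * (a k n)\<^sup>2) < \<epsilon>" if "0 < \<epsilon>" for \<epsilon>
      using that unfolding summable_Cauchy by blast
    have diff: "(LINT x|M. (?s m x - ?s p x)\<^sup>2) = (\<Sum>n=p..<m. N (k, n) * (a k n)\<^sup>2)" if "p \<le> m" for m p
    proof -
      \<comment> \<open>Written with \<open>0 -\<close> so that the Pythagorean formula applies with
        \<open>h = 0\<close>.\<close>
      have "?s m x - ?s p x = - (0 - (\<Sum>n\<in>{p..<m}. a k n * e k n x))" for x
        using sum_diff_nat_ivl[of 0 p m "\<lambda>n. a k n * e k n x"] that by (simp add: atLeast0LessThan)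
      then have "(LINT x|M. (?s m x - ?s p x)\<^sup>2) = (LINT x|M. (0 - (\<Sum>n\<in>{p..<m}. a k n * e k n x))\<^sup>2)"
        by (simp only: power2_minus)
      also have "\<dots> = (\<Sum>n=p..<m. (a k n)\<^sup>2 * (LINT x|M. (e k n x)\<^sup>2))"
        by (subst integral_square_diff_orthogonal_sum) (use e orth in auto)
      finally show ?thesis by (simp add: N_def E_def mult.commute)
    qed
    have Cs: "\<exists>N'. \<forall>m\<ge>N'. \<forall>p\<ge>N'. (LINT x|M. (?s m x - ?s p x)\<^sup>2) < \<epsilon>" if "0 < \<epsilon>" for \<epsilon>
    proof -
      obtain N' where N': "\<And>m p. m \<ge> N' \<Longrightarrow> norm (\<Sum>n=m..<p. N (k, n) * (a k n)\<^sup>2) < \<epsilon>"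
        using C[OF \<open>0 < \<epsilon>\<close>] by blast
      have "(LINT x|M. (?s m x - ?s p x)\<^sup>2) < \<epsilon>" if "m \<ge> N'" "p \<ge> N'" for m p
      proof (cases "p \<le> m")
        case True
        then show ?thesis using N'[of p m] diff[of p m] that by simp
      next
        case False
        then have "(LINT x|M. (?s p x - ?s m x)\<^sup>2) < \<epsilon>" using N'[of m p] diff[of m p] that by simp
        then show ?thesis by (simp add: power2_commute)
      qed
      then show ?thesis by blast
    qed
    have "L2_fun M (?s m)" for m by (intro L2_fun_sum L2_fun_cmult e)
    then obtain f where "L2_tendsto M ?s f"
      using Cs by (rule L2_complete)
    then show ?thesis by (auto simp: L2_sums_def)
  qed
  then obtain S where S: "\<And>k. L2_sums M (\<lambda>n x. a k n * e k n x) (S k)" by metis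
  have LS: "L2_fun M (S k)" for k using S by (simp add: L2_sums_def L2_tendsto_def)
  have LT: "L2_fun M (\<lambda>x. \<Sum>k\<le>K. S k x)" for K by (intro L2_fun_sum LS)
  have "(\<lambda>K. LINT x|M. (norm ((\<Sum>k\<le>K. S k x) - h x))\<^sup>2) \<longlonglongrightarrow> 0"
  proof (rule LIMSEQ_I)
    fix \<epsilon> :: real assume "0 < \<epsilon>"
    then obtain b L where bL: "(LINT x|M. (h x - (\<Sum>k<L. \<Sum>n<L. b k n * e k n x))\<^sup>2) < \<epsilon> / 8"
      using dense[of "\<epsilon>/8"] by auto
    then have bL': "D (\<lambda>i. b (fst i) (snd i)) ({..<L} \<times> {..<L}) < \<epsilon> / 8"
      by (simp add: D_def E_def sum.cartesian_product split_def)
    have "norm ((LINT x|M. (norm ((\<Sum>k\<le>K. S k x) - h x))\<^sup>2) - 0) < \<epsilon>" if "K \<ge> L" for K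
    proof -
      let ?T = "\<lambda>m x. \<Sum>k\<le>K. \<Sum>n<m. a k n * e k n x"
      have "L2_tendsto M ?T (\<lambda>x. \<Sum>k\<le>K. S k x)"
        using S unfolding L2_sums_def by (intro L2_tendsto_sum) auto
      then have T: "(\<lambda>m. LINT x|M. (norm (?T m x - (\<Sum>k\<le>K. S k x)))\<^sup>2) \<longlonglongrightarrow> 0" and LTm: "\<And>m. L2_fun M (?T m)"
        by (auto simp: L2_tendsto_def)
      obtain m0 where m0: "\<And>m. m \<ge> m0 \<Longrightarrow> norm ((LINT x|M. (norm (?T m x - (\<Sum>k\<le>K. S k x)))\<^sup>2) - 0) < \<epsilon> / 8"
        using LIMSEQ_D[OF T, of "\<epsilon>/8"] \<open>0 < \<epsilon>\<close> by auto
      \<comment> \<open>\<open>m \<ge> L\<close> makes the index rectangle contain the comparison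
        square, and \<open>m \<ge> m0\<close> brings the truncated inner series within \<epsilon>/8
        of the \<open>S k\<close> in squared norm. The square inequality doubles both errors, which
        leaves \<epsilon>/2.\<close>
      define m where "m = max m0 L"
      have m1: "(LINT x|M. (norm (?T m x - (\<Sum>k\<le>K. S k x)))\<^sup>2) < \<epsilon> / 8"
        using m0[of m] by (simp add: m_def)
      have "(LINT x|M. (norm (h x - ?T m x))\<^sup>2) = D A ({..K} \<times> {..<m})"
        by (simp add: D_def E_def A_def sum.cartesian_product split_def)
      also have "\<dots> \<le> D (\<lambda>i. b (fst i) (snd i)) ({..<L} \<times> {..<L})"
        using that by (intro best) (auto simp: m_def)
      finally have m2: "(LINT x|M. (norm (h x - ?T m x))\<^sup>2) < \<epsilon> / 8" using bL' by simp
      have L1: "L2_fun M (\<lambda>x. ?T m x - (\<Sum>k\<le>K. S k x))" and L2: "L2_fun M (\<lambda>x. h x - ?T m x)"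
        by (intro L2_fun_diff LTm LT h)+
      have L3: "L2_fun M (\<lambda>x. (?T m x - (\<Sum>k\<le>K. S k x)) + (h x - ?T m x))"
        by (intro L2_fun_add L1 L2)
      have "(LINT x|M. (norm ((\<Sum>k\<le>K. S k x) - h x))\<^sup>2) =
         (LINT x|M. (norm ((?T m x - (\<Sum>k\<le>K. S k x)) + (h x - ?T m x)))\<^sup>2)"
        by (simp add: norm_minus_commute power2_commute)
      also have "\<dots> \<le> (LINT x|M. 2 * (norm (?T m x - (\<Sum>k\<le>K. S k x)))\<^sup>2 + 2 * (norm (h x - ?T m x))\<^sup>2)"
      proof (rule integral_mono)
        show "integrable M (\<lambda>x. (norm ((?T m x - (\<Sum>k\<le>K. S k x)) + (h x - ?T m x)))\<^sup>2)"
          using L3 unfolding L2_fun_def by (rule conjunct2)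
        show "integrable M (\<lambda>x. 2 * (norm (?T m x - (\<Sum>k\<le>K. S k x)))\<^sup>2 + 2 * (norm (h x - ?T m x))\<^sup>2)"
          using L1 L2 by (auto simp: L2_fun_def)
      qed (rule norm_add_square_le)
      also have "\<dots> = 2 * (LINT x|M. (norm (?T m x - (\<Sum>k\<le>K. S k x)))\<^sup>2) + 2 * (LINT x|M. (norm (h x - ?T m x))\<^sup>2)"
        using L1 L2 by (simp add: L2_fun_def)
      also have "\<dots> < \<epsilon>" using m1 m2 \<open>0 < \<epsilon>\<close> by simp
      finally have "(LINT x|M. (norm ((\<Sum>k\<le>K. S k x) - h x))\<^sup>2) < \<epsilon>" .
      moreover have "0 \<le> (LINT x|M. (norm ((\<Sum>k\<le>K. S k x) - h x))\<^sup>2)" by (intro integral_nonneg_AE) auto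
      ultimately show ?thesis by simp
    qed
    then show "\<exists>K0. \<forall>K\<ge>K0. norm ((LINT x|M. (norm ((\<Sum>k\<le>K. S k x) - h x))\<^sup>2) - 0) < \<epsilon>" by blast
  qed
  then have "L2_tendsto M (\<lambda>K x. \<Sum>k\<le>K. S k x) h" using LT h by (simp add: L2_tendsto_def)
  then show ?thesis using S by blast
qed

section \<open>Conformal maps and polar coordinates\<close>

lemma integrable_lebesgue_on_iff:
  fixes f :: "'a::euclidean_space \<Rightarrow> real"
  assumes "S \<in> sets lebesgue"
  shows "integrable (lebesgue_on S) f \<and> integral\<^sup>L (lebesgue_on S) f = b \<longleftrightarrow>
         f absolutely_integrable_on S \<and> integral S f = b"
proof -
  have "integrable (lebesgue_on S) f \<longleftrightarrow> f absolutely_integrable_on S"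
    using assms by (simp add: set_integrable_def integrable_restrict_space)
  moreover have "integral\<^sup>L (lebesgue_on S) f = integral S f" if "f absolutely_integrable_on S"
    using assms set_lebesgue_integral_eq_integral(2)[OF that]
    by (simp add: set_lebesgue_integral_def integral_restrict_space)
  ultimately show ?thesis by auto
qed

text \<open>By the Cauchy-Riemann equations the real Jacobian of a holomorphic map is the squared
  modulus of its derivative. If one side fails to be integrable, so does the other, and both
  integrals are \<open>0\<close>.\<close>

theorem conformal_change_of_variables:
  fixes f :: "complex \<Rightarrow> real"
  assumes "open S" "g holomorphic_on S" "inj_on g S"
  shows "integrable (lebesgue_on (g ` S)) f \<longleftrightarrow> integrable (lebesgue_on S) (\<lambda>z. (cmod (deriv g z))\<^sup>2 * f (g z))"
    and "(LINT z|lebesgue_on (g ` S). f z) = (LINT z|lebesgue_on S. (cmod (deriv g z))\<^sup>2 * f (g z))"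
proof -
  have op: "open (g ` S)"
    using open_mapping_thm3[OF assms(2,1,3)] .
  have der: "(g has_derivative (\<lambda>h. deriv g z * h)) (at z within S)" if "z \<in> S" for z
    using holomorphic_derivI[OF assms(2,1) that] has_field_derivative_at_within
    by (auto simp: has_field_derivative_def)
  have det: "\<bar>real_det (\<lambda>h. deriv g z * h)\<bar> = (cmod (deriv g z))\<^sup>2" for z
    unfolding cmod_power2 by (simp add: real_det_def power2_eq_square)
  have S: "S \<in> sets lebesgue" "g ` S \<in> sets lebesgue" using assms(1) op by auto
  have *: "integrable (lebesgue_on S) (\<lambda>z. (cmod (deriv g z))\<^sup>2 * f (g z)) \<and>
      (LINT z|lebesgue_on S. (cmod (deriv g z))\<^sup>2 * f (g z)) = b \<longleftrightarrow>
    integrable (lebesgue_on (g ` S)) f \<and> (LINT z|lebesgue_on (g ` S). f z) = b" for b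
    using has_absolute_integral_change_of_variables_complex[OF S(1) der assms(3), of f b]
      integrable_lebesgue_on_iff[OF S(1)] integrable_lebesgue_on_iff[OF S(2)]
    by (simp add: det)
  then show "integrable (lebesgue_on (g ` S)) f \<longleftrightarrow> integrable (lebesgue_on S) (\<lambda>z. (cmod (deriv g z))\<^sup>2 * f (g z))"
    by auto
  then show "(LINT z|lebesgue_on (g ` S). f z) = (LINT z|lebesgue_on S. (cmod (deriv g z))\<^sup>2 * f (g z))"
    using * by (metis not_integrable_integral_eq)
qed

section \<open>Integration in polar coordinates\<close>

lemma measurable_Complex_pair [measurable]: "(\<lambda>(x, y). Complex x y) \<in> borel_measurable borel"
proof -
  have "(\<lambda>(x, y). Complex x y) = (\<lambda>p. of_real (fst p) + \<i> * of_real (snd p))"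
    by (auto simp: complex_eq_iff)
  then show ?thesis by (auto intro!: borel_measurable_continuous_onI continuous_intros)
qed

lemma distr_Complex_pair: "distr (lborel \<Otimes>\<^sub>M lborel) lborel (\<lambda>(x, y). Complex x y) = lborel"
proof (rule sym, rule lborel_eqI)
  fix l u :: complex
  assume lu: "\<And>b. b \<in> Basis \<Longrightarrow> l \<bullet> b \<le> u \<bullet> b"
  have "Re l \<le> Re u" "Im l \<le> Im u"
    using lu[of 1] lu[of \<i>] by (auto simp: Basis_complex_def)
  moreover have "(\<lambda>(x, y). Complex x y) -` box l u = box (Re l, Im l) (Re u, Im u)"
    by (auto simp: mem_box Basis_complex_def Basis_prod_def)
  ultimately show "emeasure (distr (lborel \<Otimes>\<^sub>M lborel) lborel (\<lambda>(x, y). Complex x y)) (box l u) = (\<Prod>b\<in>Basis. (u - l) \<bullet> b)"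
    unfolding lborel_prod
    apply (subst emeasure_distr)
      apply (simp_all add: emeasure_lborel_box_eq)
    apply (auto simp: Basis_complex_def Basis_prod_def)
    done
qed auto

text \<open>Strict bounds make the sector open and, for \<open>0 \<le> a\<close> and
  \<open>c \<le> 2 * pi\<close>, polar coordinates injective on it. With \<open>c = 2 * pi\<close>
  it is an annulus slit along the positive real axis.\<close>

definition polar_sector :: "real \<Rightarrow> real \<Rightarrow> real \<Rightarrow> complex set" where
  "polar_sector a b c = {of_real r * cis t | r t. a < r \<and> r < b \<and> 0 < t \<and> t < c}"

lemma polar_inj:
  assumes "0 < r" "0 < s" "0 < t" "t < 2 * pi" "0 < u" "u < 2 * pi"
    and eq: "of_real r * cis t = of_real s * cis u"
  shows "r = s \<and> t = u"
proof -
  have "cmod (of_real r * cis t) = r" "cmod (of_real s * cis u) = s"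
    using \<open>0 < r\<close> \<open>0 < s\<close> by (simp_all add: norm_mult)
  with eq have "r = s" by simp
  then have "cis t = cis u" using eq assms by simp
  moreover have "Arg2pi (cis t) = t" "Arg2pi (cis u) = u"
    using assms by (auto intro!: Arg2pi_unique[where r = 1] simp: cis_conv_exp)
  ultimately show ?thesis using \<open>r = s\<close> by metis
qed

text \<open>The polar map is applied to a rectangle of complex numbers whose real part is the radius
  and whose imaginary part is the angle; its Jacobian is the radius. Continuity of \<open>f\<close>
  makes the integrand Borel measurable, so that Fubini's theorem applies to the product of the Borel
  measures.\<close>

theorem integral_polar_sector:
  fixes f :: "complex \<Rightarrow> real"
  assumes "0 \<le> a" "c \<le> 2 * pi" and cont: "continuous_on (polar_sector a b c) f"
  shows "open (polar_sector a b c)"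
    and "integrable (lebesgue_on (polar_sector a b c)) f \<Longrightarrow>
      integrable lborel (\<lambda>r. indicator {a<..<b} r * (r * (LINT t|lborel. indicator {0<..<c} t * f (of_real r * cis t))))"
    and "integrable (lebesgue_on (polar_sector a b c)) f \<Longrightarrow> (LINT z|lebesgue_on (polar_sector a b c). f z) =
      (LINT r|lborel. indicator {a<..<b} r * (r * (LINT t|lborel. indicator {0<..<c} t * f (of_real r * cis t))))"
proof -
  define S where "S = {p. a < Re p \<and> Re p < b \<and> 0 < Im p \<and> Im p < c}"
  define g where "g p = of_real (Re p) * cis (Im p)" for p
  have Sop: "open S"
    unfolding S_def by (intro open_Collect_conj open_Collect_less continuous_intros)
  have P: "polar_sector a b c = g ` S"
  proof safe
    fix z assume "z \<in> polar_sector a b c"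
    then obtain r t where "z = g (Complex r t)" "Complex r t \<in> S"
      unfolding polar_sector_def g_def S_def by auto
    then show "z \<in> g ` S" by blast
  qed (auto simp: polar_sector_def g_def S_def)
  have inj: "inj_on g S"
  proof (rule inj_onI)
    fix p q assume *: "p \<in> S" "q \<in> S" "g p = g q"
    have "Re p = Re q \<and> Im p = Im q"
      by (rule polar_inj) (use * assms in \<open>auto simp: S_def g_def\<close>)
    then show "p = q" by (simp add: complex_eq_iff)
  qed
  have gcont: "continuous_on X g" for X
    unfolding g_def by (intro continuous_intros)
  show op: "open (polar_sector a b c)"
    unfolding P by (rule invariance_of_domain[OF gcont Sop inj])
  assume int: "integrable (lebesgue_on (polar_sector a b c)) f"
  define g' where "g' p h = of_real (Re h) * cis (Im p) + of_real (Re p) * (of_real (Im h) * (\<i> * cis (Im p)))" for p h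
  have g_alt: "g = (\<lambda>p. of_real (Re p * cos (Im p)) + \<i> * of_real (Re p * sin (Im p)))"
    by (auto simp: g_def complex_eq_iff)
  have der: "(g has_derivative g' p) (at p within S)" for p
    unfolding g_alt g'_def
    by (auto intro!: derivative_eq_intros simp: complex_eq_iff algebra_simps)
  have det: "real_det (g' p) = Re p" for p
  proof -
    have "Re p * (cos (Im p) * cos (Im p)) + Re p * (sin (Im p) * sin (Im p)) =
        Re p * (cos (Im p) * cos (Im p) + sin (Im p) * sin (Im p))"
      by (simp only: distrib_left)
    then show ?thesis by (simp add: real_det_def g'_def algebra_simps)
  qed
  have Sl: "S \<in> sets lebesgue" using Sop by auto
  have gSl: "g ` S \<in> sets lebesgue" using op P by auto
  have *: "(\<lambda>p. \<bar>Re p\<bar> * f (g p)) absolutely_integrable_on S"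
    "integral S (\<lambda>p. \<bar>Re p\<bar> * f (g p)) = (LINT z|lebesgue_on (polar_sector a b c). f z)"
    using has_absolute_integral_change_of_variables_complex[OF Sl der inj, of f]
      integrable_lebesgue_on_iff[OF gSl] int
    unfolding P by (auto simp: det)
  define F where "F p = indicator S p * (Re p * f (g p))" for p
  have "continuous_on S (\<lambda>p. f (g p))"
    by (rule continuous_on_compose2[OF cont gcont]) (simp add: P)
  then have "continuous_on S (\<lambda>p. Re p * f (g p))"
    by (intro continuous_intros)
  then have [measurable]: "F \<in> borel_measurable borel"
    unfolding F_def using borel_measurable_continuous_on_indicator[of S "\<lambda>p. Re p * f (g p)"] Sop by simp
  have **: "indicator S p *\<^sub>R (\<bar>Re p\<bar> * f (g p)) = F p" for p
    using \<open>0 \<le> a\<close> by (auto simp: F_def indicator_def S_def)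
  have "integrable lebesgue F" "(LINT p|lebesgue. F p) = (LINT z|lebesgue_on (polar_sector a b c). f z)"
    using *(1) *(2) set_lebesgue_integral_eq_integral(2)[OF *(1)]
    unfolding set_integrable_def set_lebesgue_integral_def ** by auto
  then have Fi: "integrable lborel F" "(LINT p|lborel. F p) = (LINT z|lebesgue_on (polar_sector a b c). f z)"
    by (simp_all add: integrable_completion integral_completion)
  have PM: "(\<lambda>(x, y). Complex x y) \<in> (lborel \<Otimes>\<^sub>M lborel) \<rightarrow>\<^sub>M (lborel :: complex measure)"
    unfolding lborel_prod by simp
  have pair: "integrable (lborel \<Otimes>\<^sub>M lborel) (\<lambda>(x, y). F (Complex x y))"
    "(LINT p|(lborel \<Otimes>\<^sub>M lborel). (\<lambda>(x, y). F (Complex x y)) p) = (LINT p|lborel. F p)"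
    using Fi(1) integrable_distr_eq[OF PM, of F, unfolded distr_Complex_pair]
      integral_distr[OF PM, of F, unfolded distr_Complex_pair]
    by (simp_all add: split_def)
  have inner: "(LINT t|lborel. F (Complex r t)) =
      indicator {a<..<b} r * (r * (LINT t|lborel. indicator {0<..<c} t * f (of_real r * cis t)))" for r
  proof -
    have "F (Complex r t) = indicator {a<..<b} r * r * (indicator {0<..<c} t * f (of_real r * cis t))" for t
      by (auto simp: F_def indicator_def S_def g_def)
    then show ?thesis by (simp add: mult.assoc)
  qed
  show "integrable lborel (\<lambda>r. indicator {a<..<b} r * (r * (LINT t|lborel. indicator {0<..<c} t * f (of_real r * cis t))))"
    using lborel_pair.integrable_fst'[OF pair(1)] by (simp add: inner)
  show "(LINT z|lebesgue_on (polar_sector a b c). f z) =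
      (LINT r|lborel. indicator {a<..<b} r * (r * (LINT t|lborel. indicator {0<..<c} t * f (of_real r * cis t))))"
    using lborel_pair.integral_fst'[OF pair(1)] pair(2) Fi(2) by (simp add: inner)
qed

section \<open>An orthogonal system on the half disc\<close>

text \<open>The difference of the two sides is a polynomial of degree at most \<open>n\<close> that
  vanishes at the \<open>n + 1\<close> nodes.\<close>

lemma Lagrange_interpolation_nat:
  fixes p :: "real poly"
  assumes "degree p \<le> n"
  shows "(\<Sum>l=0..n. poly p (real l) * (\<Prod>j\<in>{0..n} - {l}. (x - real j) / (real l - real j))) = poly p x"
proof -
  define q where "q = (\<Sum>l=0..n. smult (poly p (real l) / (\<Prod>j\<in>{0..n} - {l}. real l - real j))
      (\<Prod>j\<in>{0..n} - {l}. [:- real j, 1:])) - p"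
  have poly_q: "poly q y = (\<Sum>l=0..n. poly p (real l) * (\<Prod>j\<in>{0..n} - {l}. (y - real j) / (real l - real j))) - poly p y" for y
    by (simp add: q_def poly_sum poly_prod prod_dividef)
  have "degree q \<le> n"
    unfolding q_def
  proof (intro degree_diff_le degree_sum_le assms)
    fix l assume l: "l \<in> {0..n}"
    have "degree (\<Prod>j\<in>{0..n} - {l}. [:- real j, 1:]) \<le> (\<Sum>j\<in>{0..n} - {l}. 1)"
      by (intro order.trans[OF degree_prod_sum_le]) auto
    also have "\<dots> = n" using l by simp
    finally show "degree (smult (poly p (real l) / (\<Prod>j\<in>{0..n} - {l}. real l - real j))
      (\<Prod>j\<in>{0..n} - {l}. [:- real j, 1:])) \<le> n"
      by (rule order.trans[OF degree_smult_le])
  qed auto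
  have root: "poly q (real i) = 0" if "i \<le> n" for i
  proof -
    have "(\<Sum>l=0..n. poly p (real l) * (\<Prod>j\<in>{0..n} - {l}. (real i - real j) / (real l - real j))) =
        (\<Sum>l=0..n. if l = i then poly p (real i) else 0)"
    proof (rule sum.cong[OF refl])
      fix l assume "l \<in> {0..n}"
      show "poly p (real l) * (\<Prod>j\<in>{0..n} - {l}. (real i - real j) / (real l - real j)) =
          (if l = i then poly p (real i) else 0)"
      proof (cases "l = i")
        case True
        have "(\<Prod>j\<in>{0..n} - {l}. (real i - real j) / (real l - real j)) = (\<Prod>j\<in>{0..n} - {l}. 1)"
          using True by (intro prod.cong) auto
        then show ?thesis using True by simp
      next
        case False
        have "(\<Prod>j\<in>{0..n} - {l}. (real i - real j) / (real l - real j)) = 0"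
          using False that by (intro prod_zero) (auto intro!: bexI[of _ i])
        then show ?thesis using False by simp
      qed
    qed
    then show ?thesis using that by (simp add: poly_q)
  qed
  have "q = 0"
  proof (rule ccontr)
    assume "q \<noteq> 0"
    then have fin: "finite {y. poly q y = 0}" by (rule poly_roots_finite)
    have "card (real ` {0..n}) \<le> card {y. poly q y = 0}"
      using root by (intro card_mono fin) auto
    also have "\<dots> \<le> degree q" using \<open>q \<noteq> 0\<close> by (rule card_poly_roots_bound)
    finally show False using \<open>degree q \<le> n\<close> by (simp add: card_image)
  qed
  then have "poly q x = 0" by simp
  then show ?thesis using poly_q[of x] by simp
qed

text \<open>\<open>c_coeff k l n\<close> is the barycentric weight of the node \<open>l\<close>
  among \<open>0..n\<close> times the value at \<open>l\<close> of the polynomial with the roots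
  \<open>-(j + k + 1)\<close> for \<open>j < n\<close>. Interpolating at
  \<open>x = -(i + k + 1)\<close> turns the factor \<open>1 / (x - l)\<close> into
  \<open>-1 / (l + i + k + 1)\<close>, which up to a constant is the integral of a power of
  \<open>r\<close> over the unit interval.\<close>

lemma c_coeff_sum:
  "(\<Sum>l=0..n. c_coeff k l n / real (l + i + k + 1)) =
     - (\<Prod>j<n. real j - real i) / (\<Prod>j=0..n. - real (i + k + 1) - real j)"
proof -
  define x where "x = - real (i + k + 1)"
  define p where "p = (\<Prod>j<n. [:real (j + k + 1), 1:])"
  have deg: "degree p \<le> n"
    unfolding p_def by (intro order.trans[OF degree_prod_sum_le]) auto
  have pl: "poly p (real l) = (\<Prod>j<n. real (l + j + k + 1))" for l
    by (simp add: p_def poly_prod algebra_simps)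
  have px: "poly p x = (\<Prod>j<n. real j - real i)"
    by (simp add: p_def poly_prod x_def algebra_simps)
  have ne: "x - real l \<noteq> 0" for l by (simp add: x_def)
  have "poly p x = (\<Sum>l=0..n. poly p (real l) * (\<Prod>j\<in>{0..n} - {l}. (x - real j) / (real l - real j)))"
    by (rule Lagrange_interpolation_nat[OF deg, symmetric])
  also have "\<dots> = (\<Sum>l=0..n. (\<Prod>j=0..n. x - real j) * (c_coeff k l n / (x - real l)))"
  proof (rule sum.cong[OF refl])
    fix l assume "l \<in> {0..n}"
    then have "(\<Prod>j=0..n. x - real j) = (x - real l) * (\<Prod>j\<in>{0..n} - {l}. x - real j)"
      by (subst prod.remove[of _ l]) auto
    then show "poly p (real l) * (\<Prod>j\<in>{0..n} - {l}. (x - real j) / (real l - real j)) =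
        (\<Prod>j=0..n. x - real j) * (c_coeff k l n / (x - real l))"
      using ne[of l] by (simp add: c_coeff_def pl prod_dividef)
  qed
  also have "\<dots> = - (\<Prod>j=0..n. x - real j) * (\<Sum>l=0..n. c_coeff k l n / real (l + i + k + 1))"
  proof -
    have "c_coeff k l n / (x - real l) = - (c_coeff k l n / real (l + i + k + 1))" for l
      by (simp add: x_def divide_simps) (simp add: algebra_simps)
    then show ?thesis by (simp add: sum_distrib_left sum_negf)
  qed
  finally have "poly p x = - (\<Prod>j=0..n. x - real j) * (\<Sum>l=0..n. c_coeff k l n / real (l + i + k + 1))" .
  moreover have "(\<Prod>j=0..n. x - real j) \<noteq> 0" using ne by simp
  ultimately show ?thesis unfolding px x_def[symmetric] by (simp add: field_simps)
qed

text \<open>For \<open>i < n\<close> the evaluation point is a root of the interpolated polynomial.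
  This is the orthogonality of \<open>L_poly n k\<close> to the lower powers.\<close>

lemma c_coeff_sum_eq_0: "i < n \<Longrightarrow> (\<Sum>l=0..n. c_coeff k l n / real (l + i + k + 1)) = 0"
  unfolding c_coeff_sum by (simp add: prod_zero_iff) 

lemma c_coeff_top_nonzero: "c_coeff k n n \<noteq> 0"
  by (auto simp: c_coeff_def)

text \<open>This is twice the squared norm of \<open>L_poly n k\<close> for the weight
  \<open>r\<close>: by orthogonality only the top power contributes to the pairing of
  \<open>L_poly n k\<close> with itself.\<close>

lemma c_coeff_sum_top:
  "c_coeff k n n * (\<Sum>l=0..n. c_coeff k l n / real (l + n + k + 1)) = 1 / real (2 * n + k + 1)"
proof -
  define D where "D = (\<Prod>j<n. real n - real j)"
  define B where "B = (\<Prod>j<n. real (n + j + k + 1))"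
  have D0: "D \<noteq> 0" by (auto simp: D_def)
  have B0: "B \<noteq> 0" unfolding B_def by (simp add: prod_zero_iff del: of_nat_add)
  have set: "{0..n} - {n} = {..<n}" by auto
  have c: "c_coeff k n n = B / D" by (simp add: c_coeff_def D_def B_def set)
  have 1: "(\<Prod>j<n. real j - real n) = (- 1) ^ n * D"
  proof -
    have "(\<Prod>j<n. real j - real n) = (\<Prod>j<n. (- 1) * (real n - real j))" by (intro prod.cong) auto
    then show ?thesis unfolding prod.distrib D_def by simp
  qed
  have "(\<Prod>j=0..n. - real (n + k + 1) - real j) = (\<Prod>j=0..n. (- 1) * real (n + j + k + 1))"
    by (intro prod.cong) auto
  also have "\<dots> = (- 1) ^ (n + 1) * (\<Prod>j=0..n. real (n + j + k + 1))"
    unfolding prod.distrib by simp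
  also have "(\<Prod>j=0..n. real (n + j + k + 1)) = B * real (2 * n + k + 1)"
  proof -
    have "{0..n} = insert n {..<n}" by auto
    then show ?thesis by (simp add: B_def algebra_simps)
  qed
  finally have 2: "(\<Prod>j=0..n. - real (n + k + 1) - real j) = - ((- 1) ^ n * (B * real (2 * n + k + 1)))"
    by simp
  show ?thesis
    unfolding c_coeff_sum c 1 2 using D0 B0 by (simp del: of_nat_add of_nat_mult)
qed

section \<open>One-dimensional integrals of powers and cosines\<close>

lemma integral_open_eq_closed:
  fixes f :: "real \<Rightarrow> real"
  shows "(LINT x|lborel. indicator {a<..<b} x * f x) = (LINT x|lborel. indicator {a..b} x * f x)"
  by (rule integral_discrete_difference[where X = "{a, b}"]) (auto simp: indicator_def)

lemma integral_power_unit: "(LINT r|lborel. indicator {0<..<1} r * r ^ m) = 1 / real (m + 1)"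
  using integral_power[of 0 1 m] by (simp only: integral_open_eq_closed) (simp add: mult.commute)

lemma integrable_open_unit_power: "integrable lborel (\<lambda>r::real. indicator {0<..<1} r * r ^ m)"
proof -
  have "integrable lborel (\<lambda>r::real. indicator {0..1} r *\<^sub>R r ^ m)"
    by (rule borel_integrable_atLeastAtMost'[unfolded set_integrable_def]) (intro continuous_intros)
  then have "integrable lborel (\<lambda>r::real. indicator {0<..<1} r *\<^sub>R (indicator {0..1} r *\<^sub>R r ^ m))"
    by (rule integrable_mult_indicator[rotated]) simp
  moreover have "(\<lambda>r::real. indicator {0<..<1} r *\<^sub>R (indicator {0..1} r *\<^sub>R r ^ m)) = (\<lambda>r. indicator {0<..<1} r * r ^ m)"
    by (auto simp: indicator_def fun_eq_iff)
  ultimately show ?thesis by simp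
qed

lemma integral_cos_half_period:
  "(LINT t|lborel. indicator {0<..<pi} t * cos (of_int p * t)) = (if p = 0 then pi else 0)"
proof (cases "p = 0")
  case True
  then show ?thesis by (simp add: integral_open_eq_closed)
next
  case False
  have "(LINT t|lborel. indicator {0..pi} t *\<^sub>R cos (of_int p * t)) = sin (of_int p * pi) / of_int p - sin (of_int p * 0) / of_int p"
  proof (rule integral_FTC_atLeastAtMost)
    show "((\<lambda>t. sin (of_int p * t) / of_int p) has_vector_derivative cos (of_int p * t)) (at t within {0..pi})" for t
      unfolding has_real_derivative_iff_has_vector_derivative[symmetric]
      using False by (auto intro!: derivative_eq_intros)
  qed (auto intro!: continuous_intros)
  moreover have "sin (of_int p * pi) = 0" using sin_npi_int[of p] by (simp add: mult.commute) 
  ultimately show ?thesis using False by (simp add: integral_open_eq_closed)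
qed

text \<open>The product-to-sum formula leaves the frequencies \<open>k - j\<close> and
  \<open>k + j\<close>. Both vanish only for \<open>k = j = 0\<close>, which doubles the value in
  that case.\<close>

lemma integral_cos_mult_cos:
  "(LINT t|lborel. indicator {0<..<pi} t * (cos (real k * t) * cos (real j * t))) =
     (if k = j then if k = 0 then pi else pi / 2 else 0)"
proof -
  have int: "integrable lborel (\<lambda>t. indicator {0<..<pi} t * cos (of_int p * t))" for p
  proof -
    have "integrable lborel (\<lambda>t::real. indicator {0..pi} t *\<^sub>R cos (of_int p * t))"
      by (rule borel_integrable_atLeastAtMost'[unfolded set_integrable_def]) (intro continuous_intros)
    then have "integrable lborel (\<lambda>t::real. indicator {0<..<pi} t *\<^sub>R (indicator {0..pi} t *\<^sub>R cos (of_int p * t)))"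
      by (rule integrable_mult_indicator[rotated]) simp
    moreover have "(\<lambda>t::real. indicator {0<..<pi} t *\<^sub>R (indicator {0..pi} t *\<^sub>R cos (of_int p * t))) = 
        (\<lambda>t. indicator {0<..<pi} t * cos (of_int p * t))"
      by (auto simp: indicator_def fun_eq_iff)
    ultimately show ?thesis by simp
  qed
  have "(LINT t|lborel. indicator {0<..<pi} t * (cos (real k * t) * cos (real j * t))) =
    (LINT t|lborel. (indicator {0<..<pi} t * cos (of_int (int k - int j) * t) +
       indicator {0<..<pi} t * cos (of_int (int k + int j) * t)) / 2)"
  proof (intro Bochner_Integration.integral_cong refl)
    fix t :: real
    have "cos (real k * t) * cos (real j * t) = (cos (of_int (int k - int j) * t) + cos (of_int (int k + int j) * t)) / 2"
      using cos_times_cos[of "real k * t" "real j * t"] by (simp add: left_diff_distrib distrib_right)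
    then show "indicator {0<..<pi} t * (cos (real k * t) * cos (real j * t)) =
      (indicator {0<..<pi} t * cos (of_int (int k - int j) * t) + indicator {0<..<pi} t * cos (of_int (int k + int j) * t)) / 2"
      by (simp only: distrib_left times_divide_eq_right)
  qed
  also have "\<dots> = ((if int k - int j = 0 then pi else 0) + (if int k + int j = 0 then pi else 0)) / 2"
    using int by (simp add: integral_cos_half_period del: of_int_diff of_int_add)
  finally show ?thesis by auto
qed

text \<open>On the half disc \<open>Arg\<close> is continuous with values strictly between
  \<open>0\<close> and \<open>pi\<close>, so it serves as the polar angle.\<close>

definition half_disc_basis :: "nat \<Rightarrow> nat \<Rightarrow> complex \<Rightarrow> real" where
  "half_disc_basis k n z = L_poly n k (cmod z) * cos (real k * Arg z)"

lemma half_disc_basis_polar: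
  assumes "0 < r" "0 < t" "t < pi"
  shows "half_disc_basis k n (of_real r * cis t) = L_poly n k r * cos (real k * t)"
proof -
  have "Arg (of_real r * cis t) = t"
    using assms by (intro Arg_unique[where r = r]) (auto simp: cis_conv_exp)
  then show ?thesis using assms by (simp add: half_disc_basis_def norm_mult)
qed

lemma half_disc_eq_polar_sector: "half_disc = polar_sector 0 1 pi"
proof safe
  fix z assume z: "z \<in> half_disc"
  then have "Im z > 0" "cmod z < 1" by (auto simp: half_disc_def)
  then have "0 < Arg z" "Arg z < pi" using Arg_lt_pi[of z] by auto
  moreover have "z \<noteq> 0" using \<open>Im z > 0\<close> by auto
  moreover have "z = of_real (cmod z) * cis (Arg z)"
    using Arg_eq[OF \<open>z \<noteq> 0\<close>] by (simp add: cis_conv_exp)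
  ultimately show "z \<in> polar_sector 0 1 pi"
    unfolding polar_sector_def mem_Collect_eq using \<open>cmod z < 1\<close>
    by (intro exI[of _ "cmod z"] exI[of _ "Arg z"]) auto
next
  fix z assume "z \<in> polar_sector 0 1 pi"
  then show "z \<in> half_disc"
    by (auto simp: polar_sector_def half_disc_def norm_mult sin_gt_zero)
qed

lemma open_half_disc: "open half_disc"
proof -
  have "half_disc = ball 0 1 \<inter> {z. Im z > 0}" by (auto simp: half_disc_def)
  then show ?thesis using open_Int[OF open_ball open_halfspace_Im_gt] by metis
qed

lemma finite_measure_lebesgue_on_bounded:
  fixes S :: "complex set"
  assumes "open S" "bounded S"
  shows "finite_measure (lebesgue_on S)"
proof (rule finite_measure_lebesgue_on)
  show "S \<in> lmeasurable"
    using assms by (rule lmeasurable_open[rotated])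
qed

lemma finite_measure_half_disc: "finite_measure (lebesgue_on half_disc)"
  by (rule finite_measure_lebesgue_on_bounded[OF open_half_disc])
    (rule bounded_subset[of "ball 0 1"], auto simp: half_disc_def)

lemma continuous_on_half_disc_basis: "continuous_on half_disc (half_disc_basis k n)"
  unfolding half_disc_basis_def L_poly_def
  by (intro continuous_intros) (auto simp: half_disc_def complex_nonpos_Reals_iff)

lemma half_disc_basis_bounded:
  obtains B where "\<And>z. z \<in> half_disc \<Longrightarrow> \<bar>half_disc_basis k n z\<bar> \<le> B"
proof
  fix z assume "z \<in> half_disc"
  then have z: "cmod z \<le> 1" by (auto simp: half_disc_def)
  have "\<bar>L_poly n k (cmod z)\<bar> \<le> (\<Sum>l=0..n. \<bar>c_coeff k l n\<bar>)"
    unfolding L_poly_def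
  proof (rule order.trans[OF sum_abs], rule sum_mono)
    fix l
    show "\<bar>c_coeff k l n * cmod z ^ (2 * l + k)\<bar> \<le> \<bar>c_coeff k l n\<bar>"
      using z by (simp add: abs_mult mult_left_le power_le_one)
  qed
  then have "\<bar>L_poly n k (cmod z)\<bar> * \<bar>cos (real k * Arg z)\<bar> \<le> (\<Sum>l=0..n. \<bar>c_coeff k l n\<bar>) * 1"
    by (intro mult_mono) (auto intro: sum_nonneg)
  then show "\<bar>half_disc_basis k n z\<bar> \<le> (\<Sum>l=0..n. \<bar>c_coeff k l n\<bar>)"
    by (simp add: half_disc_basis_def abs_mult)
qed

lemma L2_half_disc_basis: "L2_fun (lebesgue_on half_disc) (half_disc_basis k n)"
proof -
  obtain B where "\<And>z. z \<in> half_disc \<Longrightarrow> \<bar>half_disc_basis k n z\<bar> \<le> B"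
    using half_disc_basis_bounded[of k n] by blast
  then show ?thesis
    using open_half_disc
    by (intro L2_fun_bounded[OF finite_measure_half_disc, where B = B]
        continuous_imp_measurable_on_sets_lebesgue continuous_on_half_disc_basis) auto
qed

text \<open>The inner sums of the double sum are those of \<open>c_coeff_sum\<close>, which vanish
  for \<open>i < n\<close>: nothing remains if \<open>m < n\<close>, and only \<open>i = n\<close>
  remains if \<open>m = n\<close>. The case \<open>n < m\<close> follows by symmetry.\<close>

lemma integral_radial_L_poly:
  "(LINT r|lborel. indicator {0<..<1} r * (r * (L_poly n k r * L_poly m k r))) =
     (if n = m then 1 / (2 * real (2 * n + k + 1)) else 0)"
proof -
  have sq: "(LINT r|lborel. indicator {0<..<1} r * (r * (L_poly n k r * L_poly m k r))) =
     (\<Sum>i=0..m. c_coeff k i m / 2 * (\<Sum>l=0..n. c_coeff k l n / real (l + i + k + 1)))" for n m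
  proof -
    \<comment> \<open>The exponents \<open>2 * l + k\<close> and \<open>2 * i + k\<close>, and one
      more from the area element.\<close>
    define q where "q l i = 2 * l + 2 * i + 2 * k + 1" for l i :: nat
    have "(LINT r|lborel. indicator {0<..<1} r * (r * (L_poly n k r * L_poly m k r))) =
      (LINT r|lborel. (\<Sum>i=0..m. \<Sum>l=0..n. c_coeff k i m * c_coeff k l n * (indicator {0<..<1} r * r ^ q l i)))"
    proof (rule Bochner_Integration.integral_cong[OF refl])
      fix r :: real
      have "indicator {0<..<1} r * (r * (L_poly n k r * L_poly m k r)) =
         (\<Sum>i=0..m. \<Sum>l=0..n. (indicator {0<..<1} r * r) * ((c_coeff k l n * r ^ (2 * l + k)) * (c_coeff k i m * r ^ (2 * i + k))))"
        unfolding L_poly_def sum_product by (subst sum.swap) (simp add: sum_distrib_left mult.assoc)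
      also have "\<dots> = (\<Sum>i=0..m. \<Sum>l=0..n. c_coeff k i m * c_coeff k l n * (indicator {0<..<1} r * r ^ q l i))"
        by (intro sum.cong refl) (simp add: q_def power_add power_mult mult_2 power2_eq_square algebra_simps)
      finally show "indicator {0<..<1} r * (r * (L_poly n k r * L_poly m k r)) = \<dots>" .
    qed
    also have "\<dots> = (\<Sum>i=0..m. \<Sum>l=0..n. c_coeff k i m * c_coeff k l n * (1 / real (q l i + 1)))"
      using integrable_open_unit_power by (simp add: integral_power_unit del: of_nat_add of_nat_mult of_nat_Suc)
    also have "\<dots> = (\<Sum>i=0..m. c_coeff k i m / 2 * (\<Sum>l=0..n. c_coeff k l n / real (l + i + k + 1)))"
    proof -
      have "real (q l i + 1) = 2 * real (l + i + k + 1)" for l i by (simp add: q_def)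
      then show ?thesis by (simp add: sum_distrib_left del: of_nat_add)
    qed
    finally show ?thesis .
  qed
  have less: "(LINT r|lborel. indicator {0<..<1} r * (r * (L_poly n k r * L_poly m k r))) = 0" if "m < n" for n m
    unfolding sq
  proof (intro sum.neutral ballI)
    fix i assume "i \<in> {0..m}"
    then have "i < n" using that by simp
    then show "c_coeff k i m / 2 * (\<Sum>l=0..n. c_coeff k l n / real (l + i + k + 1)) = 0"
      by (simp only: c_coeff_sum_eq_0 mult_zero_right)
  qed
  consider "n = m" | "m < n" | "n < m" by linarith
  then show ?thesis
  proof cases
    case 1
    have "(\<Sum>i=0..n. c_coeff k i n / 2 * (\<Sum>l=0..n. c_coeff k l n / real (l + i + k + 1))) =
       c_coeff k n n / 2 * (\<Sum>l=0..n. c_coeff k l n / real (l + n + k + 1))"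
    proof -
      have "(\<Sum>i=0..<n. c_coeff k i n / 2 * (\<Sum>l=0..n. c_coeff k l n / real (l + i + k + 1))) = 0"
      proof (intro sum.neutral ballI)
        fix i assume "i \<in> {0..<n}"
        then have "i < n" by simp
        then show "c_coeff k i n / 2 * (\<Sum>l=0..n. c_coeff k l n / real (l + i + k + 1)) = 0"
          by (simp only: c_coeff_sum_eq_0 mult_zero_right)
      qed
      moreover have "{0..n} = insert n {0..<n}" by auto
      ultimately show ?thesis by (simp del: of_nat_add)
    qed
    also have "\<dots> = 1 / (2 * real (2 * n + k + 1))"
      using c_coeff_sum_top[of k n] by (simp add: field_simps del: of_nat_add of_nat_mult)
    finally show ?thesis using 1 sq by simp
  next
    case 2 then show ?thesis using less by simp
  next
    case 3
    then show ?thesis using less[of n m] by (simp add: mult.commute[of "L_poly n k _"])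
  qed
qed

theorem half_disc_basis_orthogonal:
  "(LINT z|lebesgue_on half_disc. half_disc_basis k n z * half_disc_basis j m z) =
     (if k = j \<and> n = m then (if k = 0 then pi else pi / 2) / (2 * real (2 * n + k + 1)) else 0)"
proof -
  have cont: "continuous_on (polar_sector 0 1 pi) (\<lambda>z. half_disc_basis k n z * half_disc_basis j m z)"
    unfolding half_disc_eq_polar_sector[symmetric] by (intro continuous_intros continuous_on_half_disc_basis)
  have int: "integrable (lebesgue_on (polar_sector 0 1 pi)) (\<lambda>z. half_disc_basis k n z * half_disc_basis j m z)"
    unfolding half_disc_eq_polar_sector[symmetric]
    by (rule L2_fun_mult_integrable[OF L2_half_disc_basis L2_half_disc_basis])
  have "(LINT z|lebesgue_on half_disc. half_disc_basis k n z * half_disc_basis j m z) =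
     (LINT r|lborel. indicator {0<..<1} r * (r * (LINT t|lborel. indicator {0<..<pi} t *
        (half_disc_basis k n (of_real r * cis t) * half_disc_basis j m (of_real r * cis t)))))"
    unfolding half_disc_eq_polar_sector by (rule integral_polar_sector(3)[OF _ _ cont int]) auto
  also have "\<dots> = (LINT r|lborel. (if k = j then if k = 0 then pi else pi / 2 else 0) * 
      (indicator {0<..<1} r * (r * (L_poly n k r * L_poly m j r))))"
  proof (rule Bochner_Integration.integral_cong[OF refl])
    fix r :: real
    show "indicator {0<..<1} r * (r * (LINT t|lborel. indicator {0<..<pi} t *
        (half_disc_basis k n (of_real r * cis t) * half_disc_basis j m (of_real r * cis t)))) =
      (if k = j then if k = 0 then pi else pi / 2 else 0) * 
      (indicator {0<..<1} r * (r * (L_poly n k r * L_poly m j r)))"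
    proof (cases "r \<in> {0<..<1}")
      case True
      have "(LINT t|lborel. indicator {0<..<pi} t *
        (half_disc_basis k n (of_real r * cis t) * half_disc_basis j m (of_real r * cis t))) =
        (LINT t|lborel. (L_poly n k r * L_poly m j r) * (indicator {0<..<pi} t * (cos (real k * t) * cos (real j * t))))"
        by (intro Bochner_Integration.integral_cong refl)
          (use True in \<open>auto simp: indicator_def half_disc_basis_polar\<close>)
      also have "\<dots> = (L_poly n k r * L_poly m j r) * (if k = j then if k = 0 then pi else pi / 2 else 0)"
        unfolding integral_mult_right_zero integral_cos_mult_cos ..
      finally show ?thesis by simp
    qed simp
  qed
  also have "\<dots> = (if k = j then if k = 0 then pi else pi / 2 else 0) *
      (LINT r|lborel. indicator {0<..<1} r * (r * (L_poly n k r * L_poly m j r)))"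
    by (rule integral_mult_right_zero)
  finally have eq: "(LINT z|lebesgue_on half_disc. half_disc_basis k n z * half_disc_basis j m z) =
      (if k = j then if k = 0 then pi else pi / 2 else 0) *
      (LINT r|lborel. indicator {0<..<1} r * (r * (L_poly n k r * L_poly m j r)))" .
  show ?thesis
  proof (cases "k = j")
    case True
    show ?thesis using eq unfolding True integral_radial_L_poly
      by (simp del: of_nat_add of_nat_mult of_nat_Suc)
  qed (simp add: eq)
qed

section \<open>Completeness of the orthogonal system\<close>

text \<open>Truncation reduces approximation to bounded functions, for which convergence almost
  everywhere on a set of finite measure gives L2 convergence.\<close>

lemma L2_clamp_tendsto:
  fixes h :: "'a \<Rightarrow> real"
  assumes "L2_fun M h"
  shows "(\<lambda>m. LINT x|M. (h x - max (- real m) (min (real m) (h x)))\<^sup>2) \<longlonglongrightarrow> 0"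
proof -
  have [measurable]: "h \<in> borel_measurable M" using assms by (simp add: L2_fun_real)
  have "(\<lambda>m. LINT x|M. (h x - max (- real m) (min (real m) (h x)))\<^sup>2) \<longlonglongrightarrow> (LINT x|M. 0)"
  proof (rule integral_dominated_convergence[where w = "\<lambda>x. (h x)\<^sup>2"])
    show "integrable M (\<lambda>x. (h x)\<^sup>2)" using assms by (simp add: L2_fun_real)
    show "AE x in M. (\<lambda>m. (h x - max (- real m) (min (real m) (h x)))\<^sup>2) \<longlonglongrightarrow> 0"
    proof (rule AE_I2)
      fix x
      obtain m0 :: nat where m0: "\<bar>h x\<bar> \<le> real m0" using real_arch_simple by blast
      have "eventually (\<lambda>m. (h x - max (- real m) (min (real m) (h x)))\<^sup>2 = 0) sequentially"
        using eventually_ge_at_top[of m0]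
      proof eventually_elim
        case (elim m)
        then have "\<bar>h x\<bar> \<le> real m" using m0 by linarith
        then show ?case by auto
      qed
      then show "(\<lambda>m. (h x - max (- real m) (min (real m) (h x)))\<^sup>2) \<longlonglongrightarrow> 0"
        by (rule tendsto_eventually)
    qed
    show "AE x in M. norm ((h x - max (- real m) (min (real m) (h x)))\<^sup>2) \<le> (h x)\<^sup>2" for m
    proof (rule AE_I2)
      fix x
      have "\<bar>h x - max (- real m) (min (real m) (h x))\<bar> \<le> \<bar>h x\<bar>" by auto
      then show "norm ((h x - max (- real m) (min (real m) (h x)))\<^sup>2) \<le> (h x)\<^sup>2"
        by (simp add: abs_le_square_iff)
    qed
  qed auto
  then show ?thesis by simp
qed

lemma L2_continuous_approximation:
  fixes h :: "complex \<Rightarrow> real"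
  assumes S: "open S" "bounded S" and h: "L2_fun (lebesgue_on S) h" and "0 < \<epsilon>"
  obtains \<phi> where "continuous_on UNIV \<phi>" "(LINT z|lebesgue_on S. (h z - \<phi> z)\<^sup>2) < \<epsilon>"
proof -
  interpret finite_measure "lebesgue_on S" by (rule finite_measure_lebesgue_on_bounded[OF S])
  have Sl: "S \<in> sets lebesgue" using S by auto
  obtain m :: nat where m: "(LINT z|lebesgue_on S. (h z - max (- real m) (min (real m) (h z)))\<^sup>2) < \<epsilon> / 4"
  proof -
    have "eventually (\<lambda>m. (LINT z|lebesgue_on S. (h z - max (- real m) (min (real m) (h z)))\<^sup>2) < \<epsilon> / 4) sequentially"
      using L2_clamp_tendsto[OF h] \<open>0 < \<epsilon>\<close> by (intro order_tendstoD(2)) auto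
    then show ?thesis using that by (auto simp: eventually_sequentially)
  qed
  let ?c = "\<lambda>x::real. max (- real m) (min (real m) x)"
  have hm: "h \<in> borel_measurable (lebesgue_on S)" using h by (simp add: L2_fun_real)
  then have "h measurable_on S" using Sl by (simp add: measurable_on_iff_borel_measurable)
  \<comment> \<open>Lebesgue measurable functions are limits of continuous ones outside a negligible
    set. Clamping these at the same height as \<open>h\<close> gives the uniform bound for dominated
    convergence.\<close>
  then obtain N g where N: "negligible N" and g: "\<And>n. continuous_on UNIV (g n)"
    and lim: "\<And>x. x \<notin> N \<Longrightarrow> (\<lambda>n. g n x) \<longlonglongrightarrow> (if x \<in> S then h x else 0)"
    unfolding measurable_on_def by metis
  have gc: "continuous_on UNIV (\<lambda>x. ?c (g n x))" for n
    by (intro continuous_intros g)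
  have gm: "(\<lambda>x. ?c (g n x)) \<in> borel_measurable (lebesgue_on S)" for n
    using Sl by (intro continuous_imp_measurable_on_sets_lebesgue continuous_on_subset[OF gc]) auto
  have ae: "AE x in lebesgue_on S. x \<notin> N"
  proof -
    have "N \<in> null_sets lebesgue" using N by (simp add: negligible_iff_null_sets)
    then have "AE x in lebesgue. x \<notin> N" by (rule AE_not_in)
    then show ?thesis using Sl by (subst AE_restrict_space_iff) (auto elim: eventually_mono)
  qed
  have T: "L2_tendsto (lebesgue_on S) (\<lambda>n x. ?c (g n x)) (\<lambda>x. ?c (h x))"
  proof (rule L2_tendsto_bounded_convergence[where B = "real m"])
    show "AE x in lebesgue_on S. (\<lambda>n. ?c (g n x)) \<longlonglongrightarrow> ?c (h x)"
      using ae AE_space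
    proof eventually_elim
      case (elim x)
      then have "(\<lambda>n. g n x) \<longlonglongrightarrow> h x" using lim[of x] by (auto simp: space_restrict_space)
      then show ?case by (intro tendsto_max tendsto_min tendsto_const)
    qed
    show "(\<lambda>x. ?c (h x)) \<in> borel_measurable (lebesgue_on S)" using hm by measurable
  qed (use gm finite_measure_axioms in auto)
  then have "(\<lambda>n. LINT x|lebesgue_on S. (norm (?c (g n x) - ?c (h x)))\<^sup>2) \<longlonglongrightarrow> 0"
    by (simp add: L2_tendsto_def)
  then have "eventually (\<lambda>n. (LINT x|lebesgue_on S. (norm (?c (g n x) - ?c (h x)))\<^sup>2) < \<epsilon> / 4) sequentially"
    using \<open>0 < \<epsilon>\<close> by (intro order_tendstoD(2)) auto
  then obtain n where n: "(LINT x|lebesgue_on S. (norm (?c (g n x) - ?c (h x)))\<^sup>2) < \<epsilon> / 4"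
    by (auto simp: eventually_sequentially)
  have Lc: "L2_fun (lebesgue_on S) (\<lambda>x. ?c (h x))" and Lg: "L2_fun (lebesgue_on S) (\<lambda>x. ?c (g n x))"
    using T by (auto simp: L2_tendsto_def)
  have L: "L2_fun (lebesgue_on S) (\<lambda>x. h x - ?c (h x))" "L2_fun (lebesgue_on S) (\<lambda>x. ?c (h x) - ?c (g n x))"
    "L2_fun (lebesgue_on S) (\<lambda>x. h x - ?c (g n x))"
    by (intro L2_fun_diff h Lc Lg)+
  have "(LINT x|lebesgue_on S. (h x - ?c (g n x))\<^sup>2) \<le>
     (LINT x|lebesgue_on S. 2 * (h x - ?c (h x))\<^sup>2 + 2 * (?c (h x) - ?c (g n x))\<^sup>2)"
  proof (rule integral_mono)
    fix x
    show "(h x - ?c (g n x))\<^sup>2 \<le> 2 * (h x - ?c (h x))\<^sup>2 + 2 * (?c (h x) - ?c (g n x))\<^sup>2"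
      using add_square_le[of "h x - ?c (h x)" "?c (h x) - ?c (g n x)"] by simp
  next
    show "integrable (lebesgue_on S) (\<lambda>x. (h x - ?c (g n x))\<^sup>2)" using L(3) by (simp only: L2_fun_real)
    show "integrable (lebesgue_on S) (\<lambda>x. 2 * (h x - ?c (h x))\<^sup>2 + 2 * (?c (h x) - ?c (g n x))\<^sup>2)"
      using L(1,2) unfolding L2_fun_real by (intro Bochner_Integration.integrable_add integrable_mult_right) auto
  qed
  also have "\<dots> = 2 * (LINT x|lebesgue_on S. (h x - ?c (h x))\<^sup>2) + 2 * (LINT x|lebesgue_on S. (?c (h x) - ?c (g n x))\<^sup>2)"
    using L(1,2) unfolding L2_fun_real by (subst Bochner_Integration.integral_add) auto
  also have "(LINT x|lebesgue_on S. (?c (h x) - ?c (g n x))\<^sup>2) = (LINT x|lebesgue_on S. (norm (?c (g n x) - ?c (h x)))\<^sup>2)"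
    by (simp add: power2_commute)
  finally have "(LINT x|lebesgue_on S. (h x - ?c (g n x))\<^sup>2) < \<epsilon>" using m n by linarith
  then show ?thesis using that[OF gc] by blast
qed

text \<open>In \<open>x = Re z\<close> and \<open>y = Im z\<close> these are polynomials even in
  \<open>y\<close>. They agree at conjugate points, so they separate points of the half disc only
  because it lies on one side of the real axis.\<close>

inductive_set even_polys :: "(complex \<Rightarrow> real) set" where
  mono: "(\<lambda>z. c * (cmod z ^ (2 * l) * Re (z ^ k))) \<in> even_polys"
| add: "p \<in> even_polys \<Longrightarrow> q \<in> even_polys \<Longrightarrow> (\<lambda>z. p z + q z) \<in> even_polys"

text \<open>This is \<open>2 * Re a * Re b = Re (a * b) + Re (a * cnj b)\<close>, since
  \<open>z ^ k * cnj (z ^ j)\<close> equals \<open>cmod z ^ (2 * j) * z ^ (k - j)\<close>. It makes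
  \<open>even_polys\<close> closed under products.\<close>

lemma Re_power_mult_Re_power:
  assumes "j \<le> k"
  shows "Re (z ^ k) * Re (z ^ j) = (Re (z ^ (k + j)) + cmod z ^ (2 * j) * Re (z ^ (k - j))) / 2"
proof -
  have "z ^ k * cnj (z ^ j) = z ^ (k - j) * (z * cnj z) ^ j"
    using assms by (simp add: power_mult_distrib flip: power_add mult.assoc)
  also have "z * cnj z = of_real ((cmod z)\<^sup>2)" by (rule complex_norm_square[symmetric])
  also have "z ^ (k - j) * of_real ((cmod z)\<^sup>2) ^ j = of_real (cmod z ^ (2 * j)) * z ^ (k - j)"
    by (simp add: power_mult)
  finally have "Re (z ^ k * cnj (z ^ j)) = Re (of_real (cmod z ^ (2 * j)) * z ^ (k - j))" by (rule arg_cong)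
  also have "\<dots> = cmod z ^ (2 * j) * Re (z ^ (k - j))" by (simp del: of_real_power)
  finally have "Re (z ^ k * cnj (z ^ j)) = cmod z ^ (2 * j) * Re (z ^ (k - j))" .
  then have "Re (z ^ k) * Re (z ^ j) + Im (z ^ k) * Im (z ^ j) = cmod z ^ (2 * j) * Re (z ^ (k - j))"
    by (simp del: complex_cnj_power)
  moreover have "Re (z ^ k) * Re (z ^ j) - Im (z ^ k) * Im (z ^ j) = Re (z ^ (k + j))"
    by (simp add: power_add)
  ultimately show ?thesis by (simp add: field_simps)
qed

lemma even_polys_mult_mono:
  assumes "p \<in> even_polys"
  shows "(\<lambda>z. p z * (d * (cmod z ^ (2 * m) * Re (z ^ j)))) \<in> even_polys"
  using assms
proof induction
  case (mono c l k)
  define a b where "a = max j k" and "b = min j k"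
  have "Re (z ^ k) * Re (z ^ j) = (Re (z ^ (a + b)) + cmod z ^ (2 * b) * Re (z ^ (a - b))) / 2" for z
    using Re_power_mult_Re_power[of b a z] by (auto simp: a_def b_def max_def min_def mult.commute)
  then have "(\<lambda>z. c * (cmod z ^ (2 * l) * Re (z ^ k)) * (d * (cmod z ^ (2 * m) * Re (z ^ j)))) =
    (\<lambda>z. c * d * cmod z ^ (2 * l) * cmod z ^ (2 * m) * ((Re (z ^ (a + b)) + cmod z ^ (2 * b) * Re (z ^ (a - b))) / 2))"
    by (metis (no_types, opaque_lifting) mult.assoc mult.left_commute)
  also have "\<dots> = (\<lambda>z. (c * d / 2) * (cmod z ^ (2 * (l + m)) * Re (z ^ (a + b))) +
      (c * d / 2) * (cmod z ^ (2 * (l + m + b)) * Re (z ^ (a - b))))"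
    by (simp add: power_add distrib_left add_divide_distrib mult_ac fun_eq_iff)
  also have "\<dots> \<in> even_polys" by (intro even_polys.intros)
  finally show ?case .
next
  case (add p q)
  then show ?case using even_polys.add[OF add.IH] by (simp add: distrib_right)
qed

lemma even_polys_mult:
  assumes "p \<in> even_polys" "q \<in> even_polys"
  shows "(\<lambda>z. p z * q z) \<in> even_polys"
  using assms(2)
proof induction
  case (mono c l k)
  then show ?case by (rule even_polys_mult_mono[OF assms(1)])
next
  case (add p' q')
  then show ?case using even_polys.add[OF add.IH] by (simp add: distrib_left)
qed

lemma even_polys_dense:
  assumes "continuous_on UNIV \<phi>" "0 < e"
  obtains q where "q \<in> even_polys" "\<And>z. z \<in> half_disc \<Longrightarrow> \<bar>\<phi> z - q z\<bar> < e"
proof -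
  define K where "K = cball 0 1 \<inter> {z::complex. 0 \<le> Im z}"
  have comp: "compact K"
    unfolding K_def by (intro compact_Int_closed compact_cball closed_halfspace_Im_ge)
  interpret function_ring_on even_polys K
  proof
    show "compact K" by (rule comp)
    show "continuous_on K f" if "f \<in> even_polys" for f
      using that by induction (intro continuous_intros; simp)+
    show "(\<lambda>_. c) \<in> even_polys" for c using even_polys.mono[of c 0 0] by simp
    show "\<exists>f\<in>even_polys. f x \<noteq> f y" if "x \<in> K" "y \<in> K" "x \<noteq> y" for x y
    proof (cases "Re x = Re y")
      case False
      then show ?thesis using even_polys.mono[of 1 0 1] by auto
    next
      case True
      \<comment> \<open>Imaginary parts are nonnegative on \<open>K\<close>, so different ones have
        different squares and the modulus separates the points.\<close>
      with that have "(Im x)\<^sup>2 \<noteq> (Im y)\<^sup>2"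
        by (auto simp: K_def complex_eq_iff power2_eq_iff_nonneg)
      then have "(cmod x)\<^sup>2 \<noteq> (cmod y)\<^sup>2" using True by (simp add: cmod_power2)
      then have "cmod x \<noteq> cmod y" by metis
      then show ?thesis using even_polys.mono[of 1 1 0] by (intro bexI) auto
    qed
  qed (auto intro: even_polys.add even_polys_mult)
  obtain q where "q \<in> even_polys" "\<forall>z\<in>K. \<bar>\<phi> z - q z\<bar> < e"
    using Stone_Weierstrass_basic[OF continuous_on_subset[OF assms(1)] assms(2)] by auto
  moreover have "half_disc \<subseteq> K" by (auto simp: half_disc_def K_def)
  ultimately show ?thesis using that by blast
qed

text \<open>Asking for the expansion at every sufficiently large square truncation lets two
  expansions be added at a common size.\<close>

definition finite_expansion :: "(complex \<Rightarrow> real) \<Rightarrow> bool" where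
  "finite_expansion q \<longleftrightarrow> (\<exists>b N. \<forall>L\<ge>N. \<forall>z\<in>half_disc. q z = (\<Sum>k<L. \<Sum>n<L. b k n * half_disc_basis k n z))"

lemma finite_expansion_add:
  assumes "finite_expansion p" "finite_expansion q"
  shows "finite_expansion (\<lambda>z. p z + q z)"
proof -
  from assms obtain b N c N' where
    "\<forall>L\<ge>N. \<forall>z\<in>half_disc. p z = (\<Sum>k<L. \<Sum>n<L. b k n * half_disc_basis k n z)"
    "\<forall>L\<ge>N'. \<forall>z\<in>half_disc. q z = (\<Sum>k<L. \<Sum>n<L. c k n * half_disc_basis k n z)"
    unfolding finite_expansion_def by blast
  then show ?thesis
    unfolding finite_expansion_def
    by (intro exI[of _ "\<lambda>k n. b k n + c k n"] exI[of _ "max N N'"])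
      (auto simp: distrib_right sum.distrib)
qed

lemma finite_expansion_cmult: "finite_expansion p \<Longrightarrow> finite_expansion (\<lambda>z. c * p z)"
proof -
  assume "finite_expansion p"
  then obtain b N where
    "\<forall>L\<ge>N. \<forall>z\<in>half_disc. p z = (\<Sum>k<L. \<Sum>n<L. b k n * half_disc_basis k n z)"
    unfolding finite_expansion_def by blast
  then show ?thesis
    unfolding finite_expansion_def
    by (intro exI[of _ "\<lambda>k n. c * b k n"] exI[of _ N])
      (simp add: sum_distrib_left mult.assoc)
qed

lemma finite_expansion_basis: "finite_expansion (half_disc_basis k0 n0)"
proof -
  have "half_disc_basis k0 n0 z =
      (\<Sum>k<L. \<Sum>n<L. (if k = k0 \<and> n = n0 then 1 else 0) * half_disc_basis k n z)" if "L \<ge> Suc (max k0 n0)" for L z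
  proof -
    have "(\<Sum>k<L. \<Sum>n<L. (if k = k0 \<and> n = n0 then 1 else 0) * half_disc_basis k n z) =
        (\<Sum>k<L. if k = k0 then half_disc_basis k0 n0 z else 0)"
    proof (rule sum.cong[OF refl])
      fix k
      have "(\<Sum>n<L. (if k = k0 \<and> n = n0 then 1 else 0) * half_disc_basis k n z) =
          (\<Sum>n<L. if n = n0 then (if k = k0 then half_disc_basis k0 n0 z else 0) else 0)"
        by (intro sum.cong) auto
      then show "(\<Sum>n<L. (if k = k0 \<and> n = n0 then 1 else 0) * half_disc_basis k n z) =
          (if k = k0 then half_disc_basis k0 n0 z else 0)" using that by (auto simp: Suc_le_eq)
    qed
    then show ?thesis using that by simp
  qed
  then show ?thesis unfolding finite_expansion_def
    by (intro exI[of _ "\<lambda>k n. if k = k0 \<and> n = n0 then 1 else 0"] exI[of _ "Suc (max k0 n0)"]) blast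
qed

lemma finite_expansion_cong:
  "finite_expansion p \<Longrightarrow> (\<And>z. z \<in> half_disc \<Longrightarrow> p z = q z) \<Longrightarrow> finite_expansion q"
  unfolding finite_expansion_def by force

lemma finite_expansion_sum:
  "finite I \<Longrightarrow> (\<And>i. i \<in> I \<Longrightarrow> finite_expansion (p i)) \<Longrightarrow> finite_expansion (\<lambda>z. \<Sum>i\<in>I. p i z)"
proof (induction I rule: finite_induct)
  case empty
  show ?case using finite_expansion_cmult[OF finite_expansion_basis, of 0] by simp
next
  case (insert i I)
  then show ?case using finite_expansion_add[of "p i" "\<lambda>z. \<Sum>i\<in>I. p i z"] by simp
qed

lemma half_disc_basis_eq_sum:
  assumes "z \<in> half_disc"
  shows "half_disc_basis k n z = (\<Sum>l=0..n. c_coeff k l n * (cmod z ^ (2 * l) * Re (z ^ k)))"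
proof -
  have "z \<noteq> 0" using assms by (auto simp: half_disc_def)
  have "z ^ k = (of_real (cmod z) * cis (Arg z)) ^ k"
    using Arg_eq[OF \<open>z \<noteq> 0\<close>] by (simp add: cis_conv_exp)
  then have "z ^ k = of_real (cmod z ^ k) * cis (real k * Arg z)"
    by (simp add: power_mult_distrib Complex.DeMoivre)
  then have "Re (z ^ k) = cmod z ^ k * cos (real k * Arg z)"
    by simp
  then show ?thesis
    by (simp add: half_disc_basis_def L_poly_def sum_distrib_right power_add mult.assoc)
qed

text \<open>\<open>L_poly l k\<close> has the top coefficient
  \<open>c_coeff k l l \<noteq> 0\<close>, so the passage from monomials to basis functions is
  triangular and can be inverted by induction on \<open>l\<close>.\<close>

lemma finite_expansion_mono: "finite_expansion (\<lambda>z. cmod z ^ (2 * l) * Re (z ^ k))"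
proof (induction l rule: less_induct)
  case (less l)
  have "finite_expansion (\<lambda>z. (1 / c_coeff k l l) * (half_disc_basis k l z + 
      (-1) * (\<Sum>i<l. c_coeff k i l * (cmod z ^ (2 * i) * Re (z ^ k)))))"
    by (intro finite_expansion_cmult finite_expansion_add finite_expansion_basis finite_expansion_sum less) auto
  then show ?case
  proof (rule finite_expansion_cong)
    fix z assume "z \<in> half_disc"
    have "{0..l} = insert l {..<l}" by auto
    then have "half_disc_basis k l z = c_coeff k l l * (cmod z ^ (2 * l) * Re (z ^ k)) +
        (\<Sum>i<l. c_coeff k i l * (cmod z ^ (2 * i) * Re (z ^ k)))"
      using half_disc_basis_eq_sum[OF \<open>z \<in> half_disc\<close>, of k l] by simp
    then show "(1 / c_coeff k l l) * (half_disc_basis k l z + 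
      (-1) * (\<Sum>i<l. c_coeff k i l * (cmod z ^ (2 * i) * Re (z ^ k)))) = cmod z ^ (2 * l) * Re (z ^ k)"
      using c_coeff_top_nonzero[of k l] by simp
  qed
qed

lemma finite_expansion_even_polys: "q \<in> even_polys \<Longrightarrow> finite_expansion q"
  by (induction rule: even_polys.induct) (intro finite_expansion_add finite_expansion_cmult finite_expansion_mono; assumption)+

lemma half_disc_basis_dense:
  assumes h: "L2_fun (lebesgue_on half_disc) h" and "0 < \<epsilon>"
  shows "\<exists>b L. (LINT z|lebesgue_on half_disc. (h z - (\<Sum>k<L. \<Sum>n<L. b k n * half_disc_basis k n z))\<^sup>2) < \<epsilon>"
proof -
  interpret finite_measure "lebesgue_on half_disc" by (rule finite_measure_half_disc)
  let ?M = "lebesgue_on half_disc"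
  have "bounded half_disc" by (rule bounded_subset[of "ball 0 1"]) (auto simp: half_disc_def)
  then obtain \<phi> where \<phi>: "continuous_on UNIV \<phi>" "(LINT z|?M. (h z - \<phi> z)\<^sup>2) < \<epsilon> / 4"
    using L2_continuous_approximation[OF open_half_disc _ h, of "\<epsilon> / 4"] \<open>0 < \<epsilon>\<close> by auto
  \<comment> \<open>The summand \<open>1\<close> keeps \<open>V\<close> positive without computing
    the measure. Then \<open>e\<close> is chosen so that a uniform error \<open>e\<close>
    contributes at most \<epsilon>/4 to the squared L2 error.\<close>
  define V where "V = measure ?M (space ?M) + 1"
  have V: "V > 0" unfolding V_def by (simp add: add_nonneg_pos)
  define e where "e = sqrt (\<epsilon> / (4 * V))"
  have e: "e > 0" "e\<^sup>2 * V = \<epsilon> / 4" using V \<open>0 < \<epsilon>\<close> by (auto simp: e_def)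
  obtain q where q: "q \<in> even_polys" "\<And>z. z \<in> half_disc \<Longrightarrow> \<bar>\<phi> z - q z\<bar> < e"
    using even_polys_dense[OF \<phi>(1) e(1)] by blast
  obtain b L where bL: "\<And>z. z \<in> half_disc \<Longrightarrow> q z = (\<Sum>k<L. \<Sum>n<L. b k n * half_disc_basis k n z)"
    using finite_expansion_even_polys[OF q(1)] unfolding finite_expansion_def by blast
  define Q where "Q z = (\<Sum>k<L. \<Sum>n<L. b k n * half_disc_basis k n z)" for z
  have LQ: "L2_fun ?M Q" unfolding Q_def by (intro L2_fun_sum L2_fun_cmult L2_half_disc_basis)
  have L\<phi>Q: "L2_fun ?M (\<lambda>z. \<phi> z - Q z)"
  proof (rule L2_fun_bounded[OF finite_measure_half_disc, where B = e])
    have "\<phi> \<in> borel_measurable ?M" using open_half_disc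
      by (intro continuous_imp_measurable_on_sets_lebesgue continuous_on_subset[OF \<phi>(1)]) auto
    then show "(\<lambda>z. \<phi> z - Q z) \<in> borel_measurable ?M" using LQ by (auto simp: L2_fun_real)
    show "norm (\<phi> z - Q z) \<le> e" if "z \<in> space ?M" for z
      using q(2)[of z] bL[of z] that by (simp add: Q_def space_restrict_space)
  qed
  have LhQ: "L2_fun ?M (\<lambda>z. h z - Q z)" by (intro L2_fun_diff h LQ)
  have "L2_fun ?M (\<lambda>z. (h z - Q z) - (\<phi> z - Q z))" by (intro L2_fun_diff LhQ L\<phi>Q)
  then have Lh\<phi>: "L2_fun ?M (\<lambda>z. h z - \<phi> z)" by simp
  have "(LINT z|?M. (\<phi> z - Q z)\<^sup>2) \<le> (LINT z|?M. e\<^sup>2)"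
  proof (rule integral_mono)
    fix z assume "z \<in> space ?M"
    then have "\<bar>\<phi> z - Q z\<bar> \<le> e" using q(2)[of z] bL[of z] by (simp add: Q_def space_restrict_space)
    then show "(\<phi> z - Q z)\<^sup>2 \<le> e\<^sup>2" using power_mono[of "\<bar>\<phi> z - Q z\<bar>" e 2] by simp
  qed (use L\<phi>Q in \<open>auto simp: L2_fun_real\<close>)
  also have "\<dots> \<le> e\<^sup>2 * V" by (simp add: V_def algebra_simps)
  finally have 1: "(LINT z|?M. (\<phi> z - Q z)\<^sup>2) \<le> \<epsilon> / 4" using e(2) by simp
  have "(LINT z|?M. (h z - Q z)\<^sup>2) \<le> (LINT z|?M. 2 * (h z - \<phi> z)\<^sup>2 + 2 * (\<phi> z - Q z)\<^sup>2)"
  proof (rule integral_mono)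
    fix z
    show "(h z - Q z)\<^sup>2 \<le> 2 * (h z - \<phi> z)\<^sup>2 + 2 * (\<phi> z - Q z)\<^sup>2"
      using add_square_le[of "h z - \<phi> z" "\<phi> z - Q z"] by simp
  qed (use L\<phi>Q LhQ Lh\<phi> in \<open>auto simp: L2_fun_real\<close>)
  also have "\<dots> = 2 * (LINT z|?M. (h z - \<phi> z)\<^sup>2) + 2 * (LINT z|?M. (\<phi> z - Q z)\<^sup>2)"
    using L\<phi>Q Lh\<phi> by (simp add: L2_fun_real)
  finally have "(LINT z|?M. (h z - Q z)\<^sup>2) < \<epsilon>" using 1 \<phi>(2) by linarith
  then show ?thesis unfolding Q_def by blast
qed

text \<open>For \<open>k \<ge> 1\<close> the factor \<open>4 * (2 * n + k + 1) / pi\<close> is the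
  reciprocal of the squared norm of the basis function. For \<open>k = 0\<close> it is twice the
  reciprocal, so \<open>p n 0\<close> is twice the Fourier coefficient, and the \<open>1 / 2\<close>
  in front of \<open>S 0\<close> compensates.\<close>

theorem half_disc_expansion:
  assumes h: "L2_fun (lebesgue_on half_disc) h"
    and p: "\<And>n k. p n k = 4 * real (2 * n + k + 1) / pi * (LINT z|lebesgue_on half_disc. h z * half_disc_basis k n z)"
  shows "\<exists>S. L2_sums (lebesgue_on half_disc) (\<lambda>n z. L_poly n 0 (cmod z) * p n 0) (S 0) \<and>
       (\<forall>k\<ge>1. L2_sums (lebesgue_on half_disc)
         (\<lambda>n z. L_poly n k (cmod z) * cos (real k * Arg z) * p n k) (S k)) \<and>
       L2_tendsto (lebesgue_on half_disc) (\<lambda>K z. 1 / 2 * S 0 z + (\<Sum>k=1..K. S k z)) h"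
proof -
  let ?M = "lebesgue_on half_disc"
  define a where "a k n = (LINT z|?M. h z * half_disc_basis k n z) / (LINT z|?M. (half_disc_basis k n z)\<^sup>2)" for k n
  have sq: "(LINT z|?M. (half_disc_basis k n z)\<^sup>2) = (if k = 0 then pi else pi / 2) / (2 * real (2 * n + k + 1))" for k n
    using half_disc_basis_orthogonal[of k n k n] by (simp add: power2_eq_square del: of_nat_add of_nat_mult)
  have "\<exists>S. (\<forall>k. L2_sums ?M (\<lambda>n z. a k n * half_disc_basis k n z) (S k)) \<and> L2_tendsto ?M (\<lambda>K z. \<Sum>k\<le>K. S k z) h"
  proof (rule L2_iterated_orthogonal_expansion[OF L2_half_disc_basis h])
    show "(LINT z|?M. half_disc_basis k n z * half_disc_basis j m z) = 0" if "(k, n) \<noteq> (j, m)" for k n j m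
      using that by (auto simp: half_disc_basis_orthogonal)
    show "(LINT z|?M. (half_disc_basis k n z)\<^sup>2) > 0" for k n
      unfolding sq by simp
  qed (auto simp: a_def half_disc_basis_dense[OF h])
  then obtain S where S: "\<And>k. L2_sums ?M (\<lambda>n z. a k n * half_disc_basis k n z) (S k)"
    and T: "L2_tendsto ?M (\<lambda>K z. \<Sum>k\<le>K. S k z) h" by blast
  have pa: "p n k = (if k = 0 then 2 else 1) * a k n" for n k
    unfolding p a_def sq by (simp del: of_nat_add of_nat_mult)
  define S' where "S' k z = (if k = 0 then 2 * S 0 z else S k z)" for k z
  have "(1 / 2 * S' 0 z + (\<Sum>k=1..K. S' k z)) = (\<Sum>k\<le>K. S k z)" for K z
  proof -
    have "{..K} = insert 0 {1..K}" by auto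
    then show ?thesis by (auto simp: S'_def intro!: sum.cong)
  qed
  with T have "L2_tendsto ?M (\<lambda>K z. 1 / 2 * S' 0 z + (\<Sum>k=1..K. S' k z)) h" by simp
  moreover have "L2_sums ?M (\<lambda>n z. L_poly n k (cmod z) * cos (real k * Arg z) * p n k) (S' k)" if "k \<ge> 1" for k
  proof -
    have "(\<lambda>n z. L_poly n k (cmod z) * cos (real k * Arg z) * p n k) = (\<lambda>n z. a k n * half_disc_basis k n z)"
      using that by (auto simp: pa half_disc_basis_def mult_ac fun_eq_iff)
    moreover have "S' k = S k" using that by (auto simp: S'_def)
    ultimately show ?thesis using S[of k] by simp
  qed
  moreover have "L2_sums ?M (\<lambda>n z. L_poly n 0 (cmod z) * p n 0) (S' 0)"
  proof -
    have eq: "(\<Sum>n<N. L_poly n 0 (cmod z) * p n 0) = 2 * (\<Sum>n<N. a 0 n * half_disc_basis 0 n z)" for N z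
      by (simp add: pa half_disc_basis_def sum_distrib_left mult_ac)
    have L: "L2_fun ?M (\<lambda>z. \<Sum>n<N. a 0 n * half_disc_basis 0 n z)" "L2_fun ?M (S 0)"
      and lim: "(\<lambda>N. LINT z|?M. (norm ((\<Sum>n<N. a 0 n * half_disc_basis 0 n z) - S 0 z))\<^sup>2) \<longlonglongrightarrow> 0" for N
      using S[of 0] by (auto simp: L2_sums_def L2_tendsto_def)
    have "(LINT z|?M. (norm (2 * (\<Sum>n<N. a 0 n * half_disc_basis 0 n z) - 2 * S 0 z))\<^sup>2) =
       4 * (LINT z|?M. (norm ((\<Sum>n<N. a 0 n * half_disc_basis 0 n z) - S 0 z))\<^sup>2)" for N
    proof -
      have "(norm (2 * x - 2 * y))\<^sup>2 = 4 * (norm (x - y))\<^sup>2" for x y :: real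
        by (simp add: power2_eq_square algebra_simps)
      then show ?thesis by (simp only: integral_mult_right_zero)
    qed
    then have "(\<lambda>N. LINT z|?M. (norm (2 * (\<Sum>n<N. a 0 n * half_disc_basis 0 n z) - 2 * S 0 z))\<^sup>2) \<longlonglongrightarrow> 4 * 0"
      using tendsto_mult[OF tendsto_const lim, of 4] by simp
    moreover have "S' 0 = (\<lambda>z. 2 * S 0 z)" by (auto simp: S'_def)
    ultimately show ?thesis using L
      by (auto simp: L2_sums_def L2_tendsto_def eq intro!: L2_fun_cmult)
  qed
  ultimately show ?thesis by blast
qed

section \<open>The conformal map\<close>

lemma closure_half_disc: "closure half_disc = cball 0 1 \<inter> {z. 0 \<le> Im z}"
proof -
  have "half_disc = ball 0 1 \<inter> {z. 0 < Im z}" by (auto simp: half_disc_def)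
  moreover have "convex (ball 0 (1::real) :: complex set)" "convex {z. 0 < Im z}"
    by (auto intro: convex_halfspace_Im_gt)
  moreover have "rel_interior (ball 0 (1::real) :: complex set) \<inter> rel_interior {z. 0 < Im z} \<noteq> {}"
  proof -
    have "\<i> / 2 \<in> ball 0 1 \<inter> {z. 0 < Im z}" by simp
    then have "ball 0 1 \<inter> {z. 0 < Im z} \<noteq> {}" by blast
    then show ?thesis
      using rel_interior_open[OF open_ball, of "0::complex" 1] rel_interior_open[OF open_halfspace_Im_gt, of 0] by auto
  qed
  ultimately have "closure half_disc = closure (ball 0 1) \<inter> closure {z. 0 < Im z}"
    using closure_Int_convex[of "ball 0 (1::real) :: complex set" "{z. 0 < Im z}"] by metis
  moreover have "closure {z::complex. 0 < Im z} = {z. 0 \<le> Im z}"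
    using closure_halfspace_gt[of \<i> 0] by (simp add: inner_complex_def)
  ultimately show ?thesis by simp
qed

section \<open>The map theta from the half disc to the disc\<close>

lemma less_iff_square_less: "0 \<le> a \<Longrightarrow> 0 \<le> b \<Longrightarrow> a < b \<longleftrightarrow> a\<^sup>2 < (b::real)\<^sup>2"
  by (meson not_le power2_le_imp_le power_mono)

text \<open>With \<open>s = ((1 + z) / (1 - z))^2\<close> the map theta is the Cayley transform
  \<open>(s - \<i>) / (s + \<i>)\<close>: the half disc goes to a quadrant, by squaring to the upper
  half plane, and then to the disc. Clearing the denominator \<open>(1 - z)^2\<close> keeps the
  corner \<open>z = 1\<close> in the domain.\<close>

definition theta_num :: "complex \<Rightarrow> complex" where
  "theta_num z = (1 + z)\<^sup>2 - \<i> * (1 - z)\<^sup>2"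

definition theta_den :: "complex \<Rightarrow> complex" where
  "theta_den z = (1 + z)\<^sup>2 + \<i> * (1 - z)\<^sup>2"

lemma theta_map_eq: "theta_map z = theta_num z / theta_den z"
  by (simp add: theta_map_def theta_num_def theta_den_def)

text \<open>Both sides are \<open>4 * Im s\<close> times \<open>cmod (1 - z) ^ 4\<close>, where
  \<open>s\<close> is the square of \<open>(1 + z) / (1 - z)\<close>. On the closed half disc the
  right side is nonnegative, and it vanishes only on the boundary.\<close>

lemma theta_norm_diff:
  "(cmod (theta_den z))\<^sup>2 - (cmod (theta_num z))\<^sup>2 = 16 * (1 - (cmod z)\<^sup>2) * Im z"
proof -
  obtain x y where z: "z = Complex x y" by (cases z)
  show ?thesis
    unfolding z theta_den_def theta_num_def cmod_power2 by (simp add: power2_eq_square) algebra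
qed

text \<open>Decides on which half of the unit circle a boundary point lands: on the upper half
  circle the second square vanishes, and on the open diameter the first one does.\<close>

lemma Im_theta_num_cnj_den:
  "Im (theta_num z * cnj (theta_den z)) = 2 * ((2 * Im z)\<^sup>2 - (1 - (cmod z)\<^sup>2)\<^sup>2)"
proof -
  obtain x y where z: "z = Complex x y" by (cases z)
  show ?thesis
    unfolding z theta_den_def theta_num_def cmod_power2 by (simp add: power2_eq_square) algebra
qed

text \<open>By the norm identity a zero of the denominator would also be a zero of the numerator,
  and then \<open>1 + z\<close> and \<open>1 - z\<close> would both vanish.\<close>

lemma theta_den_nonzero:
  assumes "cmod z \<le> 1" "0 \<le> Im z"
  shows "theta_den z \<noteq> 0"
proof
  assume "theta_den z = 0"
  have "0 \<le> 16 * (1 - (cmod z)\<^sup>2) * Im z"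
    using assms power_le_one[of "cmod z" 2] by simp
  moreover have "(cmod (theta_den z))\<^sup>2 = 0" using \<open>theta_den z = 0\<close> by simp
  ultimately have "(cmod (theta_num z))\<^sup>2 \<le> 0"
    using theta_norm_diff[of z] by linarith
  then have "theta_num z = 0" by simp
  with \<open>theta_den z = 0\<close> have "theta_num z + theta_den z = 0" "theta_den z - theta_num z = 0" by auto
  then have "2 * (1 + z)\<^sup>2 = 0" "2 * \<i> * (1 - z)\<^sup>2 = 0"
    by (auto simp: theta_num_def theta_den_def algebra_simps)
  then show False by (auto simp: add_eq_0_iff)
qed

lemma theta_cmod:
  assumes "cmod z \<le> 1" "0 \<le> Im z"
  shows "cmod (theta_map z) \<le> 1" "cmod (theta_map z) < 1 \<longleftrightarrow> z \<in> half_disc"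
proof -
  have d: "cmod (theta_den z) > 0" using theta_den_nonzero[OF assms] by simp
  have p: "0 \<le> 1 - (cmod z)\<^sup>2" using assms power_le_one[of "cmod z" 2] by simp
  have ge: "0 \<le> 16 * (1 - (cmod z)\<^sup>2) * Im z" using p assms by simp
  then have "(cmod (theta_num z))\<^sup>2 \<le> (cmod (theta_den z))\<^sup>2" using theta_norm_diff[of z] by linarith
  then have "cmod (theta_num z) \<le> cmod (theta_den z)" by (rule power2_le_imp_le) simp
  then show "cmod (theta_map z) \<le> 1" using d by (simp add: theta_map_eq norm_divide)
  have "cmod (theta_map z) < 1 \<longleftrightarrow> cmod (theta_num z) < cmod (theta_den z)"
    using d by (simp add: theta_map_eq norm_divide)
  also have "\<dots> \<longleftrightarrow> (cmod (theta_num z))\<^sup>2 < (cmod (theta_den z))\<^sup>2"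
    by (rule less_iff_square_less) simp_all
  also have "\<dots> \<longleftrightarrow> 0 < (1 - (cmod z)\<^sup>2) * Im z" using theta_norm_diff[of z] by linarith
  also have "\<dots> \<longleftrightarrow> 0 < 1 - (cmod z)\<^sup>2 \<and> 0 < Im z" using p assms(2) by (auto simp: zero_less_mult_iff)
  also have "0 < 1 - (cmod z)\<^sup>2 \<longleftrightarrow> cmod z < 1"
    using abs_square_less_1[of "cmod z"] by simp
  finally show "cmod (theta_map z) < 1 \<longleftrightarrow> z \<in> half_disc" by (auto simp: half_disc_def)
qed

lemma theta_inj:
  assumes z: "cmod z \<le> 1" "0 \<le> Im z" and w: "cmod w \<le> 1" "0 \<le> Im w" and eq: "theta_map z = theta_map w"
  shows "z = w"
proof -
  have "theta_num z * theta_den w = theta_num w * theta_den z"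
    using eq theta_den_nonzero[OF z] theta_den_nonzero[OF w] by (simp add: theta_map_eq frac_eq_eq)
  moreover have "2 * \<i> * (((1 + z) * (1 - w))\<^sup>2 - ((1 + w) * (1 - z))\<^sup>2) =
      theta_num z * theta_den w - theta_num w * theta_den z"
    unfolding theta_num_def theta_den_def power2_eq_square by algebra
  ultimately have "2 * \<i> * (((1 + z) * (1 - w))\<^sup>2 - ((1 + w) * (1 - z))\<^sup>2) = 0" by simp
  then have "((1 + z) * (1 - w))\<^sup>2 = ((1 + w) * (1 - z))\<^sup>2" by simp
  then consider "(1 + z) * (1 - w) = (1 + w) * (1 - z)" | "(1 + z) * (1 - w) = - ((1 + w) * (1 - z))"
    by (auto simp: power2_eq_iff)
  then show ?thesis
  proof cases
    case 1
    then have "2 * z = 2 * w" by (simp add: algebra_simps)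
    then show ?thesis by simp
  next
    \<comment> \<open>The other square root gives \<open>z * w = 1\<close>. In the closed half disc
      this forces both points onto the unit circle with \<open>w = cnj z\<close>, so both are real
      and therefore equal.\<close>
    case 2
    then have "2 * (z * w) = 2 * 1" by (simp add: algebra_simps)
    then have zw: "z * w = 1" by simp
    then have "cmod z * cmod w = 1" by (metis norm_mult norm_one)
    with z w have "cmod z = 1"
      by (smt (verit) mult_left_le norm_ge_zero mult_right_le_one_le)
    have "w = cnj z"
    proof -
      have "z * cnj z = 1" using \<open>cmod z = 1\<close> complex_norm_square[of z] by simp
      then show ?thesis using zw by (metis mult.left_commute mult.right_neutral)
    qed
    then have "Im z = 0" using z w by simp
    then show ?thesis using \<open>w = cnj z\<close> by (simp add: complex_eq_iff)
  qed
qed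

lemma theta_Im:
  assumes "cmod z \<le> 1" "0 \<le> Im z"
  shows "Im (theta_map z) = 2 * ((2 * Im z)\<^sup>2 - (1 - (cmod z)\<^sup>2)\<^sup>2) / (cmod (theta_den z))\<^sup>2"
proof -
  have "theta_map z = theta_num z * cnj (theta_den z) / of_real ((cmod (theta_den z))\<^sup>2)"
    using theta_den_nonzero[OF assms] unfolding theta_map_eq complex_norm_square by simp
  then show ?thesis by (metis Im_theta_num_cnj_den Im_divide_of_real)
qed

lemma compact_closure_half_disc: "compact (closure half_disc)"
  unfolding closure_half_disc by (intro compact_Int_closed compact_cball closed_halfspace_Im_ge)

section \<open>The disc automorphism sigma and the arc\<close>

context
  fixes \<alpha> :: real
  assumes \<alpha>: "0 < \<alpha>" "\<alpha> < pi / 2"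
begin

text \<open>The parameter \<open>w\<close> of \<open>sigma_map\<close> is
  \<open>- \<i> * sigma_t\<close>. As \<open>sigma_t\<close> is
  \<open>tan (pi / 4 - \<alpha> / 2)\<close>, sine and cosine of \<alpha> are rational functions of
  it.\<close>

definition sigma_t :: real where "sigma_t = cos \<alpha> / (1 + sin \<alpha>)"

lemma sigma_t: "0 < sigma_t" "sigma_t < 1" "cos \<alpha> = 2 * sigma_t / (1 + sigma_t\<^sup>2)"
  "sin \<alpha> = (1 - sigma_t\<^sup>2) / (1 + sigma_t\<^sup>2)"
proof -
  have c: "0 < cos \<alpha>" using \<alpha> by (intro cos_gt_zero_pi) auto
  have s: "0 < sin \<alpha>" using \<alpha> by (intro sin_gt_zero) auto
  show "0 < sigma_t" using c s by (simp add: sigma_t_def)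
  have "cos \<alpha> < 1 + sin \<alpha>" using s cos_le_one[of \<alpha>] by linarith
  then show "sigma_t < 1" using s by (simp add: sigma_t_def)
  have cs: "(cos \<alpha>)\<^sup>2 = 1 - (sin \<alpha>)\<^sup>2" by (simp add: cos_squared_eq)
  have "1 + sigma_t\<^sup>2 = ((1 + sin \<alpha>)\<^sup>2 + (cos \<alpha>)\<^sup>2) / (1 + sin \<alpha>)\<^sup>2"
    using s by (simp add: sigma_t_def power_divide add_divide_distrib)
  also have "\<dots> = 2 * (1 + sin \<alpha>) / (1 + sin \<alpha>)\<^sup>2"
    unfolding cs by (simp add: power2_eq_square algebra_simps)
  also have "\<dots> = 2 / (1 + sin \<alpha>)"
  proof -
    have "2 * u / u\<^sup>2 = 2 / u" for u :: real by (simp add: power2_eq_square)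
    then show ?thesis .
  qed
  finally have eq: "1 + sigma_t\<^sup>2 = 2 / (1 + sin \<alpha>)" .
  show "cos \<alpha> = 2 * sigma_t / (1 + sigma_t\<^sup>2)" unfolding eq using s by (simp add: sigma_t_def)
  have "1 - sigma_t\<^sup>2 = 2 - 2 / (1 + sin \<alpha>)" using eq by simp
  then show "sin \<alpha> = (1 - sigma_t\<^sup>2) / (1 + sigma_t\<^sup>2)"
    unfolding eq using s by (simp add: field_simps)
qed

lemma sigma_map_eq: "sigma_map \<alpha> z = (z + \<i> * sigma_t) / (1 - \<i> * sigma_t * z)"
proof -
  have "(z + \<i> * sigma_t) / (1 - \<i> * sigma_t * z) = (- (z + \<i> * sigma_t)) / (- (1 - \<i> * sigma_t * z))"
    by (rule minus_divide_divide[symmetric])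
  then show ?thesis
    by (simp add: sigma_map_def Let_def sigma_t_def[symmetric])
qed

lemma sigma_den_nonzero:
  assumes "cmod z \<le> 1"
  shows "1 - \<i> * sigma_t * z \<noteq> 0"
proof
  assume "1 - \<i> * sigma_t * z = 0"
  then have "cmod (\<i> * sigma_t * z) = 1" by (metis eq_iff_diff_eq_0 norm_one)
  then have "sigma_t * cmod z = 1" using sigma_t by (simp add: norm_mult)
  then show False using sigma_t assms by (smt (verit) mult_left_le)
qed

lemma sigma_norm_diff:
  "(cmod (1 - \<i> * sigma_t * z))\<^sup>2 - (cmod (z + \<i> * sigma_t))\<^sup>2 = (1 - sigma_t\<^sup>2) * (1 - (cmod z)\<^sup>2)"
  unfolding cmod_power2 by (simp add: power2_eq_square algebra_simps)

lemma sigma_cmod: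
  assumes "cmod z \<le> 1"
  shows "cmod (sigma_map \<alpha> z) \<le> 1" "cmod (sigma_map \<alpha> z) < 1 \<longleftrightarrow> cmod z < 1"
proof -
  have d: "cmod (1 - \<i> * sigma_t * z) > 0" using sigma_den_nonzero[OF assms] by simp
  have s: "0 < 1 - sigma_t\<^sup>2" using sigma_t abs_square_less_1[of sigma_t] by simp
  have p: "0 \<le> 1 - (cmod z)\<^sup>2" using assms power_le_one[of "cmod z" 2] by simp
  have "0 \<le> (1 - sigma_t\<^sup>2) * (1 - (cmod z)\<^sup>2)" using s p by simp
  then have "(cmod (z + \<i> * sigma_t))\<^sup>2 \<le> (cmod (1 - \<i> * sigma_t * z))\<^sup>2" using sigma_norm_diff[of z] by linarith
  then have "cmod (z + \<i> * sigma_t) \<le> cmod (1 - \<i> * sigma_t * z)" by (rule power2_le_imp_le) simp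
  then show "cmod (sigma_map \<alpha> z) \<le> 1" using d by (simp add: sigma_map_eq norm_divide)
  have "cmod (sigma_map \<alpha> z) < 1 \<longleftrightarrow> cmod (z + \<i> * sigma_t) < cmod (1 - \<i> * sigma_t * z)"
    using d by (simp add: sigma_map_eq norm_divide)
  also have "\<dots> \<longleftrightarrow> (cmod (z + \<i> * sigma_t))\<^sup>2 < (cmod (1 - \<i> * sigma_t * z))\<^sup>2"
    by (rule less_iff_square_less) simp_all
  also have "\<dots> \<longleftrightarrow> 0 < (1 - sigma_t\<^sup>2) * (1 - (cmod z)\<^sup>2)" using sigma_norm_diff[of z] by linarith
  also have "\<dots> \<longleftrightarrow> 0 < 1 - (cmod z)\<^sup>2" using s by (simp add: zero_less_mult_iff)
  also have "\<dots> \<longleftrightarrow> cmod z < 1" using abs_square_less_1[of "cmod z"] by simp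
  finally show "cmod (sigma_map \<alpha> z) < 1 \<longleftrightarrow> cmod z < 1" .
qed

lemma sigma_inj:
  assumes "cmod z \<le> 1" "cmod w \<le> 1" "sigma_map \<alpha> z = sigma_map \<alpha> w"
  shows "z = w"
proof -
  have "(z + \<i> * sigma_t) * (1 - \<i> * sigma_t * w) = (w + \<i> * sigma_t) * (1 - \<i> * sigma_t * z)"
    using assms sigma_den_nonzero by (simp add: sigma_map_eq frac_eq_eq)
  then have "(1 - of_real (sigma_t\<^sup>2)) * (z - w) = 0"
    by (simp add: power2_eq_square algebra_simps)
  moreover have "1 - of_real (sigma_t\<^sup>2) \<noteq> (0::complex)"
    using sigma_t abs_square_less_1[of sigma_t]
    by (metis abs_of_pos eq_iff_diff_eq_0 less_irrefl of_real_eq_1_iff)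
  ultimately show ?thesis by simp
qed

text \<open>The arc is symmetric about \<open>\<i>\<close>, so it is the part of the circle that is
  at least as high as its endpoints. This replaces angles by an algebraic condition.\<close>

lemma circ_arc_iff: "\<zeta> \<in> circ_arc \<alpha> \<longleftrightarrow> cmod \<zeta> = 1 \<and> cos \<alpha> \<le> Im \<zeta>"
proof
  assume "\<zeta> \<in> circ_arc \<alpha>"
  then obtain t where t: "\<zeta> = cis t" "pi / 2 - \<alpha> \<le> t" "t \<le> pi / 2 + \<alpha>" by (auto simp: circ_arc_def)
  have "cos \<alpha> \<le> cos \<bar>t - pi / 2\<bar>"
    using t \<alpha> by (intro cos_monotone_0_pi_le) auto
  also have "cos \<bar>t - pi / 2\<bar> = sin t" by (simp add: cos_diff)
  finally show "cmod \<zeta> = 1 \<and> cos \<alpha> \<le> Im \<zeta>" using t by simp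
next
  assume *: "cmod \<zeta> = 1 \<and> cos \<alpha> \<le> Im \<zeta>"
  have c: "0 < cos \<alpha>" using \<alpha> by (intro cos_gt_zero_pi) auto
  define t where "t = Arg \<zeta>"
  have "\<zeta> \<noteq> 0" using * by auto
  then have z: "\<zeta> = cis t" using Arg_eq[of \<zeta>] * by (simp add: t_def cis_conv_exp)
  have "0 < Arg \<zeta>" "Arg \<zeta> < pi" using Arg_lt_pi[of \<zeta>] * c by auto
  then have t: "0 < t" "t < pi" by (auto simp: t_def)
  have "cos \<alpha> \<le> cos \<bar>t - pi / 2\<bar>" using * z by (simp add: cos_diff)
  then have "\<bar>t - pi / 2\<bar> \<le> \<alpha>"
    using t \<alpha> by (subst (asm) cos_mono_le_eq) auto
  then show "\<zeta> \<in> circ_arc \<alpha>" unfolding circ_arc_def z by (intro imageI) (auto simp: abs_le_iff)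
qed

text \<open>When the height of the image is compared with \<open>cos \<alpha>\<close>, the terms
  without \<open>Im z\<close> cancel by the choice of \<open>sigma_t\<close>, and
  \<open>(1 - sigma_t^2)^2 * Im z\<close> remains.\<close>

lemma sigma_in_circ_arc_iff:
  assumes "cmod z = 1"
  shows "sigma_map \<alpha> z \<in> circ_arc \<alpha> \<longleftrightarrow> 0 \<le> Im z"
proof -
  let ?t = sigma_t and ?d = "1 - \<i> * sigma_t * z"
  have d: "(cmod ?d)\<^sup>2 > 0" using sigma_den_nonzero[of z] assms by simp
  have xy: "(Re z)\<^sup>2 + (Im z)\<^sup>2 = 1" using assms by (metis cmod_power2 one_power2)
  have D: "(cmod ?d)\<^sup>2 = 1 + 2 * ?t * Im z + ?t\<^sup>2"
  proof -
    have "(cmod ?d)\<^sup>2 = 1 + 2 * ?t * Im z + ?t\<^sup>2 * ((Re z)\<^sup>2 + (Im z)\<^sup>2)"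
      unfolding cmod_power2 by (simp add: power2_eq_square algebra_simps)
    then show ?thesis using xy by simp
  qed
  have "Im ((z + \<i> * ?t) * cnj ?d) = (1 + ?t\<^sup>2) * Im z + ?t + ?t * ((Re z)\<^sup>2 + (Im z)\<^sup>2)"
    by (simp add: power2_eq_square algebra_simps)
  then have N: "Im ((z + \<i> * ?t) * cnj ?d) = (1 + ?t\<^sup>2) * Im z + 2 * ?t" unfolding xy by simp
  have "sigma_map \<alpha> z = (z + \<i> * ?t) * cnj ?d / of_real ((cmod ?d)\<^sup>2)"
  proof -
    have "cnj ?d \<noteq> 0" using sigma_den_nonzero[of z] assms by (metis complex_cnj_zero_iff order_refl)
    then show ?thesis
      unfolding sigma_map_eq complex_norm_square by (rule mult_divide_mult_cancel_right[symmetric])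
  qed
  then have Im: "Im (sigma_map \<alpha> z) = ((1 + ?t\<^sup>2) * Im z + 2 * ?t) / (1 + 2 * ?t * Im z + ?t\<^sup>2)"
    by (metis D N Im_divide_of_real)
  have norm: "cmod (sigma_map \<alpha> z) = 1"
    using sigma_cmod[of z] assms by auto
  have p: "0 < 1 + 2 * ?t * Im z + ?t\<^sup>2" using d D by simp
  have q: "0 < 1 + ?t\<^sup>2" by (simp add: add_pos_nonneg)
  have s: "0 < 1 - ?t\<^sup>2" using sigma_t abs_square_less_1[of ?t] by simp
  have "cos \<alpha> \<le> Im (sigma_map \<alpha> z) \<longleftrightarrow>
      2 * ?t * (1 + 2 * ?t * Im z + ?t\<^sup>2) \<le> ((1 + ?t\<^sup>2) * Im z + 2 * ?t) * (1 + ?t\<^sup>2)"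
  proof -
    have "a / b \<le> c / d \<longleftrightarrow> a * d \<le> c * b" if "0 < b" "0 < d" for a b c d :: real
      using that by (simp add: field_simps)
    then show ?thesis unfolding Im sigma_t(3) using p q by blast
  qed
  also have "\<dots> \<longleftrightarrow> 0 \<le> (1 - ?t\<^sup>2)\<^sup>2 * Im z"
    by (simp add: power2_eq_square algebra_simps)
  also have "\<dots> \<longleftrightarrow> 0 \<le> Im z" using s by (simp add: zero_le_mult_iff)
  finally show ?thesis using norm by (simp add: circ_arc_iff)
qed

section \<open>The conformal map psi and its inverse\<close>

lemma psi_cmod:
  assumes "z \<in> closure half_disc"
  shows "cmod (psi \<alpha> z) \<le> 1" "cmod (psi \<alpha> z) < 1 \<longleftrightarrow> z \<in> half_disc"
  using assms sigma_cmod[of "theta_map z"] theta_cmod[of z] by (auto simp: psi_def closure_half_disc)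

lemma psi_inj: "inj_on (psi \<alpha>) (closure half_disc)"
proof (rule inj_onI)
  fix z w assume "z \<in> closure half_disc" "w \<in> closure half_disc" and eq: "psi \<alpha> z = psi \<alpha> w"
  then have zw: "cmod z \<le> 1" "0 \<le> Im z" "cmod w \<le> 1" "0 \<le> Im w" by (auto simp: closure_half_disc)
  have "sigma_map \<alpha> (theta_map z) = sigma_map \<alpha> (theta_map w)" using eq by (simp add: psi_def)
  then have "theta_map z = theta_map w"
    by (rule sigma_inj[OF theta_cmod(1)[OF zw(1,2)] theta_cmod(1)[OF zw(3,4)]])
  then show "z = w" by (rule theta_inj[OF zw])
qed

text \<open>On the boundary, \<open>theta_map\<close> sends the open diameter into the open lower
  half circle, which \<open>sigma_map\<close> keeps off the arc. The corners have modulus one and go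
  to the endpoints of the closed arc.\<close>

lemma psi_in_circ_arc_iff:
  assumes z: "z \<in> closure half_disc"
  shows "psi \<alpha> z \<in> circ_arc \<alpha> \<longleftrightarrow> cmod z = 1"
proof (cases "z \<in> half_disc")
  case True
  then have "cmod (psi \<alpha> z) < 1" using psi_cmod[OF z] by simp
  then show ?thesis using True by (auto simp: circ_arc_iff half_disc_def)
next
  case False
  have zz: "cmod z \<le> 1" "0 \<le> Im z" using z by (auto simp: closure_half_disc)
  have "cmod (theta_map z) = 1" using theta_cmod[OF zz] False by simp
  then have "psi \<alpha> z \<in> circ_arc \<alpha> \<longleftrightarrow> 0 \<le> Im (theta_map z)"
    using sigma_in_circ_arc_iff by (simp add: psi_def)
  also have "\<dots> \<longleftrightarrow> 0 \<le> (2 * Im z)\<^sup>2 - (1 - (cmod z)\<^sup>2)\<^sup>2"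
    unfolding theta_Im[OF zz] using theta_den_nonzero[OF zz] by (simp add: zero_le_divide_iff)
  also have "\<dots> \<longleftrightarrow> cmod z = 1"
  proof (cases "cmod z = 1")
    case False
    then have "cmod z < 1" using zz by simp
    then have "Im z = 0" using \<open>z \<notin> half_disc\<close> zz by (auto simp: half_disc_def)
    moreover have "(cmod z)\<^sup>2 < 1" using \<open>cmod z < 1\<close> abs_square_less_1[of "cmod z"] by simp
    ultimately show ?thesis using False by (simp add: not_le)
  qed simp
  finally show ?thesis .
qed

lemma psi_holomorphic: "psi \<alpha> holomorphic_on half_disc"
proof -
  have "theta_map holomorphic_on half_disc"
    unfolding theta_map_def
    by (intro holomorphic_intros) (use theta_den_nonzero in \<open>auto simp: half_disc_def theta_den_def\<close>)
  moreover have "sigma_map \<alpha> holomorphic_on ball 0 1"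
    unfolding sigma_map_eq[abs_def]
    by (intro holomorphic_intros) (use sigma_den_nonzero in auto)
  moreover have "theta_map ` half_disc \<subseteq> ball 0 1"
    using theta_cmod(2) by (auto simp: half_disc_def)
  ultimately show ?thesis unfolding psi_def by (rule holomorphic_on_compose_gen)
qed

lemma psi_continuous: "continuous_on (closure half_disc) (psi \<alpha>)"
proof -
  have "continuous_on (closure half_disc) theta_map"
    unfolding theta_map_def
    by (intro continuous_intros) (use theta_den_nonzero in \<open>auto simp: closure_half_disc theta_den_def\<close>)
  moreover have "continuous_on (cball 0 1) (sigma_map \<alpha>)"
    unfolding sigma_map_eq[abs_def]
    by (intro continuous_intros) (use sigma_den_nonzero in auto)
  moreover have "theta_map ` closure half_disc \<subseteq> cball 0 1"
    using theta_cmod(1) by (auto simp: closure_half_disc)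
  ultimately show ?thesis unfolding psi_def by (metis continuous_on_compose continuous_on_subset)
qed

lemma psi_inj_half_disc: "inj_on (psi \<alpha>) half_disc"
  using psi_inj closure_subset by (rule inj_on_subset)

text \<open>The image of the half disc is open by the open mapping theorem, and relatively closed in
  the disc because it is the part of the compact image of the closure that lies in the disc.\<close>

lemma psi_image_half_disc: "psi \<alpha> ` half_disc = disc"
proof -
  have op: "open (psi \<alpha> ` half_disc)"
    by (rule open_mapping_thm3[OF psi_holomorphic open_half_disc psi_inj_half_disc])
  have eq: "psi \<alpha> ` half_disc = disc \<inter> psi \<alpha> ` closure half_disc"
    using psi_cmod closure_subset[of half_disc] by force
  have "closed (psi \<alpha> ` closure half_disc)"
    by (intro compact_imp_closed compact_continuous_image psi_continuous compact_closure_half_disc)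
  then have cl: "closedin (top_of_set disc) (psi \<alpha> ` half_disc)"
    unfolding eq by (auto simp: closedin_closed)
  have "openin (top_of_set disc) (psi \<alpha> ` half_disc)"
    using op eq by (intro open_openin_trans) auto
  moreover have "connected disc" by simp
  moreover have "psi \<alpha> ` half_disc \<noteq> {}"
  proof -
    have "\<i> / 2 \<in> half_disc" by (simp add: half_disc_def)
    then show ?thesis by blast
  qed
  ultimately show ?thesis using cl by (metis connected_clopen)
qed

lemma psi_image_closure: "psi \<alpha> ` closure half_disc = cball 0 1"
proof
  show "psi \<alpha> ` closure half_disc \<subseteq> cball 0 1" using psi_cmod(1) by auto
  have "closed (psi \<alpha> ` closure half_disc)"
    by (intro compact_imp_closed compact_continuous_image psi_continuous compact_closure_half_disc)
  moreover have "disc \<subseteq> psi \<alpha> ` closure half_disc"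
    using psi_image_half_disc closure_subset[of half_disc] by blast
  ultimately have "closure disc \<subseteq> psi \<alpha> ` closure half_disc" by (rule closure_minimal[rotated])
  then show "cball 0 1 \<subseteq> psi \<alpha> ` closure half_disc" by simp
qed

lemma psi_inv_psi: "z \<in> closure half_disc \<Longrightarrow> psi_inv \<alpha> (psi \<alpha> z) = z"
  unfolding psi_inv_def by (rule inv_into_f_f[OF psi_inj])

lemma psi_psi_inv: "\<zeta> \<in> cball 0 1 \<Longrightarrow> psi \<alpha> (psi_inv \<alpha> \<zeta>) = \<zeta>"
  unfolding psi_inv_def by (rule f_inv_into_f) (simp add: psi_image_closure)

lemma psi_inv_in_closure: "\<zeta> \<in> cball 0 1 \<Longrightarrow> psi_inv \<alpha> \<zeta> \<in> closure half_disc"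
  unfolding psi_inv_def by (rule inv_into_into) (simp add: psi_image_closure)

lemma psi_inv_in_half_disc: "\<zeta> \<in> disc \<Longrightarrow> psi_inv \<alpha> \<zeta> \<in> half_disc"
  using psi_cmod(2)[OF psi_inv_in_closure, of \<zeta>] psi_psi_inv[of \<zeta>] by auto

lemma psi_inv_continuous: "continuous_on (cball 0 1) (psi_inv \<alpha>)"
  using continuous_on_inv[OF psi_continuous compact_closure_half_disc, of "psi_inv \<alpha>"]
  by (simp add: psi_inv_psi psi_image_closure)

lemma psi_deriv_nonzero: "z \<in> half_disc \<Longrightarrow> deriv (psi \<alpha>) z \<noteq> 0"
  by (rule holomorphic_injective_imp_regular[OF psi_holomorphic open_half_disc psi_inj_half_disc])

lemma psi_inv_holomorphic: "psi_inv \<alpha> holomorphic_on disc"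
  and psi_inv_deriv: "z \<in> half_disc \<Longrightarrow> deriv (psi \<alpha>) z * deriv (psi_inv \<alpha>) (psi \<alpha> z) = 1"
proof -
  obtain g where g: "g holomorphic_on psi \<alpha> ` half_disc"
    "\<And>z. z \<in> half_disc \<Longrightarrow> deriv (psi \<alpha>) z * deriv g (psi \<alpha> z) = 1"
    "\<And>z. z \<in> half_disc \<Longrightarrow> g (psi \<alpha> z) = z"
    using holomorphic_has_inverse[OF psi_holomorphic open_half_disc psi_inj_half_disc] by metis
  have eq: "psi_inv \<alpha> \<zeta> = g \<zeta>" if "\<zeta> \<in> disc" for \<zeta>
    using g(3)[OF psi_inv_in_half_disc[OF that]] psi_psi_inv[of \<zeta>] that by simp
  show "psi_inv \<alpha> holomorphic_on disc"
    using g(1) eq unfolding psi_image_half_disc by (metis holomorphic_transform)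
  show "deriv (psi \<alpha>) z * deriv (psi_inv \<alpha>) (psi \<alpha> z) = 1" if z: "z \<in> half_disc"
  proof -
    have "psi \<alpha> z \<in> disc" using psi_image_half_disc z by blast
    then have "eventually (\<lambda>\<zeta>. \<zeta> \<in> disc) (nhds (psi \<alpha> z))"
      by (intro eventually_nhds_in_open) auto
    then have "eventually (\<lambda>\<zeta>. psi_inv \<alpha> \<zeta> = g \<zeta>) (nhds (psi \<alpha> z))"
      by (rule eventually_mono) (rule eq)
    then have "deriv (psi_inv \<alpha>) (psi \<alpha> z) = deriv g (psi \<alpha> z)" by (rule deriv_cong_ev) simp
    then show ?thesis using g(2)[OF z] by simp
  qed
qed

text \<open>On the arc \<open>psi_inv \<alpha> \<zeta>\<close> has modulus one, so the imaginary
  part of its power is the sine of a multiple of its argument. Off the arc it is real, and the right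
  side vanishes like the extension by zero.\<close>

lemma sine_data_eq:
  assumes "cmod \<zeta> = 1"
  shows "ext0 (circ_arc \<alpha>) (sine_data \<alpha> n) \<zeta> = Im (psi_inv \<alpha> \<zeta> ^ n)"
proof -
  define z where "z = psi_inv \<alpha> \<zeta>"
  have z: "z \<in> closure half_disc" "psi \<alpha> z = \<zeta>"
    using assms psi_inv_in_closure psi_psi_inv by (auto simp: z_def)
  have zb: "z \<notin> half_disc" using psi_cmod(2)[OF z(1)] z(2) assms by auto
  show ?thesis
  proof (cases "\<zeta> \<in> circ_arc \<alpha>")
    case True
    then have "cmod z = 1" using psi_in_circ_arc_iff[OF z(1)] z(2) by simp
    then have "z \<noteq> 0" by auto
    then have "z = cis (Arg z)" using Arg_eq[of z] \<open>cmod z = 1\<close> by (auto simp: cis_conv_exp)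
    then have "z ^ n = cis (real n * Arg z)" by (metis Complex.DeMoivre)
    then have "Im (z ^ n) = sin (real n * Arg z)" by simp
    then show ?thesis using True by (simp add: ext0_def sine_data_def z_def)
  next
    case False
    then have "cmod z < 1" using psi_in_circ_arc_iff[OF z(1)] z by (auto simp: closure_half_disc)
    moreover have "0 \<le> Im z" using z(1) by (simp add: closure_half_disc)
    ultimately have "Im z = 0" using zb by (auto simp: half_disc_def)
    then have "z = of_real (Re z)" by (simp add: complex_eq_iff)
    then have "Im (z ^ n) = 0" by (metis Im_complex_of_real of_real_power)
    then show ?thesis using False by (simp add: ext0_def z_def)
  qed
qed

end

section \<open>Imaginary parts of holomorphic functions in the Sobolev space\<close>

lemma pdiff_eqI: "(u has_derivative u') (at z) \<Longrightarrow> pdiff v u z = u' v"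
  unfolding pdiff_def by (metis frechet_derivative_at)

lemma has_derivative_pdiff: "u differentiable (at z) \<Longrightarrow> (u has_derivative (\<lambda>h. pdiff h u z)) (at z)"
  unfolding pdiff_def by (simp add: frechet_derivative_works)

lemma has_real_derivative_line:
  assumes "u differentiable (at (z + of_real t * v))"
  shows "((\<lambda>t. u (z + of_real t * v)) has_real_derivative pdiff v u (z + of_real t * v)) (at t)"
proof -
  note der = has_derivative_pdiff[OF assms]
  have "((\<lambda>t. u (z + of_real t * v)) has_derivative (\<lambda>s. pdiff (of_real s * v) u (z + of_real t * v))) (at t)"
    by (rule has_derivative_compose[where f = "\<lambda>t. z + of_real t * v" and g = u, OF _ der])
      (auto intro!: derivative_eq_intros)
  moreover have "pdiff (of_real s * v) u (z + of_real t * v) = pdiff v u (z + of_real t * v) * s" for s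
    using linear_scale[OF has_derivative_linear[OF der], of s v] by (simp add: scaleR_conv_of_real)
  ultimately show ?thesis by (simp add: has_field_derivative_def)
qed

lemma has_derivative_Im_holomorphic:
  assumes "open S" "F holomorphic_on S" "\<And>z. z \<in> S \<Longrightarrow> u z = Im (F z)" "z \<in> S"
  shows "(u has_derivative (\<lambda>h. Im (deriv F z * h))) (at z)"
proof -
  have "(F has_derivative (\<lambda>h. deriv F z * h)) (at z)"
    using holomorphic_derivI[OF assms(2,1,4)] by (simp add: has_field_derivative_def)
  then have "((\<lambda>z. Im (F z)) has_derivative (\<lambda>h. Im (deriv F z * h))) (at z)"
    by (rule has_derivative_Im)
  then show ?thesis
    by (rule has_derivative_transform_within_open[OF _ assms(1,4)]) (use assms(3) in auto)
qed

lemma pdiff_Im_holomorphic: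
  assumes "open S" "F holomorphic_on S" "\<And>z. z \<in> S \<Longrightarrow> u z = Im (F z)" "z \<in> S"
  shows "pdiff v u z = Im (v * deriv F z)"
  using pdiff_eqI[OF has_derivative_Im_holomorphic[OF assms]] by (simp add: mult.commute)

lemma holomorphic_cmult_deriv: "open S \<Longrightarrow> F holomorphic_on S \<Longrightarrow> (\<lambda>z. c * deriv F z) holomorphic_on S"
  by (intro holomorphic_intros) auto

text \<open>The derivative of \<open>Im F\<close> along \<open>v\<close> is the imaginary part of
  the holomorphic function \<open>v * F'\<close>; the induction therefore runs over all
  \<open>F\<close>.\<close>

lemma Ck_on_Im_holomorphic:
  assumes "open S"
  shows "F holomorphic_on S \<Longrightarrow> (\<And>z. z \<in> S \<Longrightarrow> u z = Im (F z)) \<Longrightarrow> Ck_on k S u"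
proof (induction k arbitrary: F u)
  case 0
  have "continuous_on S (\<lambda>z. Im (F z))"
    using 0 by (intro continuous_intros holomorphic_on_imp_continuous_on)
  then have "continuous_on S u" by (rule continuous_on_eq) (use 0 in auto)
  then show ?case by simp
next
  case (Suc k)
  have "u differentiable (at z)" if "z \<in> S" for z
    using has_derivative_Im_holomorphic[OF assms Suc.prems that] by (auto simp: differentiable_def)
  moreover have "Ck_on k S (pdiff v u)" for v
    by (rule Suc.IH[OF holomorphic_cmult_deriv[OF assms Suc.prems(1), of v]])
      (rule pdiff_Im_holomorphic[OF assms Suc.prems])
  ultimately show ?case by simp
qed

text \<open>The second derivative along \<open>v\<close> is the imaginary part of
  \<open>v * v * F''\<close>, and \<open>1 + \<i> * \<i> = 0\<close>.\<close>

lemma harmonic_on_Im_holomorphic: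
  assumes "open S" "F holomorphic_on S" "\<And>z. z \<in> S \<Longrightarrow> u z = Im (F z)"
  shows "harmonic_on S u"
  unfolding harmonic_on_def
proof (intro conjI ballI)
  show "Ck_on 2 S u" by (rule Ck_on_Im_holomorphic[OF assms])
  fix z assume z: "z \<in> S"
  have d: "deriv (\<lambda>z. v * deriv F z) z = v * deriv (deriv F) z" for v
    using assms z by (intro deriv_cmult) (auto intro!: holomorphic_on_imp_differentiable_at[of _ S] holomorphic_deriv)
  have "pdiff v (pdiff v u) z = Im (v * (v * deriv (deriv F) z))" for v
    using pdiff_Im_holomorphic[OF assms(1) holomorphic_cmult_deriv[OF assms(1,2), of v] pdiff_Im_holomorphic[OF assms] z]
    by (simp add: d)
  then show "pdiff 1 (pdiff 1 u) z + pdiff \<i> (pdiff \<i> u) z = 0" by simp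
qed

lemma grad_Im_holomorphic:
  assumes "open S" "F holomorphic_on S" "\<And>z. z \<in> S \<Longrightarrow> u z = Im (F z)" "z \<in> S"
  shows "grad u z = \<i> * cnj (deriv F z)"
  using pdiff_Im_holomorphic[OF assms] by (simp add: grad_def complex_eq_iff)

section \<open>Classical gradients are weak gradients\<close>

lemma continuous_compact_support:
  fixes g :: "complex \<Rightarrow> real"
  assumes S: "open S" "continuous_on S g" and K: "compact K" "K \<subseteq> S" and z: "\<And>z. z \<in> S - K \<Longrightarrow> g z = 0"
  shows "continuous_on UNIV (\<lambda>z. if z \<in> S then g z else 0)"
    and "integrable lborel (\<lambda>z. if z \<in> S then g z else 0)"
    and "integrable (lebesgue_on S) g"
    and "(LINT z|lebesgue_on S. g z) = (LINT z|lborel. (if z \<in> S then g z else 0))"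
proof -
  let ?g = "\<lambda>z. if z \<in> S then g z else 0"
  have "continuous_on S ?g" by (rule continuous_on_eq[OF S(2)]) simp
  moreover have "continuous_on (- K) ?g"
  proof -
    have "?g z = 0" if "z \<in> - K" for z using z that by auto
    then show ?thesis by (intro continuous_on_eq[OF continuous_on_const[of _ 0]]) metis
  qed
  moreover have "open (- K)" using K by (simp add: compact_imp_closed open_Compl)
  ultimately have "continuous_on (S \<union> - K) ?g" using S(1) by (intro continuous_on_open_Un)
  then show c: "continuous_on UNIV ?g" 
  proof -
    have "S \<union> - K = UNIV" using K by auto
    then show ?thesis using \<open>continuous_on (S \<union> - K) ?g\<close> by simp
  qed
  have "integrable lborel (\<lambda>z. indicator K z *\<^sub>R ?g z)"
    by (rule borel_integrable_compact[OF K(1) continuous_on_subset[OF c]]) simp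
  moreover have "(\<lambda>z. indicator K z *\<^sub>R ?g z) = ?g"
    using K(2) z by (auto simp: indicator_def fun_eq_iff)
  ultimately show i: "integrable lborel ?g" by simp
  have Sl: "S \<in> sets lebesgue" using S by auto
  have eq: "?g = (\<lambda>z. indicator S z *\<^sub>R g z)" by (auto simp: indicator_def)
  have "integrable lebesgue ?g" using i by (rule integrable_completion[THEN iffD2, rotated]) (use i in auto)
  then show "integrable (lebesgue_on S) g"
    using Sl by (simp add: integrable_restrict_space eq)
  have "(LINT z|lebesgue_on S. g z) = (LINT z|lebesgue. ?g z)"
    using Sl by (simp add: integral_restrict_space eq)
  also have "\<dots> = (LINT z|lborel. ?g z)" using i by (intro integral_completion) auto
  finally show "(LINT z|lebesgue_on S. g z) = (LINT z|lborel. ?g z)" .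
qed

text \<open>By translation invariance every difference quotient of \<open>f\<close> has integral \<open>0\<close>.\<close>

lemma integral_pdiff_compact_support:
  fixes f :: "complex \<Rightarrow> real"
  assumes diff: "\<And>z. f differentiable (at z)" and cont: "continuous_on UNIV (pdiff v f)"
    and K: "compact K" "\<And>z. z \<notin> K \<Longrightarrow> f z = 0" and v: "norm v \<le> 1"
  shows "(LINT z|lborel. pdiff v f z) = 0"
proof -
  have fc: "continuous_on UNIV f"
    using diff by (intro continuous_at_imp_continuous_on ballI differentiable_imp_continuous_within) auto
  have fi: "integrable lborel f"
  proof -
    have "integrable lborel (\<lambda>z. if z \<in> UNIV then f z else 0)"
      using K by (intro continuous_compact_support(2)[of UNIV f K] fc) auto
    then show ?thesis by simp
  qed
  obtain R where R: "0 < R" "K \<subseteq> cball 0 R"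
    using compact_imp_bounded[OF K(1)] by (metis bounded_pos subset_iff mem_cball_0)
  \<comment> \<open>The radius \<open>R + 1\<close> leaves room for the shift in the difference
    quotient, whose length is at most \<open>1\<close>: outside this disc both \<open>z\<close> and
    its translate avoid \<open>K\<close>.\<close>
  obtain B where B: "\<And>z. z \<in> cball 0 (R + 1) \<Longrightarrow> \<bar>pdiff v f z\<bar> \<le> B"
  proof -
    have "bounded (pdiff v f ` cball 0 (R + 1))"
      by (intro compact_imp_bounded compact_continuous_image continuous_on_subset[OF cont]) auto
    then show ?thesis using that unfolding bounded_iff by (metis imageI real_norm_def)
  qed
  have p0: "pdiff v f z = 0" if "z \<notin> K" for z
  proof (rule pdiff_eqI)
    have "((\<lambda>z. 0) has_derivative (\<lambda>h. 0)) (at z)" by simp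
    then show "(f has_derivative (\<lambda>h. 0)) (at z)"
      by (rule has_derivative_transform_within_open[where s = "- K"])
        (use that K in \<open>auto simp: compact_imp_closed open_Compl\<close>)
  qed
  have B': "\<bar>pdiff v f z\<bar> \<le> max B 0" for z
    using B[of z] p0[of z] R by (cases "z \<in> K") force+
  have line: "((\<lambda>t. f (z + of_real t * v)) has_real_derivative pdiff v f (z + of_real t * v)) (at t)" for z t
    by (rule has_real_derivative_line[OF diff])
  define \<epsilon> where "\<epsilon> n = 1 / real (Suc n)" for n
  have \<epsilon>: "0 < \<epsilon> n" "\<epsilon> n \<le> 1" for n by (auto simp: \<epsilon>_def)
  have \<epsilon>0: "\<epsilon> \<longlonglongrightarrow> 0" unfolding \<epsilon>_def by (rule LIMSEQ_Suc[OF lim_1_over_n])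
  define D where "D n z = (f (of_real (\<epsilon> n) * v + z) - f z) / \<epsilon> n" for n z
  have fm: "f \<in> borel_measurable borel" using fc by (rule borel_measurable_continuous_onI)
  have pm: "pdiff v f \<in> borel_measurable borel" using cont by (rule borel_measurable_continuous_onI)
  have tr: "integrable lborel (\<lambda>z. f (c + z))" "(LINT z|lborel. f (c + z)) = (LINT z|lborel. f z)" for c
    using integrable_distr_eq[of "(+) c" lborel borel f] integral_distr[of "(+) c" lborel borel f] fm fi
    by (simp_all add: lborel_distr_plus)
  have "(LINT z|lborel. D n z) = 0" for n
    unfolding D_def using tr fi by simp
  moreover have "(\<lambda>n. LINT z|lborel. D n z) \<longlonglongrightarrow> (LINT z|lborel. pdiff v f z)"
  proof (rule integral_dominated_convergence[where w = "\<lambda>z. indicator (cball 0 (R + 1)) z *\<^sub>R max B 0"])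
    show "integrable lborel (\<lambda>z. indicator (cball 0 (R + 1)) z *\<^sub>R max B 0 :: real)"
      by (rule borel_integrable_compact) auto
    show "AE z in lborel. (\<lambda>n. D n z) \<longlonglongrightarrow> pdiff v f z"
    proof (rule AE_I2)
      fix z
      have "((\<lambda>t. f (z + of_real t * v)) has_real_derivative pdiff v f z) (at 0)" using line[of z 0] by simp
      then have "((\<lambda>t. (f (z + of_real t * v) - f z) / t) \<longlongrightarrow> pdiff v f z) (at 0)"
        by (simp add: has_field_derivative_iff)
      moreover have "filterlim \<epsilon> (at 0) sequentially"
        using \<epsilon>0 \<epsilon>(1) by (intro filterlim_atI) (auto intro!: always_eventually simp: less_imp_neq[symmetric])
      ultimately have "(\<lambda>n. (f (z + of_real (\<epsilon> n) * v) - f z) / \<epsilon> n) \<longlonglongrightarrow> pdiff v f z"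
        by (rule filterlim_compose)
      then show "(\<lambda>n. D n z) \<longlonglongrightarrow> pdiff v f z" by (simp add: D_def add.commute)
    qed
    show "AE z in lborel. norm (D n z) \<le> indicator (cball 0 (R + 1)) z *\<^sub>R max B 0" for n
    proof (rule AE_I2)
      fix z
      show "norm (D n z) \<le> indicator (cball 0 (R + 1)) z *\<^sub>R max B 0"
      proof (cases "z \<in> cball 0 (R + 1)")
        case True
        obtain s where "f (z + of_real (\<epsilon> n) * v) - f (z + of_real 0 * v) = (\<epsilon> n - 0) * pdiff v f (z + of_real s * v)"
          using MVT2[OF \<epsilon>(1)[of n], of "\<lambda>t. f (z + of_real t * v)" "\<lambda>t. pdiff v f (z + of_real t * v)"] line by blast
        then have "D n z = pdiff v f (z + of_real s * v)" using \<epsilon>(1)[of n] by (simp add: D_def add.commute)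
        then show ?thesis using B' True by simp
      next
        case False
        then have "norm z > R + 1" by simp
        moreover have "norm (of_real (\<epsilon> n) * v) \<le> 1"
          using v \<epsilon>[of n] by (simp add: norm_mult mult_le_one)
        ultimately have "norm (of_real (\<epsilon> n) * v + z) > R"
          using norm_triangle_ineq4[of "of_real (\<epsilon> n) * v + z" "of_real (\<epsilon> n) * v"] by simp
        then have "of_real (\<epsilon> n) * v + z \<notin> K" "z \<notin> K" using R \<open>norm z > R + 1\<close> by auto
        then show ?thesis using K(2) False by (simp add: D_def)
      qed
    qed
    show "D n \<in> borel_measurable lborel" for n
      unfolding D_def using fm by measurable
    show "pdiff v f \<in> borel_measurable lborel" using pm by simp
  qed
  ultimately show ?thesis by (simp add: LIMSEQ_const_iff)
qed

text \<open>Integration by parts: the product of \<open>u\<close> with a test function, extended by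
  zero, is differentiable on the whole plane, and the derivative of a compactly supported function
  has integral zero.\<close>

lemma weak_gradient_grad:
  assumes S: "open S" and C1: "Ck_on 1 S u"
  shows "weak_gradient S u (grad u)"
  unfolding weak_gradient_def
proof (intro allI impI ballI)
  fix \<phi> v assume \<phi>: "test_function S \<phi>" and v: "v \<in> {1, \<i>}"
  define K where "K = closure {z. \<phi> z \<noteq> 0}"
  have K: "compact K" "K \<subseteq> S" "\<And>z. z \<notin> K \<Longrightarrow> \<phi> z = 0"
    using \<phi> closure_subset[of "{z. \<phi> z \<noteq> 0}"] by (auto simp: test_function_def K_def)
  have "Ck_on 1 UNIV \<phi>" using \<phi> by (simp add: test_function_def smooth_on_def)
  then have \<phi>d: "\<phi> differentiable (at z)" and \<phi>c: "continuous_on UNIV (pdiff v \<phi>)" for z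
    using v by auto
  have ud: "u differentiable (at z)" if "z \<in> S" for z using C1 that by simp
  have uc: "continuous_on S (pdiff v u)" using C1 v by auto
  have uC: "continuous_on S u" using ud S
    by (intro continuous_at_imp_continuous_on ballI differentiable_imp_continuous_within) auto
  have \<phi>C: "continuous_on S \<phi>" using \<phi>d
    by (intro continuous_at_imp_continuous_on ballI differentiable_imp_continuous_within) auto
  have nK: "open (- K)" using K by (simp add: compact_imp_closed open_Compl)
  have p0: "pdiff v \<phi> z = 0" if "z \<notin> K" for z
  proof (rule pdiff_eqI)
    have "((\<lambda>z. 0) has_derivative (\<lambda>h. 0)) (at z)" by simp
    then show "(\<phi> has_derivative (\<lambda>h. 0)) (at z)"
      by (rule has_derivative_transform_within_open[OF _ nK]) (use that K in auto)
  qed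
  define f where "f z = (if z \<in> S then u z * \<phi> z else 0)" for z
  define f' where "f' z = (if z \<in> S then u z * pdiff v \<phi> z + pdiff v u z * \<phi> z else 0)" for z
  have fd: "f differentiable (at z) \<and> pdiff v f z = f' z" for z
  proof (cases "z \<in> S")
    case True
    have "(u has_derivative (\<lambda>h. pdiff h u z)) (at z)" "(\<phi> has_derivative (\<lambda>h. pdiff h \<phi> z)) (at z)"
      using has_derivative_pdiff ud[OF True] \<phi>d[of z] by auto
    then have "((\<lambda>z. u z * \<phi> z) has_derivative (\<lambda>h. u z * pdiff h \<phi> z + pdiff h u z * \<phi> z)) (at z)"
      by (rule has_derivative_mult)
    then have "(f has_derivative (\<lambda>h. u z * pdiff h \<phi> z + pdiff h u z * \<phi> z)) (at z)"
      by (rule has_derivative_transform_within_open[OF _ S True]) (auto simp: f_def)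
    then show ?thesis using pdiff_eqI True by (auto simp: differentiable_def f'_def)
  next
    case False
    then have "z \<in> - K" using K by auto
    have "((\<lambda>z. 0) has_derivative (\<lambda>h. 0)) (at z)" by simp
    then have "(f has_derivative (\<lambda>h. 0)) (at z)"
      by (rule has_derivative_transform_within_open[OF _ nK \<open>z \<in> - K\<close>]) (use K in \<open>auto simp: f_def\<close>)
    then show ?thesis using pdiff_eqI False by (auto simp: differentiable_def f'_def)
  qed
  then have pf: "pdiff v f = f'" by auto
  have c1: "continuous_on S (\<lambda>z. u z * pdiff v \<phi> z)" and c2: "continuous_on S (\<lambda>z. pdiff v u z * \<phi> z)"
    by (intro continuous_intros uC uc \<phi>C continuous_on_subset[OF \<phi>c]; simp)+
  note I1 = continuous_compact_support[OF S c1 K(1,2)]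
  note I2 = continuous_compact_support[OF S c2 K(1,2)]
  note I3 = continuous_compact_support[OF S continuous_on_add[OF c1 c2] K(1,2)]
  have "(LINT z|lborel. f' z) = 0"
    unfolding pf[symmetric]
  proof (rule integral_pdiff_compact_support[OF _ _ K(1)])
    show "continuous_on UNIV (pdiff v f)"
      unfolding pf f'_def using I3(1) p0 K(3) by simp
  qed (use fd K v in \<open>auto simp: f_def\<close>)
  then have "(LINT z|lebesgue_on S. u z * pdiff v \<phi> z + pdiff v u z * \<phi> z) = 0"
    using I3(4) p0 K(3) by (simp add: f'_def)
  moreover have "(LINT z|lebesgue_on S. u z * pdiff v \<phi> z + pdiff v u z * \<phi> z) =
      (LINT z|lebesgue_on S. u z * pdiff v \<phi> z) + (LINT z|lebesgue_on S. pdiff v u z * \<phi> z)"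
    using I1(3) I2(3) p0 K(3) by (intro Bochner_Integration.integral_add) auto
  moreover have "pdiff v u z = grad u z \<bullet> v" for z
    using v by (auto simp: grad_def inner_complex_def)
  ultimately show "(LINT z|lebesgue_on S. u z * pdiff v \<phi> z) = - (LINT z|lebesgue_on S. (grad u z \<bullet> v) * \<phi> z)"
    by simp
qed

text \<open>The dilates \<open>F (\<rho> * z)\<close> with \<open>\<rho> < 1\<close> are holomorphic
  across the unit circle, so their imaginary parts are admissible approximants. Values converge
  boundedly because \<open>F\<close> is continuous on the closed disc; \<open>deriv F\<close> may be
  unbounded, so the gradients are controlled through the Dirichlet integral.\<close>

theorem has_trace_Im_holomorphic:
  assumes F: "F holomorphic_on disc" "continuous_on (cball 0 1) F"
    and int: "integrable (lebesgue_on disc) (\<lambda>z. (cmod (deriv F z))\<^sup>2)"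
    and u: "\<And>z. z \<in> disc \<Longrightarrow> u z = Im (F z)" and b: "\<And>t. b (cis t) = Im (F (cis t))"
  shows "H1_with_gradient disc u (grad u)" "has_trace u b"
proof -
  have fin: "finite_measure (lebesgue_on disc)" by (rule finite_measure_lebesgue_on_bounded) auto
  have dl: "disc \<in> sets lebesgue" by auto
  obtain B where B: "\<And>z. z \<in> cball 0 1 \<Longrightarrow> \<bar>Im (F z)\<bar> \<le> B"
  proof -
    have "bounded (F ` cball 0 1)"
      by (intro compact_imp_bounded compact_continuous_image F) auto
    then obtain B where "\<And>z. z \<in> cball 0 1 \<Longrightarrow> cmod (F z) \<le> B" unfolding bounded_iff by blast
    then show ?thesis using that abs_Im_le_cmod order.trans by metis
  qed
  have F'c: "continuous_on disc (deriv F)"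
    using F by (intro holomorphic_on_imp_continuous_on holomorphic_deriv) auto
  have gu: "grad u z = \<i> * cnj (deriv F z)" if "z \<in> disc" for z
    by (rule grad_Im_holomorphic[OF open_ball F(1) u that])
  have uc: "continuous_on disc u"
  proof -
    have "continuous_on disc (\<lambda>z. Im (F z))" using F by (intro continuous_intros holomorphic_on_imp_continuous_on)
    then show ?thesis by (rule continuous_on_eq) (use u in auto)
  qed
  have um: "u \<in> borel_measurable (lebesgue_on disc)"
    by (rule continuous_imp_measurable_on_sets_lebesgue[OF uc dl])
  have gum: "grad u \<in> borel_measurable (lebesgue_on disc)"
  proof (rule continuous_imp_measurable_on_sets_lebesgue[OF _ dl])
    have "continuous_on disc (\<lambda>z. \<i> * cnj (deriv F z))" by (intro continuous_intros F'c)
    then show "continuous_on disc (grad u)" by (rule continuous_on_eq) (use gu in auto)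
  qed
  have Lu: "L2_fun (lebesgue_on disc) u"
    by (rule L2_fun_bounded[OF fin um, where B = B]) (use u B in auto)
  have gint: "integrable (lebesgue_on disc) (\<lambda>z. (cmod (grad u z))\<^sup>2)"
    "(LINT z|lebesgue_on disc. (cmod (grad u z))\<^sup>2) = (LINT z|lebesgue_on disc. (cmod (deriv F z))\<^sup>2)"
  proof -
    have eq: "(cmod (grad u z))\<^sup>2 = (cmod (deriv F z))\<^sup>2" if "z \<in> space (lebesgue_on disc)" for z
      using gu[of z] that by (simp add: norm_mult)
    show "integrable (lebesgue_on disc) (\<lambda>z. (cmod (grad u z))\<^sup>2)"
      using int eq by (subst Bochner_Integration.integrable_cong[OF refl eq])
    show "(LINT z|lebesgue_on disc. (cmod (grad u z))\<^sup>2) = (LINT z|lebesgue_on disc. (cmod (deriv F z))\<^sup>2)"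
      by (rule Bochner_Integration.integral_cong[OF refl eq])
  qed
  have LG: "L2_fun (lebesgue_on disc) (grad u)" using gum gint by (simp add: L2_fun_def)
  have "Ck_on 1 disc u" by (rule Ck_on_Im_holomorphic[OF open_ball F(1) u])
  then show H1: "H1_with_gradient disc u (grad u)"
    using Lu LG weak_gradient_grad[OF open_ball] by (simp add: H1_with_gradient_def)
  \<comment> \<open>The double successor makes \<open>\<rho> 0\<close> positive, so every dilation
    is injective.\<close>
  define \<rho> where "\<rho> j = 1 - 1 / real (Suc (Suc j))" for j
  have \<rho>: "0 < \<rho> j" "\<rho> j < 1" for j by (auto simp: \<rho>_def field_simps)
  have \<rho>1: "\<rho> \<longlonglongrightarrow> 1"
  proof -
    have "(\<lambda>j. 1 - 1 / real (Suc (Suc j))) \<longlonglongrightarrow> 1 - 0"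
      by (intro tendsto_diff tendsto_const LIMSEQ_Suc[OF LIMSEQ_Suc[OF lim_1_over_n]])
    then show ?thesis by (simp add: \<rho>_def[abs_def])
  qed
  have \<rho>z: "(\<lambda>j. of_real (\<rho> j) * z) \<longlonglongrightarrow> z" for z :: complex
    using tendsto_mult[OF tendsto_of_real[OF \<rho>1] tendsto_const[of z]] by simp
  have \<rho>in: "of_real (\<rho> j) * z \<in> disc" if "z \<in> cball 0 1" for j and z :: complex
  proof -
    have "\<rho> j * cmod z \<le> \<rho> j * 1" using \<rho>[of j] that by (intro mult_left_mono) auto
    then have "\<rho> j * cmod z < 1" using \<rho>[of j] by linarith
    then show ?thesis using \<rho>[of j] by (simp add: norm_mult)
  qed
  define v where "v j z = Im (F (of_real (\<rho> j) * z))" for j z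
  define U where "U j = {z::complex. of_real (\<rho> j) * z \<in> disc}" for j
  have Uop: "open (U j)" for j
  proof -
    have "U j = (\<lambda>z. of_real (\<rho> j) * z) -` disc" by (auto simp: U_def)
    then show ?thesis by (simp only:) (intro open_vimage open_ball continuous_intros)
  qed
  have Usub: "cball 0 1 \<subseteq> U j" for j using \<rho>in by (auto simp: U_def)
  have Fj: "(\<lambda>z. F (of_real (\<rho> j) * z)) holomorphic_on U j" for j
  proof -
    have "F \<circ> (\<lambda>z. of_real (\<rho> j) * z) holomorphic_on U j"
      by (rule holomorphic_on_compose_gen[OF _ F(1)]) (auto simp: U_def intro!: holomorphic_intros)
    then show ?thesis by (simp add: o_def)
  qed
  have dFj: "deriv (\<lambda>z. F (of_real (\<rho> j) * z)) z = of_real (\<rho> j) * deriv F (of_real (\<rho> j) * z)" if "z \<in> U j" for j z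
  proof -
    have "(F has_field_derivative deriv F (of_real (\<rho> j) * z)) (at (of_real (\<rho> j) * z))"
      using that by (intro holomorphic_derivI[OF F(1)]) (auto simp: U_def)
    then have "((\<lambda>z. F (of_real (\<rho> j) * z)) has_field_derivative deriv F (of_real (\<rho> j) * z) * of_real (\<rho> j)) (at z)"
      by (rule DERIV_chain2) (auto intro!: derivative_eq_intros)
    then show ?thesis by (simp add: DERIV_imp_deriv mult.commute)
  qed
  have smooth: "smooth_on (U j) (v j)" for j
    unfolding smooth_on_def by (intro allI Ck_on_Im_holomorphic[OF Uop Fj]) (simp add: v_def)
  have gv: "grad (v j) z = \<i> * cnj (of_real (\<rho> j) * deriv F (of_real (\<rho> j) * z))" if "z \<in> disc" for j z
  proof -
    have "z \<in> U j" using that Usub[of j] by auto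
    then show ?thesis using grad_Im_holomorphic[OF Uop Fj, where u = "v j"] dFj by (simp add: v_def)
  qed
  have T1: "L2_tendsto (lebesgue_on disc) v u"
  proof (rule L2_tendsto_bounded_convergence[OF fin _ um, where B = B])
    show "v j \<in> borel_measurable (lebesgue_on disc)" for j
    proof (rule continuous_imp_measurable_on_sets_lebesgue[OF _ dl])
      have "continuous_on (U j) (v j)" unfolding v_def
        by (intro continuous_intros holomorphic_on_imp_continuous_on Fj)
      then show "continuous_on disc (v j)" by (rule continuous_on_subset) (use Usub[of j] in auto)
    qed
    show "\<bar>v j x\<bar> \<le> B" if "x \<in> space (lebesgue_on disc)" for j x
    proof -
      have "of_real (\<rho> j) * x \<in> disc" using that by (intro \<rho>in) auto
      then show ?thesis using B by (simp add: v_def)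
    qed
    show "\<bar>u x\<bar> \<le> B" if "x \<in> space (lebesgue_on disc)" for x using that u B by auto
    show "AE x in lebesgue_on disc. (\<lambda>j. v j x) \<longlonglongrightarrow> u x"
    proof (rule AE_I2)
      fix x assume "x \<in> space (lebesgue_on disc)"
      then have x: "x \<in> disc" by simp
      then have "isCont F x" using F(1) by (meson continuous_on_eq_continuous_at holomorphic_on_imp_continuous_on open_ball)
      then have "(\<lambda>j. F (of_real (\<rho> j) * x)) \<longlonglongrightarrow> F x" using \<rho>z by (rule isCont_tendsto_compose)
      then show "(\<lambda>j. v j x) \<longlonglongrightarrow> u x" using u[OF x] unfolding v_def by (auto intro: tendsto_Im)
    qed
  qed
  \<comment> \<open>By conformal invariance the Dirichlet integral of \<open>v j\<close> is that of
    \<open>u\<close> over a smaller disc, hence at most that of \<open>u\<close>. Together with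
    pointwise convergence this forces L2 convergence of the gradients.\<close>
  have T2: "L2_tendsto (lebesgue_on disc) (\<lambda>j. grad (v j)) (grad u)"
  proof -
    define g where "g j z = of_real (\<rho> j) * z" for j and z :: complex
    have gd: "deriv (g j) z = of_real (\<rho> j)" for j z unfolding g_def by simp
    have gh: "g j holomorphic_on disc" for j unfolding g_def by (intro holomorphic_intros)
    have gi: "inj_on (g j) disc" for j using \<rho>[of j] by (auto simp: g_def inj_on_def)
    have gsub: "g j ` disc \<subseteq> disc" for j using \<rho>in by (auto simp: g_def)
    have gop: "open (g j ` disc)" for j by (rule open_mapping_thm3[OF gh open_ball gi])
    have gl: "g j ` disc \<in> sets lebesgue" for j using gop by auto
    let ?f = "\<lambda>z. (cmod (deriv F z))\<^sup>2"
    have i1: "integrable (lebesgue_on (g j ` disc)) ?f" for j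
    proof -
      have "integrable lebesgue (\<lambda>z. indicator disc z *\<^sub>R ?f z)"
        using int dl by (simp add: integrable_restrict_space)
      then have "integrable lebesgue (\<lambda>z. indicator (g j ` disc) z *\<^sub>R (indicator disc z *\<^sub>R ?f z))"
        by (rule integrable_mult_indicator[OF gl])
      moreover have "(\<lambda>z. indicator (g j ` disc) z *\<^sub>R (indicator disc z *\<^sub>R ?f z)) =
          (\<lambda>z. indicator (g j ` disc) z *\<^sub>R ?f z)"
        using gsub[of j] by (auto simp: indicator_def fun_eq_iff)
      ultimately show ?thesis using gl by (simp add: integrable_restrict_space)
    qed
    have eq: "(cmod (grad (v j) z))\<^sup>2 = (cmod (deriv (g j) z))\<^sup>2 * ?f (g j z)" if "z \<in> space (lebesgue_on disc)" for j z
      using gv[of z j] that \<rho>[of j] by (simp add: norm_mult power_mult_distrib gd g_def)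
    have i2: "integrable (lebesgue_on disc) (\<lambda>z. (cmod (grad (v j) z))\<^sup>2)" for j
      using conformal_change_of_variables(1)[OF open_ball gh[of j] gi[of j], of ?f] i1[of j]
      by (subst Bochner_Integration.integrable_cong[OF refl eq]) auto
    have le: "(LINT z|lebesgue_on disc. (cmod (grad (v j) z))\<^sup>2) \<le> (LINT z|lebesgue_on disc. (cmod (grad u z))\<^sup>2)" for j
    proof -
      have "(LINT z|lebesgue_on disc. (cmod (grad (v j) z))\<^sup>2) = (LINT z|lebesgue_on disc. (cmod (deriv (g j) z))\<^sup>2 * ?f (g j z))"
        by (rule Bochner_Integration.integral_cong[OF refl eq])
      also have "\<dots> = (LINT z|lebesgue_on (g j ` disc). ?f z)"
        by (rule conformal_change_of_variables(2)[OF open_ball gh gi, symmetric])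
      also have "\<dots> = (LINT z|lebesgue. indicator (g j ` disc) z *\<^sub>R ?f z)"
        using gl by (simp add: integral_restrict_space)
      also have "\<dots> \<le> (LINT z|lebesgue. indicator disc z *\<^sub>R ?f z)"
      proof (rule integral_mono)
        show "integrable lebesgue (\<lambda>z. indicator (g j ` disc) z *\<^sub>R ?f z)"
          using i1[of j] gl by (simp add: integrable_restrict_space)
        show "integrable lebesgue (\<lambda>z. indicator disc z *\<^sub>R ?f z)"
          using int dl by (simp add: integrable_restrict_space)
      qed (use gsub[of j] in \<open>auto simp: indicator_def\<close>)
      also have "\<dots> = (LINT z|lebesgue_on disc. ?f z)"
        using dl by (simp add: integral_restrict_space)
      finally show ?thesis using gint(2) by simp
    qed
    have Lv: "L2_fun (lebesgue_on disc) (grad (v j))" for j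
      unfolding L2_fun_def
    proof
      show "grad (v j) \<in> borel_measurable (lebesgue_on disc)"
      proof (rule continuous_imp_measurable_on_sets_lebesgue[OF _ dl])
        have "continuous_on disc (\<lambda>z. deriv F (of_real (\<rho> j) * z))"
          by (rule continuous_on_compose2[OF F'c]) (use \<rho>in[of _ j] in \<open>auto intro!: continuous_intros\<close>)
        then have "continuous_on disc (\<lambda>z. \<i> * cnj (of_real (\<rho> j) * deriv F (of_real (\<rho> j) * z)))"
          by (intro continuous_intros)
        then show "continuous_on disc (grad (v j))" by (rule continuous_on_eq) (use gv in auto)
      qed
      show "integrable (lebesgue_on disc) (\<lambda>x. (cmod (grad (v j) x))\<^sup>2)" by (rule i2)
    qed
    show ?thesis
    proof (rule L2_tendsto_of_norm_le[OF Lv LG le])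
      show "AE x in lebesgue_on disc. (\<lambda>j. grad (v j) x) \<longlonglongrightarrow> grad u x"
      proof (rule AE_I2)
        fix x assume "x \<in> space (lebesgue_on disc)"
        then have x: "x \<in> disc" by simp
        then have "isCont (deriv F) x" using F'c by (simp add: continuous_on_eq_continuous_at)
        then have "(\<lambda>j. deriv F (of_real (\<rho> j) * x)) \<longlonglongrightarrow> deriv F x" using \<rho>z by (rule isCont_tendsto_compose)
        then have "(\<lambda>j. \<i> * cnj (of_real (\<rho> j) * deriv F (of_real (\<rho> j) * x))) \<longlonglongrightarrow> \<i> * cnj (of_real 1 * deriv F x)"
          by (intro tendsto_intros \<rho>1)
        then show "(\<lambda>j. grad (v j) x) \<longlonglongrightarrow> grad u x" using gv[OF x] gu[OF x] by simp
      qed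
    qed
  qed
  have T3: "L2_tendsto (lebesgue_on {0..2 * pi}) (\<lambda>j t. v j (cis t)) (\<lambda>t. b (cis t))"
  proof (rule L2_tendsto_bounded_convergence[where B = B])
    show "finite_measure (lebesgue_on {0..2 * pi})" by (intro finite_measure_lebesgue_on) simp
    show "(\<lambda>t. v j (cis t)) \<in> borel_measurable (lebesgue_on {0..2 * pi})" for j
    proof (rule continuous_imp_measurable_on_sets_lebesgue)
      have "continuous_on {0..2 * pi} (\<lambda>t. F (of_real (\<rho> j) * cis t))"
      proof (rule continuous_on_compose2[OF F(2)])
        show "continuous_on {0..2 * pi} (\<lambda>t. of_real (\<rho> j) * cis t)" by (intro continuous_intros)
        show "(\<lambda>t. of_real (\<rho> j) * cis t) ` {0..2 * pi} \<subseteq> cball 0 1"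
          using \<rho>[of j] by (auto simp: norm_mult)
      qed
      then show "continuous_on {0..2 * pi} (\<lambda>t. v j (cis t))" unfolding v_def by (intro continuous_intros)
    qed auto
    show "(\<lambda>t. b (cis t)) \<in> borel_measurable (lebesgue_on {0..2 * pi})"
      unfolding b
    proof (rule continuous_imp_measurable_on_sets_lebesgue)
      have "continuous_on {0..2 * pi} (\<lambda>t. F (cis t))"
        by (rule continuous_on_compose2[OF F(2)]) (auto intro!: continuous_intros)
      then show "continuous_on {0..2 * pi} (\<lambda>t. Im (F (cis t)))" by (intro continuous_intros)
    qed auto
    show "\<bar>v j (cis t)\<bar> \<le> B" for j t
    proof -
      have "of_real (\<rho> j) * cis t \<in> disc" by (intro \<rho>in) auto
      then show ?thesis using B by (simp add: v_def)
    qed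
    show "\<bar>b (cis t)\<bar> \<le> B" for t unfolding b using B[of "cis t"] by simp
    show "AE t in lebesgue_on {0..2 * pi}. (\<lambda>j. v j (cis t)) \<longlonglongrightarrow> b (cis t)"
    proof (rule AE_I2)
      fix t :: real
      have "(\<lambda>j. F (of_real (\<rho> j) * cis t)) \<longlonglongrightarrow> F (cis t)"
      proof (rule continuous_on_tendsto_compose[OF F(2) \<rho>z])
        show "\<forall>\<^sub>F j in sequentially. of_real (\<rho> j) * cis t \<in> cball 0 1"
          using \<rho>in[of "cis t"] by (intro always_eventually) (auto intro: less_imp_le)
      qed auto
      then show "(\<lambda>j. v j (cis t)) \<longlonglongrightarrow> b (cis t)" unfolding v_def b by (rule tendsto_Im)
    qed
  qed
  have "\<exists>W. open W \<and> closure disc \<subseteq> W \<and> smooth_on W (v j)" for j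
    using Uop[of j] Usub[of j] smooth[of j] by auto
  then show "has_trace u b" unfolding has_trace_def using H1 T1 T2 T3 by blast
qed

section \<open>Harmonic functions\<close>

lemma pdiff_linear:
  assumes "u differentiable (at z)"
  shows "pdiff h u z = Re h * pdiff 1 u z + Im h * pdiff \<i> u z"
proof -
  have lin: "linear (\<lambda>h. pdiff h u z)"
    by (rule has_derivative_linear[OF has_derivative_pdiff[OF assms]])
  have "h = Re h *\<^sub>R 1 + Im h *\<^sub>R \<i>" by (simp add: complex_eq_iff)
  then have "pdiff h u z = pdiff (Re h *\<^sub>R 1 + Im h *\<^sub>R \<i>) u z" by simp
  also have "\<dots> = Re h *\<^sub>R pdiff 1 u z + Im h *\<^sub>R pdiff \<i> u z"
    using linear_add[OF lin] linear_scale[OF lin] by metis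
  finally show ?thesis by simp
qed

lemma second_difference_mean_value:
  fixes u :: "complex \<Rightarrow> real"
  assumes "0 < h"
    and u: "\<And>s t. 0 \<le> s \<Longrightarrow> s \<le> h \<Longrightarrow> 0 \<le> t \<Longrightarrow> t \<le> h \<Longrightarrow> u differentiable (at (z + of_real s * v + of_real t * w))"
    and u': "\<And>s t. 0 \<le> s \<Longrightarrow> s \<le> h \<Longrightarrow> 0 \<le> t \<Longrightarrow> t \<le> h \<Longrightarrow> pdiff v u differentiable (at (z + of_real s * v + of_real t * w))"
  shows "\<exists>s t. 0 < s \<and> s < h \<and> 0 < t \<and> t < h \<and>
    u (z + of_real h * v + of_real h * w) - u (z + of_real h * v) - u (z + of_real h * w) + u z =
      h * h * pdiff w (pdiff v u) (z + of_real s * v + of_real t * w)"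
proof -
  define \<phi> where "\<phi> s = u (z + of_real h * w + of_real s * v) - u (z + of_real s * v)" for s
  have d: "(\<phi> has_real_derivative
      pdiff v u (z + of_real h * w + of_real s * v) - pdiff v u (z + of_real s * v)) (at s)" if "0 \<le> s" "s \<le> h" for s
    unfolding \<phi>_def
    using u[of s h] u[of s 0] that \<open>0 < h\<close>
    by (intro DERIV_diff has_real_derivative_line) (simp_all add: add_ac)
  obtain s where s: "0 < s" "s < h" "\<phi> h - \<phi> 0 =
      (h - 0) * (pdiff v u (z + of_real h * w + of_real s * v) - pdiff v u (z + of_real s * v))"
    using MVT2[OF \<open>0 < h\<close>, of \<phi> "\<lambda>s. pdiff v u (z + of_real h * w + of_real s * v) - pdiff v u (z + of_real s * v)"] d
    by blast
  have d2: "((\<lambda>t. pdiff v u (z + of_real s * v + of_real t * w)) has_real_derivative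
      pdiff w (pdiff v u) (z + of_real s * v + of_real t * w)) (at t)" if "0 \<le> t" "t \<le> h" for t
    using u'[of s t] that s by (intro has_real_derivative_line) auto
  obtain t where t: "0 < t" "t < h" "pdiff v u (z + of_real s * v + of_real h * w) - pdiff v u (z + of_real s * v + of_real 0 * w) =
      (h - 0) * pdiff w (pdiff v u) (z + of_real s * v + of_real t * w)"
    using MVT2[OF \<open>0 < h\<close>, of "\<lambda>t. pdiff v u (z + of_real s * v + of_real t * w)"
        "\<lambda>t. pdiff w (pdiff v u) (z + of_real s * v + of_real t * w)"] d2 by blast
  have "u (z + of_real h * v + of_real h * w) - u (z + of_real h * v) - u (z + of_real h * w) + u z = \<phi> h - \<phi> 0"
    by (simp add: \<phi>_def add_ac)
  also have "\<dots> = h * (pdiff v u (z + of_real s * v + of_real h * w) - pdiff v u (z + of_real s * v + of_real 0 * w))"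
    using s(3) by (simp add: add_ac)
  also have "\<dots> = h * h * pdiff w (pdiff v u) (z + of_real s * v + of_real t * w)"
    using t(3) by simp
  finally show ?thesis using s t by blast
qed

text \<open>The mixed second difference over a small square is symmetric in the two directions.
  Applying the mean value theorem in either order expresses it by either mixed derivative at some
  point of the square, and the squares shrink to \<open>z\<close>.\<close>

lemma mixed_pdiff_commute:
  assumes S: "open S" and C2: "Ck_on 2 S u" and z: "z \<in> S"
  shows "pdiff \<i> (pdiff 1 u) z = pdiff 1 (pdiff \<i> u) z"
proof -
  have u: "u differentiable (at w)" and u1: "pdiff 1 u differentiable (at w)" and ui: "pdiff \<i> u differentiable (at w)" if "w \<in> S" for w
    using C2 that by (auto simp: numeral_2_eq_2)
  have c: "continuous_on S (pdiff \<i> (pdiff 1 u))" "continuous_on S (pdiff 1 (pdiff \<i> u))"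
    using C2 by (auto simp: numeral_2_eq_2)
  obtain e where e: "0 < e" "ball z e \<subseteq> S" using S z by (meson open_contains_ball)
  define h where "h n = e / 2 / real (Suc n)" for n
  have h: "0 < h n" "h n \<le> e / 2" for n using e(1) by (auto simp: h_def divide_le_eq)
  have h0: "h \<longlonglongrightarrow> 0"
    unfolding h_def using LIMSEQ_Suc[OF lim_const_over_n, of "e / 2"] by simp
  have dist: "cmod (of_real s + of_real t * \<i>) \<le> \<bar>s\<bar> + \<bar>t\<bar>" for s t
    using norm_triangle_ineq[of "of_real s" "of_real t * \<i>"] by (simp add: norm_mult)
  have inS: "z + of_real s + of_real t * \<i> \<in> S" if "0 \<le> s" "s < e / 2" "0 \<le> t" "t \<le> e / 2" for s t
  proof -
    have "cmod (of_real s + of_real t * \<i>) < e" using dist[of s t] that by linarith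
    moreover have "dist z (z + p) = cmod p" for p by (simp add: dist_norm)
    ultimately have "z + of_real s + of_real t * \<i> \<in> ball z e" by (simp only: mem_ball add.assoc)
    then show ?thesis using e by blast
  qed
  have ex: "\<exists>a b. (0 < Re a \<and> Re a < h n \<and> 0 < Im a \<and> Im a < h n) \<and> (0 < Re b \<and> Re b < h n \<and> 0 < Im b \<and> Im b < h n) \<and>
      pdiff \<i> (pdiff 1 u) (z + a) = pdiff 1 (pdiff \<i> u) (z + b)" if "h n < e / 2" for n
  proof -
    have 1: "\<exists>s t. 0 < s \<and> s < h n \<and> 0 < t \<and> t < h n \<and>
      u (z + of_real (h n) * 1 + of_real (h n) * \<i>) - u (z + of_real (h n) * 1) - u (z + of_real (h n) * \<i>) + u z =
      h n * h n * pdiff \<i> (pdiff 1 u) (z + of_real s * 1 + of_real t * \<i>)"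
      by (rule second_difference_mean_value[OF h(1)]) (use inS u u1 that in \<open>auto\<close>)
    have 2: "\<exists>s t. 0 < s \<and> s < h n \<and> 0 < t \<and> t < h n \<and>
      u (z + of_real (h n) * \<i> + of_real (h n) * 1) - u (z + of_real (h n) * \<i>) - u (z + of_real (h n) * 1) + u z =
      h n * h n * pdiff 1 (pdiff \<i> u) (z + of_real s * \<i> + of_real t * 1)"
    proof (rule second_difference_mean_value[OF h(1)])
      fix s t assume "0 \<le> s" "s \<le> h n" "0 \<le> t" "t \<le> h n"
      then have "z + of_real t + of_real s * \<i> \<in> S" using that by (intro inS) auto
      then have "z + of_real s * \<i> + of_real t * 1 \<in> S" by (simp add: add_ac)
      then show "u differentiable at (z + of_real s * \<i> + of_real t * 1)"
        "pdiff \<i> u differentiable at (z + of_real s * \<i> + of_real t * 1)" using u ui by auto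
    qed
    obtain s t s' t' where st: "0 < s" "s < h n" "0 < t" "t < h n" "0 < s'" "s' < h n" "0 < t'" "t' < h n"
      "h n * h n * pdiff \<i> (pdiff 1 u) (z + of_real s * 1 + of_real t * \<i>) =
       h n * h n * pdiff 1 (pdiff \<i> u) (z + of_real s' * \<i> + of_real t' * 1)"
      using 1 2 by (auto simp: add_ac algebra_simps)
    have E: "z + of_real s * 1 + of_real t * \<i> = z + Complex s t" "z + of_real s' * \<i> + of_real t' * 1 = z + Complex t' s'"
      by (simp_all add: complex_eq_iff)
    then have "pdiff \<i> (pdiff 1 u) (z + Complex s t) = pdiff 1 (pdiff \<i> u) (z + Complex t' s')"
      using st(9)[unfolded E] h(1)[of n] by simp
    then show ?thesis using st by (intro exI[of _ "Complex s t"] exI[of _ "Complex t' s'"]) simp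
  qed
  \<comment> \<open>\<open>h 0\<close> equals \<open>e / 2\<close>, which the strict inequality
    excludes; hence the shift of the sequence by \<open>N\<close>.\<close>
  have "eventually (\<lambda>n. h n < e / 2) sequentially"
    using order_tendstoD(2)[OF h0, of "e / 2"] e(1) by simp
  then obtain N where N: "\<And>n. n \<ge> N \<Longrightarrow> h n < e / 2" by (auto simp: eventually_sequentially)
  have "\<exists>a b. \<forall>n. (0 < Re (a n) \<and> Re (a n) < h (n + N) \<and> 0 < Im (a n) \<and> Im (a n) < h (n + N)) \<and>
      (0 < Re (b n) \<and> Re (b n) < h (n + N) \<and> 0 < Im (b n) \<and> Im (b n) < h (n + N)) \<and>
      pdiff \<i> (pdiff 1 u) (z + a n) = pdiff 1 (pdiff \<i> u) (z + b n)"
    using ex[OF N[OF le_add2]] by metis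
  then obtain a b where ab: "\<And>n. 0 < Re (a n) \<and> Re (a n) < h (n + N) \<and> 0 < Im (a n) \<and> Im (a n) < h (n + N)"
    "\<And>n. 0 < Re (b n) \<and> Re (b n) < h (n + N) \<and> 0 < Im (b n) \<and> Im (b n) < h (n + N)"
    "\<And>n. pdiff \<i> (pdiff 1 u) (z + a n) = pdiff 1 (pdiff \<i> u) (z + b n)" by blast
  have hN: "(\<lambda>n. h (n + N)) \<longlonglongrightarrow> 0" using h0 by (rule LIMSEQ_ignore_initial_segment)
  have conv: "(\<lambda>n. z + c n) \<longlonglongrightarrow> z"
    if "\<And>n. 0 < Re (c n) \<and> Re (c n) < h (n + N) \<and> 0 < Im (c n) \<and> Im (c n) < h (n + N)" for c
  proof -
    have "(\<lambda>n. Re (c n)) \<longlonglongrightarrow> 0"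
      by (rule tendsto_sandwich[OF _ _ tendsto_const hN]) (use that in \<open>auto intro!: always_eventually less_imp_le\<close>)
    moreover have "(\<lambda>n. Im (c n)) \<longlonglongrightarrow> 0"
      by (rule tendsto_sandwich[OF _ _ tendsto_const hN]) (use that in \<open>auto intro!: always_eventually less_imp_le\<close>)
    ultimately have "c \<longlonglongrightarrow> 0" by (simp add: tendsto_complex_iff)
    then show ?thesis using tendsto_add[OF tendsto_const[of z]] by fastforce
  qed
  have i: "isCont (pdiff \<i> (pdiff 1 u)) z" "isCont (pdiff 1 (pdiff \<i> u)) z"
    using c S z by (auto simp: continuous_on_eq_continuous_at)
  have "(\<lambda>n. pdiff \<i> (pdiff 1 u) (z + a n)) \<longlonglongrightarrow> pdiff \<i> (pdiff 1 u) z"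
    by (rule isCont_tendsto_compose[OF i(1) conv[OF ab(1)]])
  moreover have "(\<lambda>n. pdiff \<i> (pdiff 1 u) (z + a n)) \<longlonglongrightarrow> pdiff 1 (pdiff \<i> u) z"
    unfolding ab(3) by (rule isCont_tendsto_compose[OF i(2) conv[OF ab(2)]])
  ultimately show ?thesis by (rule LIMSEQ_unique)
qed

text \<open>If \<open>u\<close> is the real part of \<open>f\<close>, then \<open>f'\<close> is the
  derivative of \<open>u\<close> along \<open>1\<close> minus \<open>\<i>\<close> times that along
  \<open>\<i>\<close>. This combination satisfies the Cauchy-Riemann equations by harmonicity and
  the symmetry of mixed derivatives, and convexity provides a primitive.\<close>

theorem harmonic_on_imp_Re_holomorphic:
  assumes S: "open S" "convex S" and harm: "harmonic_on S u"
  obtains f where "f holomorphic_on S" "\<And>z. z \<in> S \<Longrightarrow> u z = Re (f z)"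
proof -
  have C2: "Ck_on 2 S u" using harm by (simp add: harmonic_on_def)
  have u: "u differentiable (at w)" and u1: "pdiff 1 u differentiable (at w)" and ui: "pdiff \<i> u differentiable (at w)" if "w \<in> S" for w
    using C2 that by (auto simp: numeral_2_eq_2)
  define g where "g z = of_real (pdiff 1 u z) - \<i> * of_real (pdiff \<i> u z)" for z
  have "(g has_field_derivative (of_real (pdiff 1 (pdiff 1 u) z) - \<i> * of_real (pdiff \<i> (pdiff 1 u) z))) (at z)"
    if z: "z \<in> S" for z
  proof -
    have "(g has_derivative (\<lambda>h. of_real (pdiff h (pdiff 1 u) z) - \<i> * of_real (pdiff h (pdiff \<i> u) z))) (at z)"
      unfolding g_def
      by (intro has_derivative_diff has_derivative_of_real has_derivative_mult_right has_derivative_pdiff u1 ui z)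
    moreover have "of_real (pdiff h (pdiff 1 u) z) - \<i> * of_real (pdiff h (pdiff \<i> u) z) =
        (of_real (pdiff 1 (pdiff 1 u) z) - \<i> * of_real (pdiff \<i> (pdiff 1 u) z)) * h" for h
    proof -
      have "pdiff \<i> (pdiff \<i> u) z = - pdiff 1 (pdiff 1 u) z"
        using harm z by (simp add: harmonic_on_def eq_neg_iff_add_eq_0 add.commute)
      moreover have "pdiff 1 (pdiff \<i> u) z = pdiff \<i> (pdiff 1 u) z"
        using mixed_pdiff_commute[OF S(1) C2 z] by simp
      ultimately show ?thesis
        by (simp add: pdiff_linear[OF u1[OF z], of h] pdiff_linear[OF ui[OF z], of h] complex_eq_iff algebra_simps)
    qed
    ultimately show ?thesis by (simp add: has_field_derivative_def)
  qed
  then have "g holomorphic_on S" using S(1) by (auto simp: holomorphic_on_open)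
  then obtain f where f: "\<And>z. z \<in> S \<Longrightarrow> (f has_field_derivative g z) (at z within S)"
    using holomorphic_convex_primitive'[OF S(2,1)] by blast
  have "\<exists>c. \<forall>z\<in>S. u z - Re (f z) = c"
  proof (rule has_derivative_zero_constant[OF S(2)])
    fix z assume z: "z \<in> S"
    have "(f has_derivative (\<lambda>h. g z * h)) (at z within S)" using f[OF z] by (simp add: has_field_derivative_def)
    moreover have "(u has_derivative (\<lambda>h. pdiff h u z)) (at z within S)"
      by (rule has_derivative_at_withinI[OF has_derivative_pdiff[OF u[OF z]]])
    ultimately have "((\<lambda>z. u z - Re (f z)) has_derivative (\<lambda>h. pdiff h u z - Re (g z * h))) (at z within S)"
      by (intro has_derivative_diff has_derivative_Re)
    moreover have "pdiff h u z - Re (g z * h) = 0" for h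
      by (simp add: g_def pdiff_linear[OF u[OF z], of h])
    ultimately show "((\<lambda>z. u z - Re (f z)) has_derivative (\<lambda>h. 0)) (at z within S)" by simp
  qed
  then obtain c where c: "\<And>z. z \<in> S \<Longrightarrow> u z - Re (f z) = c" by blast
  show ?thesis
  proof (rule that)
    have "f holomorphic_on S" using f by (auto simp: holomorphic_on_def field_differentiable_def)
    then show "(\<lambda>z. f z + of_real c) holomorphic_on S" by (intro holomorphic_intros)
    show "u z = Re (f z + of_real c)" if "z \<in> S" for z using c[OF that] by simp
  qed
qed

section \<open>Fourier coefficients on circles\<close>

lemma has_integral_circle_power:
  fixes f :: "complex \<Rightarrow> complex"
  assumes f: "f holomorphic_on disc" and r: "0 < r" "r < 1"
  shows "((\<lambda>t. f (of_real r * cis t) * cis (- (real k * t))) has_integral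
    of_real (r ^ k) * (2 * pi * ((deriv ^^ k) f 0 / fact k))) {0..2 * pi}"
proof -
  have sub: "cball 0 r \<subseteq> disc" using r by auto
  have "((\<lambda>u. f u / (u - 0) ^ (Suc k)) has_contour_integral ((2 * pi * \<i>) / (fact k) * (deriv ^^ k) f 0)) (circlepath 0 r)"
    using r by (intro Cauchy_has_contour_integral_higher_derivative_circlepath holomorphic_on_imp_continuous_on
        holomorphic_on_subset[OF f sub] holomorphic_on_subset[OF f order.trans[OF ball_subset_cball sub]]) auto
  then have "((\<lambda>t. f (of_real r * cis t) / (of_real r * cis t) ^ (Suc k) * r * \<i> * cis t) has_integral
      ((2 * pi * \<i>) / (fact k) * (deriv ^^ k) f 0)) {0..2 * pi}"
    unfolding circlepath_def by (subst (asm) has_contour_integral_part_circlepath_iff) auto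
  then have "((\<lambda>t. (of_real (r ^ k) / \<i>) * (f (of_real r * cis t) / (of_real r * cis t) ^ (Suc k) * r * \<i> * cis t)) has_integral
      (of_real (r ^ k) / \<i>) * ((2 * pi * \<i>) / (fact k) * (deriv ^^ k) f 0)) {0..2 * pi}"
    by (rule has_integral_mult_right)
  moreover have "(of_real (r ^ k) / \<i>) * (f (of_real r * cis t) / (of_real r * cis t) ^ (Suc k) * r * \<i> * cis t) =
      f (of_real r * cis t) * cis (- (real k * t))" for t
  proof -
    have "cis t ^ Suc k = cis t * cis (real k * t)" by (simp add: Complex.DeMoivre)
    moreover have "cis (- (real k * t)) = inverse (cis (real k * t))" by simp
    ultimately show ?thesis using r by (simp add: power_mult_distrib field_simps del: cis_inverse)
  qed
  ultimately show ?thesis by (simp add: field_simps)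
qed

text \<open>Of the two halves of \<open>Re f\<close>, only \<open>f\<close> contributes to the coefficients of positive index.\<close>

definition circle_coeff :: "(complex \<Rightarrow> complex) \<Rightarrow> nat \<Rightarrow> complex" where
  "circle_coeff f k = (if k = 0 then complex_of_real (2 * pi * Re (f 0)) else complex_of_real pi * ((deriv ^^ k) f 0 / fact k))"

text \<open>The conjugate half contributes the conjugate of the integral of
  \<open>cis (k * t) * f\<close>. That integrand is a multiple of \<open>z ^ k * f z\<close>, whose
  mean over the circle is its value at the centre, \<open>0\<close> for
  \<open>k > 0\<close>.\<close>

lemma has_integral_circle_Re:
  fixes f :: "complex \<Rightarrow> complex"
  assumes f: "f holomorphic_on disc" and r: "0 < r" "r < 1"
  shows "((\<lambda>t. of_real (Re (f (of_real r * cis t))) * cis (- (real k * t))) has_integral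
    of_real (r ^ k) * circle_coeff f k) {0..2 * pi}"
proof -
  define C where "C = (if k = 0 then 2 * pi * cnj (f 0) else 0)"
  have cn: "((\<lambda>t. cnj (f (of_real r * cis t)) * cis (- (real k * t))) has_integral C) {0..2 * pi}"
  proof (cases "k = 0")
    case True
    then show ?thesis
      using has_integral_cnj[THEN iffD2, OF has_integral_circle_power[OF f r, of 0]] by (simp add: C_def o_def)
  next
    case False
    have "(\<lambda>z. z ^ k * f z) holomorphic_on disc" using f by (intro holomorphic_intros)
    from has_integral_circle_power[OF this r, of 0]
    have "((\<lambda>t. (of_real r * cis t) ^ k * f (of_real r * cis t)) has_integral 0) {0..2 * pi}"
      using False by (simp add: zero_power)
    then have "((\<lambda>t. (1 / of_real (r ^ k)) * ((of_real r * cis t) ^ k * f (of_real r * cis t))) has_integral (1 / of_real (r ^ k)) * 0) {0..2 * pi}"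
      by (rule has_integral_mult_right)
    moreover have "(1 / of_real (r ^ k)) * ((of_real r * cis t) ^ k * f (of_real r * cis t)) = cis (real k * t) * f (of_real r * cis t)" for t
      using r by (simp add: power_mult_distrib Complex.DeMoivre)
    ultimately have "((\<lambda>t. cis (real k * t) * f (of_real r * cis t)) has_integral 0) {0..2 * pi}" by simp
    then have "((\<lambda>t. cnj (cis (real k * t) * f (of_real r * cis t))) has_integral cnj 0) {0..2 * pi}"
      using has_integral_cnj[of "\<lambda>t. cis (real k * t) * f (of_real r * cis t)" 0 "{0..2 * pi}"] by (simp add: o_def)
    then show ?thesis using False by (simp add: C_def cis_cnj mult.commute)
  qed
  have "((\<lambda>t. (f (of_real r * cis t) * cis (- (real k * t)) + cnj (f (of_real r * cis t)) * cis (- (real k * t))) * (1 / 2)) has_integral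
      (of_real (r ^ k) * (2 * pi * ((deriv ^^ k) f 0 / fact k)) + C) * (1 / 2)) {0..2 * pi}"
    by (intro has_integral_mult_left has_integral_add has_integral_circle_power[OF f r] cn)
  moreover have "(f (of_real r * cis t) * cis (- (real k * t)) + cnj (f (of_real r * cis t)) * cis (- (real k * t))) * (1 / 2) =
      of_real (Re (f (of_real r * cis t))) * cis (- (real k * t))" for t
  proof -
    have "f (of_real r * cis t) + cnj (f (of_real r * cis t)) = of_real (2 * Re (f (of_real r * cis t)))"
      by (rule complex_add_cnj)
    then show ?thesis by (simp add: distrib_right[symmetric])
  qed
  moreover have "(of_real (r ^ k) * (2 * pi * ((deriv ^^ k) f 0 / fact k)) + C) * (1 / 2) = of_real (r ^ k) * circle_coeff f k"
  proof (cases "k = 0")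
    case True
    then show ?thesis using complex_add_cnj[of "f 0"] by (simp add: C_def circle_coeff_def complex_eq_iff)
  qed (simp add: C_def circle_coeff_def)
  ultimately show ?thesis by simp
qed

text \<open>Coefficients of positive index determine the power series up to its constant term, and
  the coefficient of index \<open>0\<close> records only the real part of that term. Hence the
  conclusion is about real parts.\<close>

lemma Re_eq_if_circle_coeff_eq:
  fixes f g :: "complex \<Rightarrow> complex"
  assumes f: "f holomorphic_on disc" and g: "g holomorphic_on disc"
    and eq: "\<And>k. circle_coeff f k = circle_coeff g k" and z: "z \<in> disc"
  shows "Re (f z) = Re (g z)"
proof -
  have "(\<lambda>n. (deriv ^^ n) f 0 / fact n * (z - 0) ^ n - (deriv ^^ n) g 0 / fact n * (z - 0) ^ n) sums (f z - g z)"
    by (intro sums_diff holomorphic_power_series[OF f z] holomorphic_power_series[OF g z])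
  moreover have "(deriv ^^ n) f 0 / fact n * (z - 0) ^ n - (deriv ^^ n) g 0 / fact n * (z - 0) ^ n = 0" if "n \<noteq> 0" for n
  proof -
    have "(deriv ^^ n) f 0 / fact n = (deriv ^^ n) g 0 / fact n"
      using eq[of n] that by (simp add: circle_coeff_def)
    then show ?thesis by simp
  qed
  then have "(\<lambda>n. (deriv ^^ n) f 0 / fact n * (z - 0) ^ n - (deriv ^^ n) g 0 / fact n * (z - 0) ^ n) sums
      (\<Sum>n\<in>{0}. (deriv ^^ n) f 0 / fact n * (z - 0) ^ n - (deriv ^^ n) g 0 / fact n * (z - 0) ^ n)"
    by (intro sums_finite) auto
  ultimately have "f z - g z = f 0 - g 0" by (auto dest: sums_unique2)
  moreover have "Re (f 0) = Re (g 0)" using eq[of 0] by (simp add: circle_coeff_def flip: of_real_mult)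
  ultimately show ?thesis by (metis diff_eq_diff_eq minus_complex.sel(1))
qed

section \<open>Uniqueness of the harmonic extension\<close>

lemma integral_open_interval_lborel:
  fixes f :: "real \<Rightarrow> real"
  assumes "continuous_on {a..b} f"
  shows "(LINT x|lborel. indicator {a<..<b} x * f x) = integral {a..b} f"
proof -
  have "set_integrable lborel {a..b} f" using assms by (rule borel_integrable_atLeastAtMost')
  from set_borel_integral_eq_integral(2)[OF this]
  show ?thesis by (simp add: integral_open_eq_closed set_lebesgue_integral_def)
qed

lemma polar_sector_subset_disc: "0 \<le> a \<Longrightarrow> polar_sector a 1 c \<subseteq> disc"
  by (auto simp: polar_sector_def norm_mult)

lemma integral_annulus:
  fixes g :: "complex \<Rightarrow> real"
  assumes r0: "0 \<le> r0" and cont: "continuous_on (disc - {0}) g"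
    and int: "integrable (lebesgue_on (polar_sector r0 1 (2 * pi))) g"
  shows "integrable lborel (\<lambda>r. indicator {r0<..<1} r * (r * integral {0..2 * pi} (\<lambda>t. g (of_real r * cis t))))"
    and "(LINT z|lebesgue_on (polar_sector r0 1 (2 * pi)). g z) =
    (LINT r|lborel. indicator {r0<..<1} r * (r * integral {0..2 * pi} (\<lambda>t. g (of_real r * cis t))))"
proof -
  have sub: "polar_sector r0 1 (2 * pi) \<subseteq> disc - {0}"
    using r0 by (auto simp: polar_sector_def norm_mult)
  have c: "continuous_on (polar_sector r0 1 (2 * pi)) g"
    by (rule continuous_on_subset[OF cont sub])
  have eq: "indicator {r0<..<1} r * (r * (LINT t|lborel. indicator {0<..<2 * pi} t * g (of_real r * cis t))) =
      indicator {r0<..<1} r * (r * integral {0..2 * pi} (\<lambda>t. g (of_real r * cis t)))" for r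
  proof (cases "r \<in> {r0<..<1}")
    case True
    have "continuous_on {0..2 * pi} (\<lambda>t. g (of_real r * cis t))"
      by (rule continuous_on_compose2[OF cont]) (use True r0 in \<open>auto intro!: continuous_intros simp: norm_mult\<close>)
    then show ?thesis by (simp add: integral_open_interval_lborel)
  qed simp
  show "integrable lborel (\<lambda>r. indicator {r0<..<1} r * (r * integral {0..2 * pi} (\<lambda>t. g (of_real r * cis t))))"
    and "(LINT z|lebesgue_on (polar_sector r0 1 (2 * pi)). g z) =
    (LINT r|lborel. indicator {r0<..<1} r * (r * integral {0..2 * pi} (\<lambda>t. g (of_real r * cis t))))"
    using integral_polar_sector(2,3)[OF r0 order_refl c int] unfolding eq .
qed

lemma integral_lebesgue_on_subset:
  fixes g :: "complex \<Rightarrow> real"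
  assumes S: "S \<in> sets lebesgue" and T: "T \<in> sets lebesgue" "T \<subseteq> S" and int: "integrable (lebesgue_on S) g"
  shows "integrable (lebesgue_on T) g" "(LINT z|lebesgue_on T. g z) = (LINT z|lebesgue_on S. g z * indicator T z)"
proof -
  have i: "integrable lebesgue (\<lambda>z. indicator S z *\<^sub>R g z)"
    using int S by (simp add: integrable_restrict_space)
  have "integrable lebesgue (\<lambda>z. indicator T z *\<^sub>R (indicator S z *\<^sub>R g z))"
    by (rule integrable_mult_indicator[OF T(1) i])
  moreover have eq: "(\<lambda>z. indicator T z *\<^sub>R (indicator S z *\<^sub>R g z)) = (\<lambda>z. indicator T z *\<^sub>R g z)"
    using T(2) by (auto simp: indicator_def fun_eq_iff)
  ultimately have "integrable lebesgue (\<lambda>z. indicator T z *\<^sub>R g z)" by (simp only:)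
  then show "integrable (lebesgue_on T) g" using T(1) by (simp add: integrable_restrict_space)
  have "(LINT z|lebesgue_on T. g z) = (LINT z|lebesgue. indicator T z *\<^sub>R (indicator S z *\<^sub>R g z))"
    unfolding eq using T(1) by (simp add: integral_restrict_space)
  also have "\<dots> = (LINT z|lebesgue_on S. g z * indicator T z)"
    using S by (simp add: integral_restrict_space mult_ac)
  finally show "(LINT z|lebesgue_on T. g z) = (LINT z|lebesgue_on S. g z * indicator T z)" .
qed

text \<open>Used in place of the Cauchy-Schwarz inequality, with \<epsilon> chosen according to the
  sizes of the two integrals.\<close>

lemma abs_mult_le_weighted_squares:
  assumes "0 < \<epsilon>"
  shows "\<bar>a * b :: real\<bar> \<le> a\<^sup>2 / (4 * \<epsilon>) + \<epsilon> * b\<^sup>2"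
proof -
  have "0 \<le> (\<bar>a\<bar> - 2 * \<epsilon> * \<bar>b\<bar>)\<^sup>2" by simp
  then have "4 * \<epsilon> * \<bar>a * b\<bar> \<le> a\<^sup>2 + 4 * \<epsilon>\<^sup>2 * b\<^sup>2"
    by (simp add: power2_diff power_mult_distrib abs_mult mult_ac)
  then have "4 * \<epsilon> * \<bar>a * b\<bar> \<le> 4 * \<epsilon> * (a\<^sup>2 / (4 * \<epsilon>) + \<epsilon> * b\<^sup>2)"
    using assms by (simp add: distrib_left power2_eq_square)
  then show ?thesis using assms by (metis mult_le_cancel_left_pos mult_pos_pos zero_less_numeral)
qed

lemma L2_tendsto_integral_mult:
  fixes f w :: "'a \<Rightarrow> real"
  assumes T: "L2_tendsto M s f" and w: "L2_fun M w"
  shows "(\<lambda>j. LINT x|M. s j x * w x) \<longlonglongrightarrow> (LINT x|M. f x * w x)"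
proof (rule LIMSEQ_I)
  fix e :: real assume e: "0 < e"
  have L: "L2_fun M (s j)" "L2_fun M f" for j using T by (auto simp: L2_tendsto_def)
  define W where "W = (LINT x|M. (w x)\<^sup>2) + 1"
  have W0: "0 \<le> (LINT x|M. (w x)\<^sup>2)" by (intro integral_nonneg_AE) auto
  then have W: "0 < W" unfolding W_def by linarith
  define \<epsilon> where "\<epsilon> = e / (2 * W)"
  have \<epsilon>: "0 < \<epsilon>" "\<epsilon> * W = e / 2" using e W by (auto simp: \<epsilon>_def)
  have "(\<lambda>j. LINT x|M. (norm (s j x - f x))\<^sup>2) \<longlonglongrightarrow> 0" using T by (simp add: L2_tendsto_def)
  from LIMSEQ_D[OF this, of "4 * \<epsilon> * (e / 2)"] obtain N where
    N: "\<And>j. j \<ge> N \<Longrightarrow> norm ((LINT x|M. (norm (s j x - f x))\<^sup>2) - 0) < 4 * \<epsilon> * (e / 2)"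
    using e \<epsilon> by auto
  have "norm ((LINT x|M. s j x * w x) - (LINT x|M. f x * w x)) < e" if "j \<ge> N" for j
  proof -
    have Ld: "L2_fun M (\<lambda>x. s j x - f x)" by (intro L2_fun_diff L)
    have i: "integrable M (\<lambda>x. s j x * w x)" "integrable M (\<lambda>x. f x * w x)" "integrable M (\<lambda>x. (s j x - f x) * w x)"
      by (intro L2_fun_mult_integrable L w Ld)+
    have "(LINT x|M. s j x * w x) - (LINT x|M. f x * w x) = (LINT x|M. (s j x - f x) * w x)"
      using i by (simp add: left_diff_distrib)
    also have "\<bar>\<dots>\<bar> \<le> (LINT x|M. \<bar>(s j x - f x) * w x\<bar>)" by (rule integral_abs_bound)
    also have "\<dots> \<le> (LINT x|M. (s j x - f x)\<^sup>2 / (4 * \<epsilon>) + \<epsilon> * (w x)\<^sup>2)"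
      using i(3) Ld w abs_mult_le_weighted_squares[OF \<epsilon>(1)]
      by (intro integral_mono) (auto simp: L2_fun_real simp del: abs_mult)
    also have "\<dots> = (LINT x|M. (s j x - f x)\<^sup>2) / (4 * \<epsilon>) + \<epsilon> * (LINT x|M. (w x)\<^sup>2)"
      using Ld w by (simp add: L2_fun_real)
    also have "\<dots> < e / 2 + e / 2"
    proof (rule add_less_le_mono)
      show "(LINT x|M. (s j x - f x)\<^sup>2) / (4 * \<epsilon>) < e / 2"
        using N[OF that] \<epsilon> by (simp add: divide_less_eq mult_ac)
      have "\<epsilon> * (LINT x|M. (w x)\<^sup>2) \<le> \<epsilon> * W" using \<epsilon>(1) by (intro mult_left_mono) (auto simp: W_def)
      then show "\<epsilon> * (LINT x|M. (w x)\<^sup>2) \<le> e / 2" using \<epsilon>(2) by simp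
    qed
    finally show ?thesis by simp
  qed
  then show "\<exists>N. \<forall>j\<ge>N. norm ((LINT x|M. s j x * w x) - (LINT x|M. f x * w x)) < e" by blast
qed

text \<open>Differentiating the circle integral in the radius gives a derivative bounded by the
  integral of the gradient norm over that circle. Integrating over the radius yields an area
  integral, which an L2 bound on the gradient controls.\<close>

lemma circle_integral_radial_difference:
  fixes v :: "complex \<Rightarrow> real" and \<kappa> :: "real \<Rightarrow> real"
  assumes U: "open U" "cball 0 1 \<subseteq> U" and C1: "Ck_on 1 U v"
    and \<kappa>: "continuous_on UNIV \<kappa>" "\<And>t. \<bar>\<kappa> t\<bar> \<le> 1" and r0: "1 / 2 \<le> r0" "r0 \<le> r" "r \<le> 1"
    and int: "integrable (lebesgue_on (polar_sector r0 1 (2 * pi))) (\<lambda>z. norm (grad v z))"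
  shows "\<bar>integral {0..2 * pi} (\<lambda>t. v (of_real r * cis t) * \<kappa> t) - integral {0..2 * pi} (\<lambda>t. v (cis t) * \<kappa> t)\<bar>
     \<le> 2 * (LINT z|lebesgue_on (polar_sector r0 1 (2 * pi)). norm (grad v z))"
proof -
  have vd: "v differentiable (at z)" if "z \<in> U" for z using C1 that by simp
  have c: "continuous_on U (pdiff 1 v)" "continuous_on U (pdiff \<i> v)" using C1 by auto
  have vc: "continuous_on U v" using vd U(1)
    by (intro continuous_at_imp_continuous_on ballI differentiable_imp_continuous_within) auto
  have inU: "of_real s * cis t \<in> U" if "s \<in> {r0..1}" for s t
    using that r0 U(2) by (auto simp: subset_iff norm_mult)
  have pc: "continuous_on ({r0..1} \<times> {0..2 * pi}) (\<lambda>(s, t). h (of_real s * cis t))" if "continuous_on U h"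
    for h :: "complex \<Rightarrow> real"
    unfolding split_def
    by (rule continuous_on_compose2[OF that]) (use inU in \<open>auto intro!: continuous_intros\<close>)
  define D where "D s t = pdiff (cis t) v (of_real s * cis t)" for s t
  have D_eq: "D s t = grad v (of_real s * cis t) \<bullet> cis t" if "s \<in> {r0..1}" for s t
    using pdiff_linear[OF vd[OF inU[OF that]], of "cis t" t] by (simp add: D_def grad_def inner_complex_def)
  have D_le: "\<bar>D s t\<bar> \<le> norm (grad v (of_real s * cis t))" if "s \<in> {r0..1}" for s t
    unfolding D_eq[OF that] using Cauchy_Schwarz_ineq2[of "grad v (of_real s * cis t)" "cis t"] by simp
  have "continuous_on ({r0..1} \<times> {0..2 * pi}) (\<lambda>p. pdiff 1 v (of_real (fst p) * cis (snd p)) * cos (snd p) +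
      pdiff \<i> v (of_real (fst p) * cis (snd p)) * sin (snd p))"
    using pc[OF c(1)] pc[OF c(2)] unfolding split_def by (intro continuous_intros)
  then have Dc: "continuous_on ({r0..1} \<times> {0..2 * pi}) (\<lambda>(s, t). D s t)"
  proof (rule continuous_on_eq)
    fix p assume "p \<in> {r0..1} \<times> {0..2 * pi}"
    then show "pdiff 1 v (of_real (fst p) * cis (snd p)) * cos (snd p) +
      pdiff \<i> v (of_real (fst p) * cis (snd p)) * sin (snd p) = (case p of (s, t) \<Rightarrow> D s t)"
      using D_eq[of "fst p" "snd p"] by (auto simp: split_def grad_def inner_complex_def)
  qed
  have \<kappa>c: "continuous_on X \<kappa>" for X using \<kappa>(1) by (rule continuous_on_subset) simp
  have \<kappa>p: "continuous_on ({r0..1} \<times> {0..2 * pi}) (\<lambda>(s, t). \<kappa> t)"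
    unfolding split_def by (rule continuous_on_compose2[OF \<kappa>(1)]) (auto intro!: continuous_intros)
  define N where "N s = integral {0..2 * pi} (\<lambda>t. norm (grad v (of_real s * cis t)))" for s
  have gc: "continuous_on U (\<lambda>z. norm (grad v z))"
    unfolding grad_def complex_norm by (intro continuous_on_real_sqrt continuous_on_add continuous_on_power c)
  have slice: "continuous_on {0..2 * pi} (\<lambda>t. h (of_real s * cis t))" if "continuous_on U h" "s \<in> {r0..1}"
    for h :: "complex \<Rightarrow> real" and s
    by (rule continuous_on_compose2[OF that(1)]) (use inU that(2) in \<open>auto intro!: continuous_intros\<close>)
  have Nc: "continuous_on {r0..1} N"
    unfolding N_def
    using integral_continuous_on_param[of "{r0..1}" 0 "2 * pi" "\<lambda>s t. norm (grad v (of_real s * cis t))"] pc[OF gc]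
    by simp
  define I where "I s = integral {0..2 * pi} (\<lambda>t. v (of_real s * cis t) * \<kappa> t)" for s
  define I' where "I' s = integral {0..2 * pi} (\<lambda>t. D s t * \<kappa> t)" for s
  have der: "(I has_vector_derivative I' s) (at s within {r0..1})" if s: "s \<in> {r0..1}" for s
  proof -
    have "((\<lambda>s. integral (cbox 0 (2 * pi)) (\<lambda>t. v (of_real s * cis t) * \<kappa> t)) has_vector_derivative
        integral (cbox 0 (2 * pi)) (\<lambda>t. D s t * \<kappa> t)) (at s within {r0..1})"
    proof (rule leibniz_rule_vector_derivative[where U = "{r0..1}"])
      fix s t assume "s \<in> {r0..1}" "t \<in> cbox 0 (2 * pi)"
      then have "v differentiable (at (0 + of_real s * cis t))" using vd[OF inU] by simp
      from has_real_derivative_line[OF this]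
      have "((\<lambda>s. v (of_real s * cis t)) has_real_derivative D s t) (at s)" by (simp add: D_def)
      then have "((\<lambda>s. v (of_real s * cis t) * \<kappa> t) has_real_derivative D s t * \<kappa> t) (at s within {r0..1})"
        by (rule DERIV_cmult_right[OF DERIV_subset]) simp
      then show "((\<lambda>s. v (of_real s * cis t) * \<kappa> t) has_vector_derivative D s t * \<kappa> t) (at s within {r0..1})"
        by (simp add: has_real_derivative_iff_has_vector_derivative)
    next
      fix s assume "s \<in> {r0..1}"
      then show "(\<lambda>t. v (of_real s * cis t) * \<kappa> t) integrable_on cbox 0 (2 * pi)"
        using slice[OF vc] \<kappa>c by (intro integrable_continuous continuous_on_mult) auto
    next
      show "continuous_on ({r0..1} \<times> cbox 0 (2 * pi)) (\<lambda>(s, t). D s t * \<kappa> t)"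
        using continuous_on_mult[OF Dc \<kappa>p] by (simp add: split_def)
    qed (use s in auto)
    then show ?thesis by (simp add: I_def[abs_def] I'_def)
  qed
  have I'_le: "norm (I' s) \<le> N s" if "s \<in> {r0..1}" for s
    unfolding I'_def N_def
  proof (rule integral_norm_bound_integral)
    have "continuous_on {0..2 * pi} (Pair s)"
      using continuous_on_Pair[OF continuous_on_const[of _ s] continuous_on_id, of "{0..2 * pi}"] by simp
    moreover have "Pair s ` {0..2 * pi} \<subseteq> {r0..1} \<times> {0..2 * pi}" using that by auto
    ultimately have "continuous_on {0..2 * pi} (\<lambda>t. D s t)"
      using continuous_on_compose2[OF Dc, of "{0..2 * pi}" "Pair s"] by simp
    then show "(\<lambda>t. D s t * \<kappa> t) integrable_on {0..2 * pi}"
      by (intro integrable_continuous_real continuous_on_mult \<kappa>c)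
    show "(\<lambda>t. norm (grad v (of_real s * cis t))) integrable_on {0..2 * pi}"
      by (intro integrable_continuous_real slice[OF gc that])
    show "norm (D s t * \<kappa> t) \<le> norm (grad v (of_real s * cis t))" for t
      using mult_mono[OF D_le[OF that, of t] \<kappa>(2)[of t]] by (simp add: abs_mult)
  qed
  have fi: "(I' has_integral (I 1 - I r)) {r..1}"
  proof (rule fundamental_theorem_of_calculus)
    fix s assume "s \<in> {r..1}"
    then have "s \<in> {r0..1}" "{r..1} \<subseteq> {r0..1}" using r0 by auto
    then show "(I has_vector_derivative I' s) (at s within {r..1})"
      using has_vector_derivative_within_subset[OF der] by blast
  qed (use r0 in auto)
  have Ni: "N integrable_on {r..1}" "N integrable_on {r0..1}"
    using r0 by (auto intro!: integrable_continuous_real continuous_on_subset[OF Nc])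
  have N0: "0 \<le> N s" for s
    unfolding N_def
    by (cases "(\<lambda>t. norm (grad v (of_real s * cis t))) integrable_on {0..2 * pi}")
      (auto intro: integral_nonneg simp: not_integrable_integral)
  have "\<bar>I 1 - I r\<bar> \<le> integral {r..1} N"
    using integral_norm_bound_integral[of I' "{r..1}" N] fi Ni I'_le r0
    by (auto simp: has_integral_iff)
  also have "\<dots> \<le> integral {r0..1} N"
    using Ni r0 N0 by (intro integral_subset_le) auto
  also have "\<dots> = (LINT s|lborel. indicator {r0<..<1} s * N s)"
    by (rule integral_open_interval_lborel[OF Nc, symmetric])
  \<comment> \<open>\<open>r0 \<ge> 1 / 2\<close> gives \<open>1 \<le> 2 * s\<close> on the annulus,
    so the area factor \<open>s\<close> is inserted at the cost of the constant
    \<open>2\<close>.\<close>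
  also have "\<dots> \<le> (LINT s|lborel. 2 * (indicator {r0<..<1} s * (s * N s)))"
  proof (rule integral_mono)
    have sd: "continuous_on (disc - {0}) (\<lambda>z. norm (grad v z))"
      by (rule continuous_on_subset[OF gc]) (use U(2) ball_subset_cball[of "0::complex" 1] in blast)
    show "integrable lborel (\<lambda>s. 2 * (indicator {r0<..<1} s * (s * N s)))"
      using integral_annulus(1)[OF _ sd int] r0 by (simp add: N_def)
    have "integrable lborel (\<lambda>s. indicator {r0..1} s *\<^sub>R N s)"
      using borel_integrable_atLeastAtMost'[OF Nc] by (simp add: set_integrable_def)
    then have "integrable lborel (\<lambda>s. indicator {r0<..<1} s *\<^sub>R (indicator {r0..1} s *\<^sub>R N s))"
      by (rule integrable_mult_indicator[rotated]) simp
    moreover have "(\<lambda>s. indicator {r0<..<1} s *\<^sub>R (indicator {r0..1} s *\<^sub>R N s)) = (\<lambda>s. indicator {r0<..<1} s * N s)"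
      by (auto simp: indicator_def fun_eq_iff)
    ultimately show "integrable lborel (\<lambda>s. indicator {r0<..<1} s * N s)" by simp
    show "indicator {r0<..<1} s * N s \<le> 2 * (indicator {r0<..<1} s * (s * N s))" for s
      using N0[of s] r0 mult_right_mono[of 1 "2 * s" "N s"] by (auto simp: indicator_def)
  qed
  also have "\<dots> = 2 * (LINT z|lebesgue_on (polar_sector r0 1 (2 * pi)). norm (grad v z))"
  proof -
    have sd: "continuous_on (disc - {0}) (\<lambda>z. norm (grad v z))"
      by (rule continuous_on_subset[OF gc]) (use U(2) ball_subset_cball[of "0::complex" 1] in blast)
    show ?thesis
      using integral_annulus(2)[OF _ sd int] r0 by (simp add: N_def)
  qed
  finally show ?thesis by (simp add: I_def abs_minus_commute)
qed

lemma integral_power_annulus_bounds: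
  fixes r0 :: real
  assumes "0 \<le> r0" "r0 \<le> 1"
  shows "(1 - r0) * r0 ^ k \<le> (LINT r|lborel. indicator {r0<..<1} r * r ^ k)"
    and "(LINT r|lborel. indicator {r0<..<1} r * r ^ k) \<le> 1 - r0"
proof -
  have eq: "(LINT r|lborel. indicator {r0<..<1} r * r ^ k) = integral {r0..1} (\<lambda>r. r ^ k)"
    by (intro integral_open_interval_lborel continuous_intros)
  have i: "(\<lambda>r::real. r ^ k) integrable_on {r0..1}"
    by (intro integrable_continuous_real continuous_intros)
  have "integral {r0..1} (\<lambda>r. r0 ^ k) \<le> integral {r0..1} (\<lambda>r. r ^ k)"
    using assms i by (intro integral_le power_mono) auto
  then show "(1 - r0) * r0 ^ k \<le> (LINT r|lborel. indicator {r0<..<1} r * r ^ k)"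
    using assms by (simp add: eq)
  have "integral {r0..1} (\<lambda>r. r ^ k) \<le> integral {r0..1} (\<lambda>r. 1)"
    using assms i by (intro integral_le power_le_one) auto
  then show "(LINT r|lborel. indicator {r0<..<1} r * r ^ k) \<le> 1 - r0"
    using assms by (simp add: eq)
qed

lemma measure_annulus_le:
  assumes "0 \<le> r0" "r0 \<le> 1"
  shows "(LINT z|lebesgue_on (polar_sector r0 1 (2 * pi)). 1) \<le> 2 * pi * (1 - r0)"
proof -
  have "open (polar_sector r0 1 (2 * pi))"
    by (rule integral_polar_sector(1)[OF assms(1) order_refl continuous_on_const])
  moreover have "bounded (polar_sector r0 1 (2 * pi))"
    by (rule bounded_subset[OF bounded_ball polar_sector_subset_disc[OF assms(1)]])
  ultimately interpret finite_measure "lebesgue_on (polar_sector r0 1 (2 * pi))"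
    by (rule finite_measure_lebesgue_on_bounded)
  have "(LINT z|lebesgue_on (polar_sector r0 1 (2 * pi)). (1::real)) =
      (LINT r|lborel. indicator {r0<..<1} r * (r * integral {0..2 * pi} (\<lambda>t. 1)))"
    using assms by (intro integral_annulus continuous_intros) auto
  also have "\<dots> = (LINT r|lborel. 2 * pi * (indicator {r0<..<1} r * r ^ 1))"
    by (simp add: mult_ac)
  also have "\<dots> = 2 * pi * (LINT r|lborel. indicator {r0<..<1} r * r ^ 1)"
    by (rule integral_mult_right_zero)
  also have "\<dots> \<le> 2 * pi * (1 - r0)"
    using assms by (intro mult_left_mono integral_power_annulus_bounds) auto
  finally show ?thesis .
qed

text \<open>For the smooth approximants, the integrals against \<open>\<kappa>\<close> over the circles of radius \<open>1\<close> and
  \<open>r \<ge> r\<^sub>0\<close> differ by at most twice the integral of the norm of the gradient over the annulus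
  \<open>r\<^sub>0 < |z| < 1\<close>, which tends to \<open>0\<close> as \<open>r\<^sub>0 \<rightarrow> 1\<close>, uniformly in the approximant. Averaged over \<open>r\<close>
  this survives the limit in \<open>L\<^sup>2\<close>. The weight \<open>W\<close> cancels the factor \<open>r\<close> of the area element.\<close>

lemma trace_circle_integral:
  fixes \<kappa> :: "real \<Rightarrow> real" and W :: "complex \<Rightarrow> real"
  assumes u: "continuous_on disc u" and trace: "has_trace u h"
    and \<kappa>: "continuous_on UNIV \<kappa>" "\<And>t. \<bar>\<kappa> t\<bar> \<le> 1"
    and W: "continuous_on (- {0}) W" "\<And>r t. 0 < r \<Longrightarrow> W (of_real r * cis t) = \<kappa> t / r"
    and I: "\<And>r. 0 < r \<Longrightarrow> r < 1 \<Longrightarrow> integral {0..2 * pi} (\<lambda>t. u (of_real r * cis t) * \<kappa> t) = r ^ k * A"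
  shows "(LINT t|lebesgue_on {0..2 * pi}. h (cis t) * \<kappa> t) = A"
proof -
  define H where "H = (LINT t|lebesgue_on {0..2 * pi}. h (cis t) * \<kappa> t)"
  obtain G v where uG: "H1_with_gradient disc u G"
    and v: "\<And>j. \<exists>U. open U \<and> closure disc \<subseteq> U \<and> smooth_on U (v j)"
    and T1: "L2_tendsto (lebesgue_on disc) v u"
    and T2: "L2_tendsto (lebesgue_on disc) (\<lambda>j. grad (v j)) G"
    and T3: "L2_tendsto (lebesgue_on {0..2 * pi}) (\<lambda>j t. v j (cis t)) (\<lambda>t. h (cis t))"
    using trace unfolding has_trace_def by blast
  have fin: "finite_measure (lebesgue_on disc)" by (rule finite_measure_lebesgue_on_bounded) auto
  have fin2: "finite_measure (lebesgue_on {0..2 * pi})" by (intro finite_measure_lebesgue_on) simp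
  have dl: "disc \<in> sets lebesgue" by auto
  have LG: "L2_fun (lebesgue_on disc) G" "L2_fun (lebesgue_on disc) (grad (v j))"
    "L2_fun (lebesgue_on disc) u" "L2_fun (lebesgue_on disc) (v j)" for j
    using T1 T2 by (auto simp: L2_tendsto_def)
  \<comment> \<open>Bounds the Dirichlet integral of every late approximant: twice that of
    \<open>G\<close> plus twice a squared distance, which is eventually below
    \<open>1\<close>.\<close>
  define M where "M = 2 * (LINT z|lebesgue_on disc. (norm (G z))\<^sup>2) + 2"
  have M0: "0 \<le> M"
  proof -
    have "0 \<le> (LINT z|lebesgue_on disc. (norm (G z))\<^sup>2)" by (intro integral_nonneg_AE) auto
    then show ?thesis unfolding M_def by linarith
  qed
  have Mj: "eventually (\<lambda>j. (LINT z|lebesgue_on disc. (norm (grad (v j) z))\<^sup>2) \<le> M) sequentially"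
  proof -
    have "(\<lambda>j. LINT z|lebesgue_on disc. (norm (grad (v j) z - G z))\<^sup>2) \<longlonglongrightarrow> 0"
      using T2 by (simp add: L2_tendsto_def)
    then have "eventually (\<lambda>j. (LINT z|lebesgue_on disc. (norm (grad (v j) z - G z))\<^sup>2) < 1) sequentially"
      by (rule order_tendstoD) simp
    then show ?thesis
    proof eventually_elim
      case (elim j)
      have Ld: "L2_fun (lebesgue_on disc) (\<lambda>z. grad (v j) z - G z)" by (intro L2_fun_diff LG)
      have "(LINT z|lebesgue_on disc. (norm (grad (v j) z))\<^sup>2) \<le>
          (LINT z|lebesgue_on disc. 2 * (norm (grad (v j) z - G z))\<^sup>2 + 2 * (norm (G z))\<^sup>2)"
      proof (rule integral_mono)
        show "(norm (grad (v j) z))\<^sup>2 \<le> 2 * (norm (grad (v j) z - G z))\<^sup>2 + 2 * (norm (G z))\<^sup>2" for z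
          using norm_add_square_le[of "grad (v j) z - G z" "G z"] by simp
      qed (use Ld LG in \<open>auto simp: L2_fun_def\<close>)
      also have "\<dots> = 2 * (LINT z|lebesgue_on disc. (norm (grad (v j) z - G z))\<^sup>2) + 2 * (LINT z|lebesgue_on disc. (norm (G z))\<^sup>2)"
        using Ld LG by (simp add: L2_fun_def)
      finally show ?case using elim by (simp add: M_def)
    qed
  qed
  have \<kappa>L2: "L2_fun (lebesgue_on {0..2 * pi}) \<kappa>"
    by (rule L2_fun_bounded[OF fin2 continuous_imp_measurable_on_sets_lebesgue[OF continuous_on_subset[OF \<kappa>(1)]], where B = 1])
      (use \<kappa>(2) in auto)
  have Hlim: "(\<lambda>j. LINT t|lebesgue_on {0..2 * pi}. v j (cis t) * \<kappa> t) \<longlonglongrightarrow> H"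
    unfolding H_def by (rule L2_tendsto_integral_mult[OF T3 \<kappa>L2])
  \<comment> \<open>The free \<epsilon> balances the area of the annulus against the Dirichlet
    integral. It stays fixed while \<open>r0\<close> tends to \<open>1\<close>, after which only
    \<open>2 * \<epsilon> * M\<close> remains, and then it tends to \<open>0\<close>.\<close>
  have main: "\<bar>A - H\<bar> \<le> \<bar>A\<bar> * (1 - r0 ^ k) + 2 * (2 * pi * (1 - r0) / (4 * \<epsilon>) + \<epsilon> * M)"
    if r0: "1 / 2 \<le> r0" "r0 < 1" and \<epsilon>: "0 < \<epsilon>" for r0 \<epsilon>
  proof -
    let ?P = "polar_sector r0 1 (2 * pi)"
    have r00: "0 \<le> r0" using r0 by simp
    have Pop: "open ?P" by (rule integral_polar_sector(1)[OF r00 order_refl continuous_on_const])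
    have Psub: "?P \<subseteq> disc" by (rule polar_sector_subset_disc[OF r00])
    have Pl: "?P \<in> sets lebesgue" using Pop by auto
    interpret P: finite_measure "lebesgue_on ?P"
      by (rule finite_measure_lebesgue_on_bounded[OF Pop bounded_subset[OF bounded_ball Psub]])
    have Wb: "\<bar>W z\<bar> \<le> 2" if zP: "z \<in> ?P" for z
    proof -
      obtain r t where z: "z = of_real r * cis t" "r0 < r" "r < 1" using zP by (auto simp: polar_sector_def)
      then have "\<bar>W z\<bar> = \<bar>\<kappa> t\<bar> / r" using W(2)[of r t] r0 by simp
      also have "\<dots> \<le> 1 / (1 / 2)" using \<kappa>(2)[of t] z r0 by (intro frac_le) auto
      finally show ?thesis by simp
    qed
    have WP: "continuous_on ?P W"
      by (rule continuous_on_subset[OF W(1)]) (use r0 in \<open>auto simp: polar_sector_def\<close>)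
    have wL2: "L2_fun (lebesgue_on disc) (\<lambda>z. W z * indicator ?P z)"
    proof (rule L2_fun_bounded[OF fin, where B = 2])
      have "W \<in> borel_measurable (lebesgue_on ?P)"
        by (rule continuous_imp_measurable_on_sets_lebesgue[OF WP Pl])
      then have "(\<lambda>z. indicator ?P z *\<^sub>R W z) \<in> borel_measurable lebesgue"
        using Pl by (simp add: borel_measurable_restrict_space_iff)
      then show "(\<lambda>z. W z * indicator ?P z) \<in> borel_measurable (lebesgue_on disc)"
        by (simp add: mult.commute measurable_restrict_space1)
      show "norm (W z * indicator ?P z) \<le> 2" for z using Wb[of z] by (auto simp: indicator_def)
    qed
    have Jlim: "(\<lambda>j. LINT z|lebesgue_on ?P. v j z * W z) \<longlonglongrightarrow> (LINT z|lebesgue_on ?P. u z * W z)"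
    proof -
      have i: "(LINT z|lebesgue_on ?P. f z * W z) = (LINT z|lebesgue_on disc. f z * (W z * indicator ?P z))"
        for f :: "complex \<Rightarrow> real"
      proof -
        have eq: "(\<lambda>z. indicator disc z *\<^sub>R (f z * (W z * indicator ?P z))) = (\<lambda>z. indicator ?P z *\<^sub>R (f z * W z))"
          using Psub by (auto simp: indicator_def fun_eq_iff)
        have "(LINT z|lebesgue_on ?P. f z * W z) = (LINT z|lebesgue. indicator ?P z *\<^sub>R (f z * W z))"
          using Pl by (simp add: integral_restrict_space)
        also have "\<dots> = (LINT z|lebesgue. indicator disc z *\<^sub>R (f z * (W z * indicator ?P z)))"
          by (simp only: eq)
        also have "\<dots> = (LINT z|lebesgue_on disc. f z * (W z * indicator ?P z))"
          using dl by (simp add: integral_restrict_space)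
        finally show ?thesis .
      qed
      show ?thesis unfolding i by (rule L2_tendsto_integral_mult[OF T1 wL2])
    qed
    have annulus: "(LINT z|lebesgue_on ?P. f z * W z) =
        (LINT r|lborel. indicator {r0<..<1} r * integral {0..2 * pi} (\<lambda>t. f (of_real r * cis t) * \<kappa> t))"
      and annulus_int: "integrable lborel (\<lambda>r. indicator {r0<..<1} r * integral {0..2 * pi} (\<lambda>t. f (of_real r * cis t) * \<kappa> t))"
      if f: "continuous_on disc f" "L2_fun (lebesgue_on disc) f" for f
    proof -
      have c: "continuous_on (disc - {0}) (\<lambda>z. f z * W z)"
        by (intro continuous_on_mult continuous_on_subset[OF f(1)] continuous_on_subset[OF W(1)]) auto
      have "integrable (lebesgue_on disc) (\<lambda>z. f z * (W z * indicator ?P z))"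
        by (rule L2_fun_mult_integrable[OF f(2) wL2])
      then have "integrable lebesgue (\<lambda>z. indicator disc z *\<^sub>R (f z * (W z * indicator ?P z)))"
        using dl by (simp add: integrable_restrict_space)
      moreover have "(\<lambda>z. indicator disc z *\<^sub>R (f z * (W z * indicator ?P z))) = (\<lambda>z. indicator ?P z *\<^sub>R (f z * W z))"
        using Psub by (auto simp: indicator_def fun_eq_iff)
      ultimately have int: "integrable (lebesgue_on ?P) (\<lambda>z. f z * W z)"
        using Pl by (simp add: integrable_restrict_space)
      have eq: "indicator {r0<..<1} r * (r * integral {0..2 * pi} (\<lambda>t. f (of_real r * cis t) * W (of_real r * cis t))) =
          indicator {r0<..<1} r * integral {0..2 * pi} (\<lambda>t. f (of_real r * cis t) * \<kappa> t)" for r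
      proof (cases "r \<in> {r0<..<1}")
        case True
        then have "0 < r" using r0 by simp
        have "r * integral {0..2 * pi} (\<lambda>t. f (of_real r * cis t) * W (of_real r * cis t)) =
            integral {0..2 * pi} (\<lambda>t. r * (f (of_real r * cis t) * W (of_real r * cis t)))"
          by (rule integral_mult_right[symmetric])
        also have "\<dots> = integral {0..2 * pi} (\<lambda>t. f (of_real r * cis t) * \<kappa> t)"
          using \<open>0 < r\<close> by (simp add: W(2))
        finally show ?thesis by simp
      qed simp
      show "(LINT z|lebesgue_on ?P. f z * W z) =
        (LINT r|lborel. indicator {r0<..<1} r * integral {0..2 * pi} (\<lambda>t. f (of_real r * cis t) * \<kappa> t))"
        using integral_annulus(2)[OF r00 c int] unfolding eq .
      show "integrable lborel (\<lambda>r. indicator {r0<..<1} r * integral {0..2 * pi} (\<lambda>t. f (of_real r * cis t) * \<kappa> t))"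
        using integral_annulus(1)[OF r00 c int] unfolding eq .
    qed
    define R where "R = (LINT r|lborel. indicator {r0<..<1} r * r ^ k)"
    have Ju: "(LINT z|lebesgue_on ?P. u z * W z) = A * R"
    proof -
      have "indicator {r0<..<1} r * integral {0..2 * pi} (\<lambda>t. u (of_real r * cis t) * \<kappa> t) =
          A * (indicator {r0<..<1} r * r ^ k)" for r
        using I[of r] r0 by (cases "r \<in> {r0<..<1}") (auto simp: mult_ac)
      then show ?thesis unfolding annulus[OF u LG(3)] R_def by (simp only: integral_mult_right_zero)
    qed
    have ind: "(LINT r|lborel. indicator {r0<..<1} r * c) = (1 - r0) * c" for c :: real
      using r0 by (simp add: measure_lborel_Ioo)
    have ind_int: "integrable lborel (\<lambda>r. indicator {r0<..<1} r * c)" for c :: real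
      by (simp add: integrable_real_indicator emeasure_lborel_Ioo r0 less_imp_le)
    define E where "E j = 2 * (LINT z|lebesgue_on ?P. norm (grad (v j) z))" for j
    have E_le: "E j \<le> 2 * (2 * pi * (1 - r0) / (4 * \<epsilon>) + \<epsilon> * (LINT z|lebesgue_on disc. (norm (grad (v j) z))\<^sup>2))"
      and Ei: "integrable (lebesgue_on ?P) (\<lambda>z. norm (grad (v j) z))" for j
    proof -
      have sqi: "integrable (lebesgue_on disc) (\<lambda>z. (norm (grad (v j) z))\<^sup>2)"
        using LG(2)[of j] by (simp add: L2_fun_def)
      note sq = integral_lebesgue_on_subset[OF dl Pl Psub sqi]
      have ni: "integrable (lebesgue_on disc) (\<lambda>z. norm (grad (v j) z))"
      proof (rule L2_fun_integrable[OF fin])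
        show "L2_fun (lebesgue_on disc) (\<lambda>z. norm (grad (v j) z))"
          using LG(2)[of j] by (auto simp: L2_fun_def)
      qed
      show i: "integrable (lebesgue_on ?P) (\<lambda>z. norm (grad (v j) z))"
        by (rule integral_lebesgue_on_subset(1)[OF dl Pl Psub ni])
      have "(LINT z|lebesgue_on ?P. norm (grad (v j) z)) \<le>
          (LINT z|lebesgue_on ?P. 1 / (4 * \<epsilon>) + \<epsilon> * (norm (grad (v j) z))\<^sup>2)"
      proof (rule integral_mono[OF i])
        show "integrable (lebesgue_on ?P) (\<lambda>z. 1 / (4 * \<epsilon>) + \<epsilon> * (norm (grad (v j) z))\<^sup>2)"
          using sq(1) by simp
        show "norm (grad (v j) z) \<le> 1 / (4 * \<epsilon>) + \<epsilon> * (norm (grad (v j) z))\<^sup>2" for z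
          using abs_mult_le_weighted_squares[OF \<epsilon>, of 1 "norm (grad (v j) z)"] by simp
      qed
      also have "\<dots> = (LINT z|lebesgue_on ?P. 1) / (4 * \<epsilon>) + \<epsilon> * (LINT z|lebesgue_on ?P. (norm (grad (v j) z))\<^sup>2)"
      proof -
        have "(LINT z|lebesgue_on ?P. 1 / (4 * \<epsilon>) + \<epsilon> * (norm (grad (v j) z))\<^sup>2) =
            (LINT z|lebesgue_on ?P. 1 / (4 * \<epsilon>)) + (LINT z|lebesgue_on ?P. \<epsilon> * (norm (grad (v j) z))\<^sup>2)"
          by (rule Bochner_Integration.integral_add) (use sq(1) in auto)
        then show ?thesis by simp
      qed
      also have "\<dots> \<le> 2 * pi * (1 - r0) / (4 * \<epsilon>) + \<epsilon> * (LINT z|lebesgue_on disc. (norm (grad (v j) z))\<^sup>2)"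
      proof (intro add_mono divide_right_mono mult_left_mono)
        show "(LINT z|lebesgue_on ?P. 1) \<le> 2 * pi * (1 - r0)" using r0 by (intro measure_annulus_le) auto
        show "(LINT z|lebesgue_on ?P. (norm (grad (v j) z))\<^sup>2) \<le> (LINT z|lebesgue_on disc. (norm (grad (v j) z))\<^sup>2)"
          unfolding sq(2)
        proof (rule integral_mono[OF _ sqi])
          have "integrable (lebesgue_on disc) (\<lambda>z. indicator ?P z *\<^sub>R (norm (grad (v j) z))\<^sup>2)"
            using Pl Psub by (intro integrable_mult_indicator sqi) (auto simp: sets_restrict_space_iff)
          then show "integrable (lebesgue_on disc) (\<lambda>z. (norm (grad (v j) z))\<^sup>2 * indicator ?P z)"
            by (simp add: mult.commute)
        qed (auto simp: indicator_def)
      qed (use \<epsilon> in auto)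
      finally show "E j \<le> 2 * (2 * pi * (1 - r0) / (4 * \<epsilon>) + \<epsilon> * (LINT z|lebesgue_on disc. (norm (grad (v j) z))\<^sup>2))"
        by (simp add: E_def)
    qed
    \<comment> \<open>For each \<open>r\<close> the circle integral is within \<open>E j\<close> of
      the boundary integral. Integrating over \<open>r\<close> gives the factor
      \<open>1 - r0\<close> and produces an area integral, to which the L2 convergence of the
      \<open>v j\<close> applies.\<close>
    have step: "\<bar>(LINT z|lebesgue_on ?P. v j z * W z) - (1 - r0) * (LINT t|lebesgue_on {0..2 * pi}. v j (cis t) * \<kappa> t)\<bar> \<le> (1 - r0) * E j" for j
    proof -
      obtain U where U: "open U" "cball 0 1 \<subseteq> U" "smooth_on U (v j)" using v[of j] by auto
      have C1: "Ck_on 1 U (v j)" using U(3) by (simp add: smooth_on_def)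
      have vc: "continuous_on U (v j)" using C1 U(1)
        by (intro continuous_at_imp_continuous_on ballI differentiable_imp_continuous_within) auto
      have vd: "continuous_on disc (v j)" by (rule continuous_on_subset[OF vc]) (use U(2) ball_subset_cball[of "0::complex" 1] in blast)
      define c where "c = integral {0..2 * pi} (\<lambda>t. v j (cis t) * \<kappa> t)"
      have c_eq: "(LINT t|lebesgue_on {0..2 * pi}. v j (cis t) * \<kappa> t) = c"
      proof -
        have "continuous_on {0..2 * pi} (\<lambda>t. v j (cis t))"
          by (rule continuous_on_compose2[OF vc]) (use U(2) in \<open>auto intro!: continuous_intros\<close>)
        then have "continuous_on {0..2 * pi} (\<lambda>t. v j (cis t) * \<kappa> t)"
          by (intro continuous_on_mult continuous_on_subset[OF \<kappa>(1)]) auto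
        then have "(\<lambda>t. v j (cis t) * \<kappa> t) absolutely_integrable_on {0..2 * pi}"
          by (rule absolutely_integrable_continuous_real)
        then show ?thesis
          using integrable_lebesgue_on_iff[of "{0..2 * pi}" "\<lambda>t. v j (cis t) * \<kappa> t" c] by (simp add: c_def)
      qed
      define F where "F r = integral {0..2 * pi} (\<lambda>t. v j (of_real r * cis t) * \<kappa> t)" for r
      have Fi: "integrable lborel (\<lambda>r. indicator {r0<..<1} r * F r)"
        unfolding F_def by (rule annulus_int[OF vd LG(4)])
      have "(LINT z|lebesgue_on ?P. v j z * W z) - (1 - r0) * c =
          (LINT r|lborel. indicator {r0<..<1} r * F r) - (LINT r|lborel. indicator {r0<..<1} r * c)"
        unfolding ind annulus[OF vd LG(4)] F_def ..
      also have "\<dots> = (LINT r|lborel. indicator {r0<..<1} r * F r - indicator {r0<..<1} r * c)"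
        by (rule Bochner_Integration.integral_diff[OF Fi ind_int, symmetric])
      also have "\<bar>\<dots>\<bar> \<le> (LINT r|lborel. \<bar>indicator {r0<..<1} r * F r - indicator {r0<..<1} r * c\<bar>)"
        by (rule integral_abs_bound)
      also have "\<dots> \<le> (LINT r|lborel. indicator {r0<..<1} r * E j)"
      proof (rule integral_mono[OF integrable_abs[OF Bochner_Integration.integrable_diff[OF Fi ind_int]] ind_int])
        fix r :: real
        show "\<bar>indicator {r0<..<1} r * F r - indicator {r0<..<1} r * c\<bar> \<le> indicator {r0<..<1} r * E j"
        proof (cases "r \<in> {r0<..<1}")
          case True
          then have "\<bar>F r - c\<bar> \<le> E j"
            unfolding F_def c_def E_def
            by (intro circle_integral_radial_difference[OF U(1,2) C1 \<kappa>] Ei) (use r0 in auto)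
          then show ?thesis using True by simp
        qed simp
      qed
      also have "\<dots> = (1 - r0) * E j" by (rule ind)
      finally show ?thesis unfolding c_eq .
    qed
    define B where "B = 2 * (2 * pi * (1 - r0) / (4 * \<epsilon>) + \<epsilon> * M)"
    have "\<bar>A * R - (1 - r0) * H\<bar> \<le> (1 - r0) * B"
    proof (rule tendsto_upperbound)
      show "(\<lambda>j. \<bar>(LINT z|lebesgue_on ?P. v j z * W z) - (1 - r0) * (LINT t|lebesgue_on {0..2 * pi}. v j (cis t) * \<kappa> t)\<bar>)
          \<longlonglongrightarrow> \<bar>A * R - (1 - r0) * H\<bar>"
        unfolding Ju[symmetric] by (intro tendsto_intros Jlim Hlim)
      show "\<forall>\<^sub>F j in sequentially. \<bar>(LINT z|lebesgue_on ?P. v j z * W z) - (1 - r0) * (LINT t|lebesgue_on {0..2 * pi}. v j (cis t) * \<kappa> t)\<bar>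
          \<le> (1 - r0) * B"
        using Mj
      proof eventually_elim
        case (elim j)
        have "E j \<le> B"
          unfolding B_def
          by (rule order.trans[OF E_le[of j] mult_left_mono[OF add_left_mono[OF mult_left_mono[OF elim less_imp_le[OF \<epsilon>]]]]]) simp
        then have "(1 - r0) * E j \<le> (1 - r0) * B" using r0 by (intro mult_left_mono) auto
        then show ?case using step[of j] by linarith
      qed
    qed simp
    \<comment> \<open>The circle integrals of \<open>u\<close> are \<open>r ^ k * A\<close> with
      \<open>r ^ k\<close> between \<open>r0 ^ k\<close> and \<open>1\<close>, so replacing their
      average by \<open>A\<close> costs at most \<open>\<bar>A\<bar> * (1 - r0 ^ k)\<close>.\<close>
    moreover have "\<bar>A * (1 - r0) - A * R\<bar> \<le> (1 - r0) * (\<bar>A\<bar> * (1 - r0 ^ k))"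
    proof -
      have "(1 - r0) * r0 ^ k \<le> R" "R \<le> 1 - r0"
        unfolding R_def using r0 by (intro integral_power_annulus_bounds; simp)+
      then have "\<bar>(1 - r0) - R\<bar> \<le> (1 - r0) * (1 - r0 ^ k)" by (simp add: algebra_simps)
      then have "\<bar>A\<bar> * \<bar>(1 - r0) - R\<bar> \<le> \<bar>A\<bar> * ((1 - r0) * (1 - r0 ^ k))" by (rule mult_left_mono) simp
      then show ?thesis by (simp add: abs_mult[symmetric] right_diff_distrib mult_ac)
    qed
    ultimately have "\<bar>A * (1 - r0) - (1 - r0) * H\<bar> \<le> (1 - r0) * (\<bar>A\<bar> * (1 - r0 ^ k)) + (1 - r0) * B"
      by linarith
    then have "(1 - r0) * \<bar>A - H\<bar> \<le> (1 - r0) * (\<bar>A\<bar> * (1 - r0 ^ k) + B)"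
    proof -
      have "\<bar>A * (1 - r0) - (1 - r0) * H\<bar> = \<bar>(1 - r0) * (A - H)\<bar>" by (simp add: algebra_simps)
      also have "\<dots> = (1 - r0) * \<bar>A - H\<bar>" using r0 by (simp add: abs_mult)
      finally show ?thesis
        using \<open>\<bar>A * (1 - r0) - (1 - r0) * H\<bar> \<le> (1 - r0) * (\<bar>A\<bar> * (1 - r0 ^ k)) + (1 - r0) * B\<close>
        by (simp add: distrib_left)
    qed
    then show ?thesis using r0 unfolding B_def by (simp add: mult_le_cancel_left_pos)
  qed
  have bound: "\<bar>A - H\<bar> \<le> \<epsilon> * (2 * M)" if "0 < \<epsilon>" for \<epsilon>
  proof (rule tendsto_lowerbound[where F = "at_left 1"])
    show "((\<lambda>r0. \<bar>A\<bar> * (1 - r0 ^ k) + 2 * (2 * pi * (1 - r0) / (4 * \<epsilon>) + \<epsilon> * M)) \<longlongrightarrow> \<epsilon> * (2 * M)) (at_left 1)"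
      using that by (auto intro!: tendsto_eq_intros)
    have "eventually (\<lambda>r0::real. r0 \<in> {1 / 2<..<1}) (at_left 1)"
      by (rule eventually_at_left_real) simp
    then show "eventually (\<lambda>r0. \<bar>A - H\<bar> \<le> \<bar>A\<bar> * (1 - r0 ^ k) + 2 * (2 * pi * (1 - r0) / (4 * \<epsilon>) + \<epsilon> * M)) (at_left 1)"
      by eventually_elim (use main that in auto)
  qed simp
  have "\<bar>A - H\<bar> \<le> 0"
  proof (rule field_le_epsilon)
    fix e :: real assume e: "0 < e"
    have "\<bar>A - H\<bar> \<le> e / (2 * M + 1) * (2 * M)" using e M0 by (intro bound) auto
    also have "\<dots> \<le> e" using e M0 by (simp add: field_simps)
    finally show "\<bar>A - H\<bar> \<le> 0 + e" by simp
  qed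
  then show ?thesis unfolding H_def by simp
qed

text \<open>Both functions are real parts of holomorphic functions whose circle coefficients are
  integrals of the common trace, so the coefficients agree.\<close>

theorem harmonic_trace_unique:
  assumes u: "harmonic_on disc u" "has_trace u h" and w: "harmonic_on disc w" "has_trace w h" and z: "z \<in> disc"
  shows "u z = w z"
proof -
  have circle: "\<exists>f. f holomorphic_on disc \<and> (\<forall>z\<in>disc. u z = Re (f z)) \<and>
      (\<forall>k. \<forall>c. cmod c = 1 \<longrightarrow> Re (c * circle_coeff f k) =
        (LINT t|lebesgue_on {0..2 * pi}. h (cis t) * Re (c * cis (- (real k * t)))))"
    if u: "harmonic_on disc u" "has_trace u h" for u
  proof -
    obtain f where f: "f holomorphic_on disc" "\<And>z. z \<in> disc \<Longrightarrow> u z = Re (f z)"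
      using harmonic_on_imp_Re_holomorphic[OF open_ball convex_ball u(1)] by blast
    have uc: "continuous_on disc u"
    proof -
      have "continuous_on disc (\<lambda>z. Re (f z))" using f(1) by (intro continuous_intros holomorphic_on_imp_continuous_on)
      then show ?thesis by (rule continuous_on_eq) (use f(2) in auto)
    qed
    \<comment> \<open>The kernel has to be real, so a complex coefficient is read off from its
      products with \<open>c = 1\<close> and \<open>c = \<i>\<close>. The weight \<open>W\<close> is
      the kernel divided by \<open>r\<close>, written in terms of \<open>z\<close> so that its
      continuity off the origin is evident.\<close>
    have "(LINT t|lebesgue_on {0..2 * pi}. h (cis t) * Re (c * cis (- (real k * t)))) = Re (c * circle_coeff f k)"
      if c: "cmod c = 1" for k c
    proof (rule trace_circle_integral[OF uc u(2), where k = k and W = "\<lambda>z. Re (c * cnj z ^ k) / cmod z ^ Suc k"])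
      show "continuous_on UNIV (\<lambda>t. Re (c * cis (- (real k * t))))" by (intro continuous_intros)
      show "\<bar>Re (c * cis (- (real k * t)))\<bar> \<le> 1" for t
        using abs_Re_le_cmod[of "c * cis (- (real k * t))"] c by (simp add: norm_mult)
      show "continuous_on (- {0}) (\<lambda>z. Re (c * cnj z ^ k) / cmod z ^ Suc k)"
        by (intro continuous_intros) auto
      show "Re (c * cnj (of_real r * cis t) ^ k) / cmod (of_real r * cis t) ^ Suc k = Re (c * cis (- (real k * t))) / r"
        if "0 < r" for r t
      proof -
        have "c * cnj (of_real r * cis t) ^ k = of_real (r ^ k) * (c * cis (- (real k * t)))"
          by (simp add: power_mult_distrib cis_cnj Complex.DeMoivre)
        then have "Re (c * cnj (of_real r * cis t) ^ k) = r ^ k * Re (c * cis (- (real k * t)))"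
          by (metis Re_complex_of_real Im_complex_of_real mult_zero_left diff_zero times_complex.sel(1))
        then show ?thesis using that by (simp add: norm_mult)
      qed
      show "integral {0..2 * pi} (\<lambda>t. u (of_real r * cis t) * Re (c * cis (- (real k * t)))) = r ^ k * Re (c * circle_coeff f k)"
        if r: "0 < r" "r < 1" for r
      proof -
        have "((\<lambda>t. c * (of_real (Re (f (of_real r * cis t))) * cis (- (real k * t)))) has_integral
            c * (of_real (r ^ k) * circle_coeff f k)) {0..2 * pi}"
          by (intro has_integral_mult_right has_integral_circle_Re[OF f(1) r])
        then have "((\<lambda>t. Re (c * (of_real (Re (f (of_real r * cis t))) * cis (- (real k * t))))) has_integral
            Re (c * (of_real (r ^ k) * circle_coeff f k))) {0..2 * pi}"
          by (rule has_integral_linear[OF _ bounded_linear_Re, unfolded o_def])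
        moreover have "Re (c * (of_real (Re (f (of_real r * cis t))) * cis (- (real k * t)))) =
            u (of_real r * cis t) * Re (c * cis (- (real k * t)))" for t
        proof -
          have "of_real r * cis t \<in> disc" using r by (simp add: norm_mult)
          then show ?thesis using f(2) by (simp add: algebra_simps)
        qed
        moreover have "Re (c * (of_real (r ^ k) * circle_coeff f k)) = r ^ k * Re (c * circle_coeff f k)"
          by (simp add: algebra_simps del: of_real_power)
        ultimately show ?thesis by (simp add: integral_unique)
      qed
    qed
    note circ = this
    show ?thesis
      by (intro exI[of _ f] conjI ballI allI impI f circ[symmetric])
  qed
  obtain f where f: "f holomorphic_on disc" "\<And>z. z \<in> disc \<Longrightarrow> u z = Re (f z)"
    "\<And>k c. cmod c = 1 \<Longrightarrow> Re (c * circle_coeff f k) =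
        (LINT t|lebesgue_on {0..2 * pi}. h (cis t) * Re (c * cis (- (real k * t))))"
    using circle[OF u] by blast
  obtain g where g: "g holomorphic_on disc" "\<And>z. z \<in> disc \<Longrightarrow> w z = Re (g z)"
    "\<And>k c. cmod c = 1 \<Longrightarrow> Re (c * circle_coeff g k) =
        (LINT t|lebesgue_on {0..2 * pi}. h (cis t) * Re (c * cis (- (real k * t))))"
    using circle[OF w] by blast
  have "circle_coeff f k = circle_coeff g k" for k
  proof -
    have "Re (c * circle_coeff f k) = Re (c * circle_coeff g k)" if "cmod c = 1" for c
      using f(3)[OF that] g(3)[OF that] by metis
    from this[of 1] this[of \<i>] show ?thesis by (simp add: complex_eq_iff)
  qed
  then have "Re (f z) = Re (g z)" by (rule Re_eq_if_circle_coeff_eq[OF f(1) g(1) _ z])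
  then show ?thesis using f(2) g(2) z by simp
qed

section \<open>Reconstruction\<close>

lemma prod_nat_differences:
  assumes "l \<le> n"
  shows "(\<Prod>j\<in>{0..n} - {l}. real l - real j) = (- 1) ^ (n - l) * (fact l * fact (n - l))"
  using assms
proof (induction n rule: dec_induct)
  case base
  have "{0..l} - {l} = {0..<l}" by auto
  moreover have "(\<Prod>j\<in>{0..<l}. real l - real j) = (\<Prod>j\<in>{0..<l}. real (l - j))"
    by (intro prod.cong) auto
  ultimately show ?case by (simp add: fact_prod_rev)
next
  case (step n)
  have "{0..Suc n} - {l} = insert (Suc n) ({0..n} - {l})" using step by auto
  then have "(\<Prod>j\<in>{0..Suc n} - {l}. real l - real j) =
      (real l - real (Suc n)) * ((- 1) ^ (n - l) * (fact l * fact (n - l)))"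
    using step by simp
  also have "real l - real (Suc n) = - real (Suc (n - l))" using step by simp
  also have "- real (Suc (n - l)) * ((- 1) ^ (n - l) * (fact l * fact (n - l))) =
      (- 1) ^ Suc (n - l) * (fact l * fact (Suc (n - l)))" by (simp add: algebra_simps)
  finally show ?case using step by (simp add: Suc_diff_le)
qed

text \<open>Splitting the denominator of \<open>c_coeff\<close> at \<open>l\<close> gives the signs
  and factorials of \<open>p_coeff\<close>, whose weights are thereby recognised as the coefficients
  of \<open>L_poly\<close>.\<close>

lemma c_coeff_eq:
  assumes "l \<le> n"
  shows "c_coeff k l n = (- 1) ^ (n - l) * ((\<Prod>j<n. real (1 + k + l + j)) / (fact l * fact (n - l)))"
proof -
  have "(\<Prod>j<n. real (l + j + k + 1)) = (\<Prod>j<n. real (1 + k + l + j))"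
    by (intro prod.cong) auto
  moreover have "x / ((- 1) ^ m * y) = (- 1) ^ m * (x / y)" for x y :: real and m
    by (cases "even m") auto
  ultimately show ?thesis using assms by (simp only: c_coeff_def prod_nat_differences)
qed

lemma inner_grad_eq: "(\<i> * cnj a) \<bullet> (\<i> * cnj b) = Re (a * cnj b)"
  by (simp add: inner_complex_def)

lemma Re_power_cnj_power: "Re (z ^ l * cnj (z ^ (l + k))) = cmod z ^ (2 * l) * Re (z ^ k)"
proof -
  have "z ^ l * cnj (z ^ (l + k)) = (z * cnj z) ^ l * cnj (z ^ k)"
    by (simp add: power_add power_mult_distrib)
  also have "z * cnj z = of_real ((cmod z)\<^sup>2)" by (rule complex_norm_square[symmetric])
  also have "of_real ((cmod z)\<^sup>2) ^ l * cnj (z ^ k) = of_real (cmod z ^ (2 * l)) * cnj (z ^ k)"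
    by (simp add: power_mult)
  finally have "Re (z ^ l * cnj (z ^ (l + k))) = Re (of_real (cmod z ^ (2 * l)) * cnj (z ^ k))" by (rule arg_cong)
  also have "\<dots> = cmod z ^ (2 * l) * Re (z ^ k)" by (simp del: of_real_power complex_cnj_power)
  finally show ?thesis .
qed

text \<open>The derivative vanishes exactly at the corners \<open>1\<close> and \<open>-1\<close>,
  where theta opens the right angles of the half disc to straight ones.\<close>

lemma theta_has_derivative:
  assumes "theta_den z \<noteq> 0"
  shows "(theta_map has_field_derivative 8 * \<i> * (1 - z\<^sup>2) / (theta_den z)\<^sup>2) (at z)"
proof -
  have num: "(theta_num has_field_derivative (2 * (1 + z) + \<i> * (2 * (1 - z)))) (at z)"
    unfolding theta_num_def by (auto intro!: derivative_eq_intros simp: algebra_simps)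
  have den: "(theta_den has_field_derivative (2 * (1 + z) - \<i> * (2 * (1 - z)))) (at z)"
    unfolding theta_den_def by (auto intro!: derivative_eq_intros simp: algebra_simps)
  have "((\<lambda>z. theta_num z / theta_den z) has_field_derivative
      ((2 * (1 + z) + \<i> * (2 * (1 - z))) * theta_den z - theta_num z * (2 * (1 + z) - \<i> * (2 * (1 - z)))) /
        (theta_den z * theta_den z)) (at z)"
    by (rule DERIV_divide[OF num den assms])
  moreover have "(2 * (1 + z) + \<i> * (2 * (1 - z))) * theta_den z - theta_num z * (2 * (1 + z) - \<i> * (2 * (1 - z))) =
      8 * \<i> * (1 - z\<^sup>2)"
    unfolding theta_den_def theta_num_def power2_eq_square by algebra
  moreover have "theta_map = (\<lambda>z. theta_num z / theta_den z)" by (simp add: theta_map_eq fun_eq_iff)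
  ultimately show ?thesis by (simp add: power2_eq_square)
qed

section \<open>Corners of the half disc and the pullback of \<gamma>\<close>

context
  fixes \<alpha> :: real
  assumes \<alpha>: "0 < \<alpha>" "\<alpha> < pi / 2"
begin

text \<open>\<open>theta_map\<close> fixes both corners. With
  \<open>t = tan (pi / 4 - \<alpha> / 2)\<close> the value
  \<open>(1 + \<i> * t) / (1 - \<i> * t)\<close> of \<open>sigma_map\<close> at \<open>1\<close> has
  argument \<open>pi / 2 - \<alpha>\<close>, and the value at \<open>-1\<close> is its mirror
  image.\<close>

lemma psi_endpoints: "psi \<alpha> 1 = cis (pi / 2 - \<alpha>)" "psi \<alpha> (- 1) = cis (pi / 2 + \<alpha>)"
proof -
  let ?t = "sigma_t \<alpha>"
  have q: "1 + ?t\<^sup>2 > 0" by (simp add: add_pos_nonneg)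
  have d: "1 - \<i> * ?t \<noteq> 0" "1 + \<i> * ?t \<noteq> 0" by (auto simp: complex_eq_iff)
  have r: "(1 - \<i> * ?t) * (1 + \<i> * ?t) = of_real (1 + ?t\<^sup>2)" by (simp add: power2_eq_square algebra_simps)
  have th: "theta_map 1 = 1" "theta_map (- 1) = - 1" by (simp_all add: theta_map_def)
  have "psi \<alpha> 1 = (1 + \<i> * ?t) / (1 - \<i> * ?t)"
    by (simp add: psi_def th sigma_map_eq[OF \<alpha>])
  also have "\<dots> = (1 + \<i> * ?t) * (1 + \<i> * ?t) / ((1 - \<i> * ?t) * (1 + \<i> * ?t))"
    by (rule mult_divide_mult_cancel_right[OF d(2), symmetric])
  also have "\<dots> = cis (pi / 2 - \<alpha>)"
    unfolding r by (auto simp: complex_eq_iff Re_divide_of_real Im_divide_of_real sigma_t[OF \<alpha>] cos_diff sin_diff power2_eq_square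
        simp del: of_real_add)
  finally show "psi \<alpha> 1 = cis (pi / 2 - \<alpha>)" .
  have "psi \<alpha> (- 1) = (- 1 + \<i> * ?t) / (1 + \<i> * ?t)"
    by (simp add: psi_def th sigma_map_eq[OF \<alpha>])
  also have "\<dots> = (- 1 + \<i> * ?t) * (1 - \<i> * ?t) / ((1 + \<i> * ?t) * (1 - \<i> * ?t))"
    by (rule mult_divide_mult_cancel_right[OF d(1), symmetric])
  also have "\<dots> = (- 1 + \<i> * ?t) * (1 - \<i> * ?t) / of_real (1 + ?t\<^sup>2)"
    using r by (simp only: mult.commute)
  also have "\<dots> = cis (pi / 2 + \<alpha>)"
    by (auto simp: complex_eq_iff Re_divide_of_real Im_divide_of_real sigma_t[OF \<alpha>] cos_add sin_add power2_eq_square minus_divide_left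
        simp del: of_real_add)
  finally show "psi \<alpha> (- 1) = cis (pi / 2 + \<alpha>)" .
qed

lemma sigma_has_derivative:
  assumes "cmod z \<le> 1"
  shows "(sigma_map \<alpha> has_field_derivative of_real (1 - (sigma_t \<alpha>)\<^sup>2) / (1 - \<i> * sigma_t \<alpha> * z)\<^sup>2) (at z)"
proof -
  have "((\<lambda>z. (z + \<i> * sigma_t \<alpha>) / (1 - \<i> * sigma_t \<alpha> * z)) has_field_derivative
      (1 * (1 - \<i> * sigma_t \<alpha> * z) - (z + \<i> * sigma_t \<alpha>) * (- (\<i> * sigma_t \<alpha>))) /
        ((1 - \<i> * sigma_t \<alpha> * z) * (1 - \<i> * sigma_t \<alpha> * z))) (at z)"
    using sigma_den_nonzero[OF \<alpha> assms]
    by (intro DERIV_divide) (auto intro!: derivative_eq_intros)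
  moreover have "1 * (1 - \<i> * sigma_t \<alpha> * z) - (z + \<i> * sigma_t \<alpha>) * (- (\<i> * sigma_t \<alpha>)) = of_real (1 - (sigma_t \<alpha>)\<^sup>2)"
    by (simp add: power2_eq_square algebra_simps)
  moreover have "sigma_map \<alpha> = (\<lambda>z. (z + \<i> * sigma_t \<alpha>) / (1 - \<i> * sigma_t \<alpha> * z))"
    by (simp add: sigma_map_eq[OF \<alpha>] fun_eq_iff)
  ultimately show ?thesis by (simp only: power2_eq_square)
qed

text \<open>The denominators in the derivatives of sigma and theta are squares of quantities of
  modulus at most \<open>2\<close> and \<open>8\<close>, and
  \<open>8 / (4 * 64) = 1 / 32\<close>.\<close>

lemma psi_deriv_lower_bound:
  assumes z: "z \<in> half_disc"
  shows "(1 - (sigma_t \<alpha>)\<^sup>2) * cmod (1 - z\<^sup>2) / 32 \<le> cmod (deriv (psi \<alpha>) z)"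
proof -
  let ?t = "sigma_t \<alpha>" and ?\<theta> = "theta_map z"
  have zz: "cmod z \<le> 1" "0 \<le> Im z" using z by (auto simp: half_disc_def)
  have t: "0 < ?t" "?t < 1" by (rule sigma_t[OF \<alpha>])+
  have s: "0 < 1 - ?t\<^sup>2" using t abs_square_less_1[of ?t] by simp
  have \<theta>: "cmod ?\<theta> \<le> 1" by (rule theta_cmod(1)[OF zz])
  have "(psi \<alpha> has_field_derivative
      (of_real (1 - ?t\<^sup>2) / (1 - \<i> * ?t * ?\<theta>)\<^sup>2) * (8 * \<i> * (1 - z\<^sup>2) / (theta_den z)\<^sup>2)) (at z)"
    unfolding psi_def by (rule DERIV_chain[OF sigma_has_derivative[OF \<theta>] theta_has_derivative[OF theta_den_nonzero[OF zz]]])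
  then have "deriv (psi \<alpha>) z = (of_real (1 - ?t\<^sup>2) / (1 - \<i> * ?t * ?\<theta>)\<^sup>2) * (8 * \<i> * (1 - z\<^sup>2) / (theta_den z)\<^sup>2)"
    by (rule DERIV_imp_deriv)
  moreover have "cmod (complex_of_real (1 - ?t\<^sup>2)) = 1 - ?t\<^sup>2"
    using s by (simp only: norm_of_real abs_of_pos)
  ultimately have "cmod (deriv (psi \<alpha>) z) = ((1 - ?t\<^sup>2) / (cmod (1 - \<i> * ?t * ?\<theta>))\<^sup>2) * (8 * cmod (1 - z\<^sup>2) / (cmod (theta_den z))\<^sup>2)"
    by (simp add: norm_mult norm_divide norm_power del: of_real_diff of_real_power)
  moreover have "(1 - ?t\<^sup>2) / 4 \<le> (1 - ?t\<^sup>2) / (cmod (1 - \<i> * ?t * ?\<theta>))\<^sup>2"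
  proof -
    have "cmod (\<i> * ?t * ?\<theta>) \<le> 1" using t \<theta> by (simp add: norm_mult mult_le_one)
    then have "cmod (1 - \<i> * ?t * ?\<theta>) \<le> 2" using norm_triangle_ineq4[of 1 "\<i> * ?t * ?\<theta>"] by simp
    then have "(cmod (1 - \<i> * ?t * ?\<theta>))\<^sup>2 \<le> 4" using power_mono[of "cmod (1 - \<i> * ?t * ?\<theta>)" 2 2] by simp
    then show ?thesis using s sigma_den_nonzero[OF \<alpha> \<theta>] by (intro divide_left_mono) auto
  qed
  moreover have "8 * cmod (1 - z\<^sup>2) / 64 \<le> 8 * cmod (1 - z\<^sup>2) / (cmod (theta_den z))\<^sup>2"
  proof -
    have "cmod (1 + z) \<le> 2" "cmod (1 - z) \<le> 2"
      using norm_triangle_ineq[of 1 z] norm_triangle_ineq4[of 1 z] zz by auto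
    then have "(cmod (1 + z))\<^sup>2 \<le> 4" "(cmod (1 - z))\<^sup>2 \<le> 4"
      using power_mono[of "cmod (1 + z)" 2 2] power_mono[of "cmod (1 - z)" 2 2] by auto
    then have "cmod (theta_den z) \<le> 8"
      using norm_triangle_ineq[of "(1 + z)\<^sup>2" "\<i> * (1 - z)\<^sup>2"] by (simp add: theta_den_def norm_mult norm_power)
    then have "(cmod (theta_den z))\<^sup>2 \<le> 64" using power_mono[of "cmod (theta_den z)" 8 2] by simp
    then show ?thesis using theta_den_nonzero[OF zz] by (intro divide_left_mono) auto
  qed
  ultimately have "(1 - ?t\<^sup>2) / 4 * (8 * cmod (1 - z\<^sup>2) / 64) \<le> cmod (deriv (psi \<alpha>) z)"
    using s by (metis mult_mono divide_nonneg_nonneg less_imp_le mult_nonneg_nonneg norm_ge_zero zero_le_numeral zero_le_power2)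
  then show ?thesis by simp
qed

text \<open>Points of the disc outside \<open>U\<close> come from the compact set \<open>K\<close>,
  which misses both corners, so \<open>1 - z^2\<close> is bounded away from \<open>0\<close>
  there.\<close>

lemma psi_inv_deriv_bounded:
  assumes U: "open U" "cis (pi / 2 - \<alpha>) \<in> U" "cis (pi / 2 + \<alpha>) \<in> U"
  obtains B where "\<And>\<zeta>. \<zeta> \<in> disc - U \<Longrightarrow> cmod (deriv (psi_inv \<alpha>) \<zeta>) \<le> B"
proof -
  let ?s = "1 - (sigma_t \<alpha>)\<^sup>2"
  have s: "0 < ?s" using sigma_t[OF \<alpha>] abs_square_less_1[of "sigma_t \<alpha>"] by simp
  define K where "K = closure half_disc \<inter> psi \<alpha> -` (- U)"
  have "closed K"
    unfolding K_def using U(1) by (intro continuous_closed_preimage psi_continuous[OF \<alpha>]) auto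
  have "compact K"
  proof -
    have "closure half_disc \<inter> K = K" by (auto simp: K_def)
    then show ?thesis using compact_Int_closed[OF compact_closure_half_disc \<open>closed K\<close>] by simp
  qed
  have ne: "1 - z\<^sup>2 \<noteq> 0" if "z \<in> K" for z
  proof
    assume "1 - z\<^sup>2 = 0"
    then have "z = 1 \<or> z = - 1" by (simp add: power2_eq_1_iff eq_commute[of 1])
    then show False using that U(2,3) psi_endpoints by (auto simp: K_def)
  qed
  obtain \<delta> where \<delta>: "0 < \<delta>" "\<And>z. z \<in> K \<Longrightarrow> \<delta> \<le> cmod (1 - z\<^sup>2)"
  proof (cases "K = {}")
    case True
    then show ?thesis using that[of 1] by simp
  next
    case False
    have "continuous_on K (\<lambda>z. cmod (1 - z\<^sup>2))" by (intro continuous_intros)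
    then obtain z0 where "z0 \<in> K" "\<And>z. z \<in> K \<Longrightarrow> cmod (1 - z0\<^sup>2) \<le> cmod (1 - z\<^sup>2)"
      using continuous_attains_inf[OF \<open>compact K\<close> False] by blast
    then show ?thesis using that[of "cmod (1 - z0\<^sup>2)"] ne by simp
  qed
  have "cmod (deriv (psi_inv \<alpha>) \<zeta>) \<le> 32 / (?s * \<delta>)" if \<zeta>: "\<zeta> \<in> disc - U" for \<zeta>
  proof -
    define z where "z = psi_inv \<alpha> \<zeta>"
    have z: "z \<in> half_disc" "psi \<alpha> z = \<zeta>"
      using \<zeta> psi_inv_in_half_disc[OF \<alpha>] psi_psi_inv[OF \<alpha>, of \<zeta>] by (auto simp: z_def)
    then have "z \<in> K" using closure_subset[of half_disc] \<zeta> by (auto simp: K_def)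
    then have "?s * \<delta> / 32 \<le> ?s * cmod (1 - z\<^sup>2) / 32" using \<delta>(2) s by (intro divide_right_mono mult_left_mono) auto
    also have "\<dots> \<le> cmod (deriv (psi \<alpha>) z)" by (rule psi_deriv_lower_bound[OF z(1)])
    finally have l: "?s * \<delta> / 32 \<le> cmod (deriv (psi \<alpha>) z)" .
    have "cmod (deriv (psi \<alpha>) z) * cmod (deriv (psi_inv \<alpha>) \<zeta>) = 1"
      using psi_inv_deriv[OF \<alpha> z(1)] z(2) by (metis norm_mult norm_one)
    then have "(?s * \<delta> / 32) * cmod (deriv (psi_inv \<alpha>) \<zeta>) \<le> 1"
      using mult_right_mono[OF l, of "cmod (deriv (psi_inv \<alpha>) \<zeta>)"] by simp
    then show ?thesis using s \<delta>(1) by (simp add: pos_le_divide_eq mult_ac)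
  qed
  then show ?thesis using that by blast
qed

lemma disc_half_disc_integrable:
  fixes f :: "complex \<Rightarrow> real"
  shows "integrable (lebesgue_on disc) f \<longleftrightarrow> integrable (lebesgue_on half_disc) (\<lambda>z. (cmod (deriv (psi \<alpha>) z))\<^sup>2 * f (psi \<alpha> z))"
    and "(LINT z|lebesgue_on disc. f z) = (LINT z|lebesgue_on half_disc. (cmod (deriv (psi \<alpha>) z))\<^sup>2 * f (psi \<alpha> z))"
  using conformal_change_of_variables[OF open_half_disc psi_holomorphic[OF \<alpha>] psi_inj_half_disc[OF \<alpha>], of f]
  unfolding psi_image_half_disc[OF \<alpha>] by auto

text \<open>Substitution turns the squared norm of the pullback into the integral of
  \<open>\<gamma>^2\<close> against the squared modulus of the derivative of \<open>psi_inv\<close>,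
  a weight that is bounded outside \<open>U\<close>.\<close>

lemma L2_comp_psi:
  assumes \<gamma>: "L2_fun (lebesgue_on disc) \<gamma>"
    and U: "open U" "cis (pi / 2 - \<alpha>) \<in> U" "cis (pi / 2 + \<alpha>) \<in> U"
    and ae: "AE z in lebesgue_on disc. z \<in> U \<longrightarrow> \<gamma> z = (0::real)"
  shows "L2_fun (lebesgue_on half_disc) (\<lambda>z. \<gamma> (psi \<alpha> z))"
proof -
  have fin: "finite_measure (lebesgue_on disc)" by (rule finite_measure_lebesgue_on_bounded) auto
  have dl: "disc \<in> sets lebesgue" by auto
  have hl: "half_disc \<in> sets lebesgue" using open_half_disc by auto
  have dc: "continuous_on half_disc (deriv (psi \<alpha>))"
    using psi_holomorphic[OF \<alpha>] open_half_disc by (intro holomorphic_on_imp_continuous_on holomorphic_deriv)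
  have ic: "continuous_on disc (deriv (psi_inv \<alpha>))"
    using psi_inv_holomorphic[OF \<alpha>] by (intro holomorphic_on_imp_continuous_on holomorphic_deriv) auto
  have i: "integrable (lebesgue_on half_disc) (\<lambda>z. (cmod (deriv (psi \<alpha>) z))\<^sup>2 * \<gamma> (psi \<alpha> z))"
    using L2_fun_integrable[OF fin \<gamma>] disc_half_disc_integrable(1)[of \<gamma>] by simp
  \<comment> \<open>Measurability of the pullback comes from the change of variables: it makes the
    product with the Jacobian integrable, and the Jacobian vanishes nowhere on the half
    disc.\<close>
  have "(\<lambda>z. 1 / (cmod (deriv (psi \<alpha>) z))\<^sup>2) \<in> borel_measurable (lebesgue_on half_disc)"
    using psi_deriv_nonzero[OF \<alpha>]
    by (intro continuous_imp_measurable_on_sets_lebesgue[OF _ hl] continuous_intros dc) auto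
  from borel_measurable_times[OF this borel_measurable_integrable[OF i]]
  have "(\<lambda>z. 1 / (cmod (deriv (psi \<alpha>) z))\<^sup>2 * ((cmod (deriv (psi \<alpha>) z))\<^sup>2 * \<gamma> (psi \<alpha> z))) \<in> borel_measurable (lebesgue_on half_disc)" .
  then have meas: "(\<lambda>z. \<gamma> (psi \<alpha> z)) \<in> borel_measurable (lebesgue_on half_disc)"
    by (rule measurable_cong[THEN iffD1, rotated]) (use psi_deriv_nonzero[OF \<alpha>] in auto)
  obtain B where B: "\<And>\<zeta>. \<zeta> \<in> disc - U \<Longrightarrow> cmod (deriv (psi_inv \<alpha>) \<zeta>) \<le> B"
    using psi_inv_deriv_bounded[OF U] by blast
  have "integrable (lebesgue_on disc) (\<lambda>\<zeta>. (\<gamma> \<zeta>)\<^sup>2 * (cmod (deriv (psi_inv \<alpha>) \<zeta>))\<^sup>2)"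
  proof (rule Bochner_Integration.integrable_bound)
    show "integrable (lebesgue_on disc) (\<lambda>\<zeta>. (\<gamma> \<zeta>)\<^sup>2 * B\<^sup>2)"
      using \<gamma> by (simp add: L2_fun_real)
    have "(\<lambda>\<zeta>. (cmod (deriv (psi_inv \<alpha>) \<zeta>))\<^sup>2) \<in> borel_measurable (lebesgue_on disc)"
      by (intro continuous_imp_measurable_on_sets_lebesgue[OF _ dl] continuous_intros ic)
    then show "(\<lambda>\<zeta>. (\<gamma> \<zeta>)\<^sup>2 * (cmod (deriv (psi_inv \<alpha>) \<zeta>))\<^sup>2) \<in> borel_measurable (lebesgue_on disc)"
      using \<gamma> by (auto simp: L2_fun_real)
    show "AE \<zeta> in lebesgue_on disc. norm ((\<gamma> \<zeta>)\<^sup>2 * (cmod (deriv (psi_inv \<alpha>) \<zeta>))\<^sup>2) \<le> norm ((\<gamma> \<zeta>)\<^sup>2 * B\<^sup>2)"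
      using ae AE_space
    proof eventually_elim
      case (elim \<zeta>)
      show ?case
      proof (cases "\<zeta> \<in> U")
        case False
        then have "cmod (deriv (psi_inv \<alpha>) \<zeta>) \<le> B" using elim by (intro B) auto
        then have "(cmod (deriv (psi_inv \<alpha>) \<zeta>))\<^sup>2 \<le> B\<^sup>2" by (intro power_mono) auto
        then show ?thesis by (simp add: abs_mult mult_left_mono)
      qed (use elim in simp)
    qed
  qed
  then have "integrable (lebesgue_on half_disc)
      (\<lambda>z. (cmod (deriv (psi \<alpha>) z))\<^sup>2 * ((\<gamma> (psi \<alpha> z))\<^sup>2 * (cmod (deriv (psi_inv \<alpha>) (psi \<alpha> z)))\<^sup>2))"
    by (simp only: disc_half_disc_integrable(1))
  moreover have "(cmod (deriv (psi \<alpha>) z))\<^sup>2 * ((\<gamma> (psi \<alpha> z))\<^sup>2 * (cmod (deriv (psi_inv \<alpha>) (psi \<alpha> z)))\<^sup>2) = (\<gamma> (psi \<alpha> z))\<^sup>2"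
    if "z \<in> space (lebesgue_on half_disc)" for z
  proof -
    have "z \<in> half_disc" using that by simp
    then have "cmod (deriv (psi \<alpha>) z) * cmod (deriv (psi_inv \<alpha>) (psi \<alpha> z)) = 1"
      using psi_inv_deriv[OF \<alpha>, of z] by (metis norm_mult norm_one)
    then have "(cmod (deriv (psi \<alpha>) z) * cmod (deriv (psi_inv \<alpha>) (psi \<alpha> z)))\<^sup>2 = 1" by simp
    then show ?thesis by (simp add: power_mult_distrib mult_ac)
  qed
  ultimately have "integrable (lebesgue_on half_disc) (\<lambda>z. (\<gamma> (psi \<alpha> z))\<^sup>2)"
    by (subst (asm) Bochner_Integration.integrable_cong[OF refl])
  then show ?thesis using meas by (simp add: L2_fun_real)
qed

section \<open>The pairing of the sine data and its moments\<close>

lemma psi_inv_power_deriv: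
  assumes z: "z \<in> half_disc"
  shows "deriv (psi \<alpha>) z * deriv (\<lambda>\<zeta>. psi_inv \<alpha> \<zeta> ^ n) (psi \<alpha> z) = of_nat n * z ^ (n - 1)"
proof -
  have "psi \<alpha> z \<in> disc" using psi_image_half_disc[OF \<alpha>] z by blast
  then have "(psi_inv \<alpha> has_field_derivative deriv (psi_inv \<alpha>) (psi \<alpha> z)) (at (psi \<alpha> z))"
    by (rule holomorphic_derivI[OF psi_inv_holomorphic[OF \<alpha>] open_ball])
  then have "((\<lambda>\<zeta>. psi_inv \<alpha> \<zeta> ^ n) has_field_derivative
      of_nat n * (deriv (psi_inv \<alpha>) (psi \<alpha> z) * psi_inv \<alpha> (psi \<alpha> z) ^ (n - Suc 0))) (at (psi \<alpha> z))"
    by (rule DERIV_power)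
  then have "deriv (\<lambda>\<zeta>. psi_inv \<alpha> \<zeta> ^ n) (psi \<alpha> z) =
      of_nat n * (deriv (psi_inv \<alpha>) (psi \<alpha> z) * psi_inv \<alpha> (psi \<alpha> z) ^ (n - Suc 0))"
    by (rule DERIV_imp_deriv)
  moreover have "psi_inv \<alpha> (psi \<alpha> z) = z"
    using psi_inv_psi[OF \<alpha>, of z] z closure_subset[of half_disc] by auto
  \<comment> \<open>For \<open>n = 0\<close> the truncated exponent is harmless, as the factor
    \<open>n\<close> vanishes.\<close>
  ultimately have "deriv (psi \<alpha>) z * deriv (\<lambda>\<zeta>. psi_inv \<alpha> \<zeta> ^ n) (psi \<alpha> z) =
      (deriv (psi \<alpha>) z * deriv (psi_inv \<alpha>) (psi \<alpha> z)) * (of_nat n * z ^ (n - 1))" by (simp add: mult_ac)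
  then show ?thesis using psi_inv_deriv[OF \<alpha> z] by simp
qed

lemma psi_inv_power_holomorphic: "(\<lambda>\<zeta>. psi_inv \<alpha> \<zeta> ^ n) holomorphic_on disc"
  by (intro holomorphic_intros psi_inv_holomorphic[OF \<alpha>])

text \<open>The derivative of \<open>psi_inv\<close> blows up at the endpoints of the arc.
  Finiteness of the Dirichlet integral is therefore read off on the half disc, where the integrand
  becomes the square of \<open>cmod (n * z ^ (n - 1))\<close>, which is bounded.\<close>

lemma sine_solution:
  shows "H1_with_gradient disc (\<lambda>\<zeta>. Im (psi_inv \<alpha> \<zeta> ^ n)) (grad (\<lambda>\<zeta>. Im (psi_inv \<alpha> \<zeta> ^ n)))"
    and "has_trace (\<lambda>\<zeta>. Im (psi_inv \<alpha> \<zeta> ^ n)) (ext0 (circ_arc \<alpha>) (sine_data \<alpha> n))"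
    and "harmonic_on disc (\<lambda>\<zeta>. Im (psi_inv \<alpha> \<zeta> ^ n))"
proof -
  let ?F = "\<lambda>\<zeta>. psi_inv \<alpha> \<zeta> ^ n"
  have hl: "half_disc \<in> sets lebesgue" using open_half_disc by auto
  interpret finite_measure "lebesgue_on half_disc" by (rule finite_measure_half_disc)
  have Fc: "continuous_on (cball 0 1) ?F" by (intro continuous_intros psi_inv_continuous[OF \<alpha>])
  have eq: "(cmod (deriv (psi \<alpha>) z))\<^sup>2 * (cmod (deriv ?F (psi \<alpha> z)))\<^sup>2 = (cmod (of_nat n * z ^ (n - 1)))\<^sup>2"
    if "z \<in> space (lebesgue_on half_disc)" for z
  proof -
    have "z \<in> half_disc" using that by simp
    from psi_inv_power_deriv[OF this, of n] show ?thesis by (metis norm_mult power_mult_distrib)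
  qed
  have "integrable (lebesgue_on half_disc) (\<lambda>z. (cmod (of_nat n * z ^ (n - 1)))\<^sup>2)"
  proof (rule integrable_const_bound[where B = "(real n)\<^sup>2"])
    show "AE z in lebesgue_on half_disc. norm ((cmod (of_nat n * z ^ (n - 1)))\<^sup>2) \<le> (real n)\<^sup>2"
    proof (rule AE_I2)
      fix z assume "z \<in> space (lebesgue_on half_disc)"
      then have "cmod z \<le> 1" by (auto simp: half_disc_def)
      then have "cmod (of_nat n * z ^ (n - 1)) \<le> real n"
        by (simp add: norm_mult norm_power mult_left_le power_le_one)
      then show "norm ((cmod (of_nat n * z ^ (n - 1)))\<^sup>2) \<le> (real n)\<^sup>2"
        using power_mono[of "cmod (of_nat n * z ^ (n - 1))" "real n" 2] by simp
    qed
    show "(\<lambda>z. (cmod (of_nat n * z ^ (n - 1)))\<^sup>2) \<in> borel_measurable (lebesgue_on half_disc)"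
      by (intro continuous_imp_measurable_on_sets_lebesgue[OF _ hl] continuous_intros)
  qed
  then have "integrable (lebesgue_on half_disc) (\<lambda>z. (cmod (deriv (psi \<alpha>) z))\<^sup>2 * (cmod (deriv ?F (psi \<alpha> z)))\<^sup>2)"
    by (subst Bochner_Integration.integrable_cong[OF refl eq])
  then have int: "integrable (lebesgue_on disc) (\<lambda>z. (cmod (deriv ?F z))\<^sup>2)"
    by (simp only: disc_half_disc_integrable(1))
  have b: "ext0 (circ_arc \<alpha>) (sine_data \<alpha> n) (cis t) = Im (?F (cis t))" for t
    by (rule sine_data_eq[OF \<alpha>]) simp
  show "H1_with_gradient disc (\<lambda>\<zeta>. Im (?F \<zeta>)) (grad (\<lambda>\<zeta>. Im (?F \<zeta>)))"
    and "has_trace (\<lambda>\<zeta>. Im (?F \<zeta>)) (ext0 (circ_arc \<alpha>) (sine_data \<alpha> n))"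
    by (rule has_trace_Im_holomorphic[OF psi_inv_power_holomorphic Fc int refl b])+
  show "harmonic_on disc (\<lambda>\<zeta>. Im (?F \<zeta>))"
    by (rule harmonic_on_Im_holomorphic[OF open_ball psi_inv_power_holomorphic refl])
qed

text \<open>An explicit solution shows that the \<open>SOME\<close> choice satisfies its defining
  conditions, and uniqueness identifies it with that solution on the disc.\<close>

lemma harmonic_ext_sine:
  assumes "\<zeta> \<in> disc"
  shows "harmonic_ext (circ_arc \<alpha>) (sine_data \<alpha> n) \<zeta> = Im (psi_inv \<alpha> \<zeta> ^ n)"
proof -
  define P where "P u \<longleftrightarrow> harmonic_on disc u \<and> H1 disc u \<and> has_trace u (ext0 (circ_arc \<alpha>) (sine_data \<alpha> n))" for u
  have "P (\<lambda>\<zeta>. Im (psi_inv \<alpha> \<zeta> ^ n))" using sine_solution[of n] by (auto simp: P_def H1_def)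
  then have "P (Eps P)" by (rule someI[of P])
  moreover have "harmonic_ext (circ_arc \<alpha>) (sine_data \<alpha> n) = Eps P"
    by (simp add: harmonic_ext_def P_def[abs_def])
  ultimately have "harmonic_on disc (harmonic_ext (circ_arc \<alpha>) (sine_data \<alpha> n))"
    "has_trace (harmonic_ext (circ_arc \<alpha>) (sine_data \<alpha> n)) (ext0 (circ_arc \<alpha>) (sine_data \<alpha> n))"
    by (auto simp: P_def)
  then show ?thesis by (rule harmonic_trace_unique) (use sine_solution[of n] assms in auto)
qed

text \<open>The Jacobian of psi is absorbed by the two gradients: multiplied by the derivative of
  psi, each derivative of a power of \<open>psi_inv\<close> becomes that of a plain power of
  \<open>z\<close>.\<close>

lemma dtn_lin_sine:
  assumes L2: "L2_fun (lebesgue_on half_disc) (\<lambda>z. \<gamma> (psi \<alpha> z))"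
  shows "dtn_lin_defined (circ_arc \<alpha>) \<gamma> (sine_data \<alpha> m) (sine_data \<alpha> n)"
    and "dtn_lin (circ_arc \<alpha>) \<gamma> (sine_data \<alpha> m) (sine_data \<alpha> n) =
      real m * real n * (LINT z|lebesgue_on half_disc. \<gamma> (psi \<alpha> z) * Re (z ^ (m - 1) * cnj (z ^ (n - 1))))"
proof -
  have hl: "half_disc \<in> sets lebesgue" using open_half_disc by auto
  let ?u = "\<lambda>n. harmonic_ext (circ_arc \<alpha>) (sine_data \<alpha> n)" and ?F = "\<lambda>n \<zeta>. psi_inv \<alpha> \<zeta> ^ n"
  let ?f = "\<lambda>\<zeta>. \<gamma> \<zeta> * (grad (?u m) \<zeta> \<bullet> grad (?u n) \<zeta>)"
  have g: "grad (?u n) \<zeta> = \<i> * cnj (deriv (?F n) \<zeta>)" if "\<zeta> \<in> disc" for n \<zeta>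
    by (rule grad_Im_holomorphic[OF open_ball psi_inv_power_holomorphic harmonic_ext_sine that])
  have eq: "(cmod (deriv (psi \<alpha>) z))\<^sup>2 * ?f (psi \<alpha> z) =
      real m * real n * (\<gamma> (psi \<alpha> z) * Re (z ^ (m - 1) * cnj (z ^ (n - 1))))"
    if "z \<in> space (lebesgue_on half_disc)" for z
  proof -
    have z: "z \<in> half_disc" using that by simp
    then have "psi \<alpha> z \<in> disc" using psi_image_half_disc[OF \<alpha>] by blast
    let ?p = "deriv (psi \<alpha>) z" and ?a = "deriv (?F m) (psi \<alpha> z)" and ?b = "deriv (?F n) (psi \<alpha> z)"
    have "(cmod ?p)\<^sup>2 * Re (?a * cnj ?b) = Re (of_real ((cmod ?p)\<^sup>2) * (?a * cnj ?b))"
      by (simp del: of_real_power)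
    also have "of_real ((cmod ?p)\<^sup>2) * (?a * cnj ?b) = (?p * ?a) * cnj (?p * ?b)"
      unfolding complex_norm_square by simp
    also have "\<dots> = of_real (real m * real n) * (z ^ (m - 1) * cnj (z ^ (n - 1)))"
      unfolding psi_inv_power_deriv[OF z] by simp
    also have "Re \<dots> = real m * real n * Re (z ^ (m - 1) * cnj (z ^ (n - 1)))"
      by (simp del: of_real_mult complex_cnj_power)
    finally have "(cmod ?p)\<^sup>2 * Re (?a * cnj ?b) = real m * real n * Re (z ^ (m - 1) * cnj (z ^ (n - 1)))" .
    moreover have "grad (?u m) (psi \<alpha> z) \<bullet> grad (?u n) (psi \<alpha> z) = Re (?a * cnj ?b)"
      unfolding g[OF \<open>psi \<alpha> z \<in> disc\<close>] by (rule inner_grad_eq)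
    ultimately show ?thesis by (metis mult.left_commute mult.assoc)
  qed
  have "L2_fun (lebesgue_on half_disc) (\<lambda>z. Re (z ^ (m - 1) * cnj (z ^ (n - 1))))"
  proof (rule L2_fun_bounded[OF finite_measure_half_disc, where B = 1])
    show "(\<lambda>z. Re (z ^ (m - 1) * cnj (z ^ (n - 1)))) \<in> borel_measurable (lebesgue_on half_disc)"
      by (intro continuous_imp_measurable_on_sets_lebesgue[OF _ hl] continuous_intros)
    fix z assume "z \<in> space (lebesgue_on half_disc)"
    then have "cmod z \<le> 1" by (auto simp: half_disc_def)
    then have "cmod (z ^ (m - 1) * cnj (z ^ (n - 1))) \<le> 1"
      by (simp add: norm_mult norm_power power_le_one mult_le_one)
    then show "norm (Re (z ^ (m - 1) * cnj (z ^ (n - 1)))) \<le> 1"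
      using abs_Re_le_cmod order.trans unfolding real_norm_def by blast
  qed
  from L2_fun_mult_integrable[OF L2 this]
  have "integrable (lebesgue_on half_disc) (\<lambda>z. real m * real n * (\<gamma> (psi \<alpha> z) * Re (z ^ (m - 1) * cnj (z ^ (n - 1)))))"
    by (rule integrable_mult_right)
  then have "integrable (lebesgue_on half_disc) (\<lambda>z. (cmod (deriv (psi \<alpha>) z))\<^sup>2 * ?f (psi \<alpha> z))"
    by (subst Bochner_Integration.integrable_cong[OF refl eq])
  then have "integrable (lebesgue_on disc) ?f" by (simp only: disc_half_disc_integrable(1))
  moreover have "H_half (ext0 (circ_arc \<alpha>) (sine_data \<alpha> n))" for n
    unfolding H_half_def H1_def using sine_solution[of n] by blast
  ultimately show "dtn_lin_defined (circ_arc \<alpha>) \<gamma> (sine_data \<alpha> m) (sine_data \<alpha> n)"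
    by (simp add: dtn_lin_defined_def)
  have "dtn_lin (circ_arc \<alpha>) \<gamma> (sine_data \<alpha> m) (sine_data \<alpha> n) =
      (LINT z|lebesgue_on half_disc. (cmod (deriv (psi \<alpha>) z))\<^sup>2 * ?f (psi \<alpha> z))"
    unfolding dtn_lin_def by (rule disc_half_disc_integrable(2))
  also have "\<dots> = (LINT z|lebesgue_on half_disc. real m * real n * (\<gamma> (psi \<alpha> z) * Re (z ^ (m - 1) * cnj (z ^ (n - 1)))))"
    by (rule Bochner_Integration.integral_cong[OF refl eq])
  also have "\<dots> = real m * real n * (LINT z|lebesgue_on half_disc. \<gamma> (psi \<alpha> z) * Re (z ^ (m - 1) * cnj (z ^ (n - 1))))"
    by (rule integral_mult_right_zero)
  finally show "dtn_lin (circ_arc \<alpha>) \<gamma> (sine_data \<alpha> m) (sine_data \<alpha> n) =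
      real m * real n * (LINT z|lebesgue_on half_disc. \<gamma> (psi \<alpha> z) * Re (z ^ (m - 1) * cnj (z ^ (n - 1))))" .
qed

text \<open>The denominator \<open>(l + 1) * (l + 1 + k)\<close> cancels the factor of the bilinear
  form, the two constants multiply to \<open>2 * (2 / pi)\<close>, and summing the moments with the
  weights \<open>c_coeff k l n\<close> reassembles \<open>L_poly n k\<close>.\<close>

lemma p_coeff_eq:
  assumes L2: "L2_fun (lebesgue_on half_disc) (\<lambda>z. \<gamma> (psi \<alpha> z))"
  shows "p_coeff \<alpha> \<gamma> n k = 4 * real (2 * n + k + 1) / pi *
    (LINT z|lebesgue_on half_disc. \<gamma> (psi \<alpha> z) * half_disc_basis k n z)"
proof -
  have hl: "half_disc \<in> sets lebesgue" using open_half_disc by auto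
  define J where "J l = (LINT z|lebesgue_on half_disc. \<gamma> (psi \<alpha> z) * (cmod z ^ (2 * l) * Re (z ^ k)))" for l
  have int: "integrable (lebesgue_on half_disc) (\<lambda>z. \<gamma> (psi \<alpha> z) * (cmod z ^ (2 * l) * Re (z ^ k)))" for l
  proof (rule L2_fun_mult_integrable[OF L2], rule L2_fun_bounded[OF finite_measure_half_disc, where B = 1])
    show "(\<lambda>z. cmod z ^ (2 * l) * Re (z ^ k)) \<in> borel_measurable (lebesgue_on half_disc)"
      by (intro continuous_imp_measurable_on_sets_lebesgue[OF _ hl] continuous_intros)
    fix z assume "z \<in> space (lebesgue_on half_disc)"
    then have z: "cmod z \<le> 1" by (auto simp: half_disc_def)
    then have "\<bar>Re (z ^ k)\<bar> \<le> 1"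
      using abs_Re_le_cmod[of "z ^ k"] power_le_one[of "cmod z" k] by (simp add: norm_power)
    then show "norm (cmod z ^ (2 * l) * Re (z ^ k)) \<le> 1"
      using z by (simp add: abs_mult power_le_one mult_le_one)
  qed
  have dtn: "2 * dtn_lin (circ_arc \<alpha>) \<gamma> (sine_data \<alpha> (l + 1)) (sine_data \<alpha> (l + k + 1)) /
           (real (l + 1) * real (l + 1 + k) * pi) = 2 / pi * J l" for l
  proof -
    have "dtn_lin (circ_arc \<alpha>) \<gamma> (sine_data \<alpha> (l + 1)) (sine_data \<alpha> (l + k + 1)) = real (l + 1) * real (l + 1 + k) * J l"
      unfolding dtn_lin_sine(2)[OF L2] J_def Re_power_cnj_power[symmetric] by (simp add: ac_simps)
    then show ?thesis by (simp del: of_nat_add)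
  qed
  have "p_coeff \<alpha> \<gamma> n k = (\<Sum>l=0..n. 4 * real (2 * n + k + 1) / pi * (c_coeff k l n * J l))"
    unfolding p_coeff_def dtn
  proof (rule sum.cong[OF refl])
    fix l assume "l \<in> {0..n}"
    then show "2 * (- 1) ^ (n - l) * real (2 * n + k + 1) * ((\<Prod>j<n. real (1 + k + l + j)) / (fact l * fact (n - l))) * (2 / pi * J l) =
        4 * real (2 * n + k + 1) / pi * (c_coeff k l n * J l)"
      by (simp add: c_coeff_eq mult_ac del: of_nat_add of_nat_mult of_nat_Suc)
  qed
  also have "\<dots> = 4 * real (2 * n + k + 1) / pi * (\<Sum>l=0..n. c_coeff k l n * J l)"
    by (rule sum_distrib_left[symmetric])
  also have "(\<Sum>l=0..n. c_coeff k l n * J l) =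
      (LINT z|lebesgue_on half_disc. (\<Sum>l=0..n. c_coeff k l n * (\<gamma> (psi \<alpha> z) * (cmod z ^ (2 * l) * Re (z ^ k)))))"
    using int by (simp add: J_def)
  also have "\<dots> = (LINT z|lebesgue_on half_disc. \<gamma> (psi \<alpha> z) * half_disc_basis k n z)"
    by (intro Bochner_Integration.integral_cong refl)
      (simp add: half_disc_basis_eq_sum sum_distrib_left mult.left_commute)
  finally show ?thesis .
qed

end

theorem mainTheorem5:
  fixes \<alpha> :: real and \<gamma> :: "complex \<Rightarrow> real"
  assumes "0 < \<alpha>" and "\<alpha> < pi / 2"
    and "L2_fun (lebesgue_on disc) \<gamma>"
    and "\<exists>U. open U \<and> cis (pi / 2 - \<alpha>) \<in> U \<and> cis (pi / 2 + \<alpha>) \<in> U \<and>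
           (AE z in lebesgue_on disc. z \<in> U \<longrightarrow> \<gamma> z = 0)"
  shows "(\<forall>m\<ge>1. \<forall>n\<ge>1. dtn_lin_defined (circ_arc \<alpha>) \<gamma> (sine_data \<alpha> m) (sine_data \<alpha> n)) \<and>
    (\<exists>S F.
       L2_sums (lebesgue_on half_disc)
         (\<lambda>n z. L_poly n 0 (cmod z) * p_coeff \<alpha> \<gamma> n 0) (S 0) \<and>
       (\<forall>k\<ge>1. L2_sums (lebesgue_on half_disc)
         (\<lambda>n z. L_poly n k (cmod z) * cos (real k * Arg z) * p_coeff \<alpha> \<gamma> n k) (S k)) \<and>
       L2_tendsto (lebesgue_on half_disc)
         (\<lambda>K z. 1 / 2 * S 0 z + (\<Sum>k=1..K. S k z)) F \<and>
       (AE z in lebesgue_on disc. \<gamma> z = F (psi_inv \<alpha> z)))"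
proof -
  note \<alpha> = assms(1,2)
  obtain U where U: "open U" "cis (pi / 2 - \<alpha>) \<in> U" "cis (pi / 2 + \<alpha>) \<in> U"
    "AE z in lebesgue_on disc. z \<in> U \<longrightarrow> \<gamma> z = 0"
    using assms(4) by blast
  have L2: "L2_fun (lebesgue_on half_disc) (\<lambda>z. \<gamma> (psi \<alpha> z))"
    by (rule L2_comp_psi[OF \<alpha> assms(3) U])
  \<comment> \<open>The witness for \<open>F\<close> is \<gamma> composed with psi, so the final
    identity holds at every point of the disc.\<close>
  have "AE z in lebesgue_on disc. \<gamma> z = \<gamma> (psi \<alpha> (psi_inv \<alpha> z))"
    using psi_psi_inv[OF \<alpha>] by (intro AE_I2) auto
  with half_disc_expansion[OF L2 p_coeff_eq[OF \<alpha> L2]] dtn_lin_sine(1)[OF \<alpha> L2]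
  show ?thesis by blast
qed

end
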